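(* Let $D_t\subseteq\mathbf{C}^2$, $|t|<\delta$, be a real analytic variation of domains, and let $f_t$ be a real analytic variation of CR Hartogs functions on the domains $D_t$, $|t|<\delta$. If CRH $=$ CR on $D_0$, then for every $t$ with $|t|<\delta$ the function $f_t$ is a CR function on $\partial D_t$.
   Context: Coordinates on $\mathbf{C}^2$ are $(z,w)$. All domains $D_t$ are bounded and strictly convex, and $D_0$ has real analytic boundary. A real analytic variation of $D_0$ is a family $D_t$, $|t|<\delta$, such that $\partial D_t$ is a real analytic graph over $\partial D_0$ in the normal bundle of $\partial D_0$ (identified with a neighborhood of $\partial D_0$): there is a real analytic $h:\partial D_0\times(-\delta,\delta)\to\mathbf{R}$ with $h(\cdot,0)=0$ such that $\partial D_t=\{x+h(x,t)\nu(x):x\in\partial D_0\}$, where $\nu$ is the unit normal of $\partial D_0$. A continuous function on the boundary of a strictly convex domain $D$ is CR Hartogs (CRH) if for every nonempty slice $D\cap L$ by a complex line $L=\{z=c\}$ or $L=\{w=c\}$, its restriction to $\partial D\cap L$ extends holomorphically to $D\cap L$. It is CR if it extends holomorphically (in all variables) to $D$. "CRH $=$ CR on $D_0$" means that every CR Hartogs function on $\partial D_0$ is CR. A real analytic variation of CR Hartogs functions on $D_t$ is a family $f_t=f(t,\cdot,\cdot)$, where $f$ is real analytic in $(z,w,t)$ on $U\times(-\delta,\delta)$, $U$ is a neighborhood of $\partial D_0$ with $\bigcup_t\partial D_t\subseteq U$, and for each $t$ the restriction of $f_t$ to $\partial D_t$ is a CR Hartogs function. *)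

theory Defs
  imports "HOL-Complex_Analysis.Complex_Analysis"
begin

text \<open>
  A function is real analytic on \<open>S\<close> if near each point of \<open>S\<close> it agrees on \<open>S\<close> with the sum of a
  power series in the real coordinates converging on a full ball. For open \<open>S\<close> this is the usual
  notion; for a real analytic submanifold \<open>S\<close> it says that the function is locally the restriction
  of an ambient real analytic function, i.e. that it is real analytic in charts. The index \<open>\<alpha>\<close>
  ranges over multi-indices.
\<close>

definition real_analytic_on ::
    "('a::euclidean_space \<Rightarrow> 'b::euclidean_space) \<Rightarrow> 'a set \<Rightarrow> bool" where
  "real_analytic_on f S \<longleftrightarrow>
     (\<forall>p\<in>S. \<exists>r>0. \<exists>(c :: ('a \<Rightarrow> nat) \<Rightarrow> 'b) F. \<forall>x\<in>ball p r.
        ((\<lambda>\<alpha>. (\<Prod>b\<in>Basis. ((x - p) \<bullet> b) ^ \<alpha> b) *\<^sub>R c \<alpha>) has_sum F x) (Basis \<rightarrow>\<^sub>E UNIV)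
        \<and> (x \<in> S \<longrightarrow> f x = F x))"

definition strictly_convex_domain :: "'a::euclidean_space set \<Rightarrow> bool" where
  "strictly_convex_domain D \<longleftrightarrow> open D \<and> D \<noteq> {} \<and>
     (\<forall>x\<in>closure D. \<forall>y\<in>closure D. x \<noteq> y \<longrightarrow> open_segment x y \<subseteq> D)"

text \<open>\<open>\<rho>\<close> is a real analytic defining function of \<open>D\<close> on the neighbourhood \<open>V\<close> of the boundary
  point \<open>p\<close>, with gradient \<open>g \<noteq> 0\<close> at \<open>p\<close>.\<close>

definition analytic_defining_function ::
    "'a::euclidean_space set \<Rightarrow> 'a \<Rightarrow> 'a set \<Rightarrow> ('a \<Rightarrow> real) \<Rightarrow> 'a \<Rightarrow> bool" where
  "analytic_defining_function D p V \<rho> g \<longleftrightarrow>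
     open V \<and> p \<in> V \<and> real_analytic_on \<rho> V \<and>
     V \<inter> D = {x\<in>V. \<rho> x < 0} \<and> V \<inter> frontier D = {x\<in>V. \<rho> x = 0} \<and>
     (\<rho> has_derivative (\<lambda>v. g \<bullet> v)) (at p) \<and> g \<noteq> 0"

definition has_real_analytic_boundary :: "'a::euclidean_space set \<Rightarrow> bool" where
  "has_real_analytic_boundary D \<longleftrightarrow>
     (\<forall>p\<in>frontier D. \<exists>V \<rho> g. analytic_defining_function D p V \<rho> g)"

text \<open>The outward unit normal field; the values of \<open>\<nu>\<close> off the boundary are irrelevant.\<close>

definition unit_normal_field :: "'a::euclidean_space set \<Rightarrow> ('a \<Rightarrow> 'a) \<Rightarrow> bool" where
  "unit_normal_field D \<nu> \<longleftrightarrow>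
     (\<forall>p\<in>frontier D. \<exists>V \<rho> g. analytic_defining_function D p V \<rho> g \<and> \<nu> p = sgn g)"

text \<open>
  Identification of the normal bundle of \<open>\<partial>D\<close> with a neighbourhood \<open>W\<close> of \<open>\<partial>D\<close>: the map
  \<open>(x, s) \<mapsto> x + s \<nu>(x)\<close>, restricted to a neighbourhood of the zero section, has the real
  analytic inverse \<open>y \<mapsto> (\<pi> y, \<sigma> y)\<close> on \<open>W\<close>.
\<close>

definition normal_coordinates ::
    "'a::euclidean_space set \<Rightarrow> ('a \<Rightarrow> 'a) \<Rightarrow> 'a set \<Rightarrow> ('a \<Rightarrow> 'a) \<Rightarrow> ('a \<Rightarrow> real) \<Rightarrow> bool" where
  "normal_coordinates D \<nu> W \<pi> \<sigma> \<longleftrightarrow>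
     open W \<and> frontier D \<subseteq> W \<and> real_analytic_on \<pi> W \<and> real_analytic_on \<sigma> W \<and>
     (\<forall>x\<in>frontier D. \<pi> x = x \<and> \<sigma> x = 0) \<and>
     (\<forall>y\<in>W. \<pi> y \<in> frontier D \<and> \<pi> y + \<sigma> y *\<^sub>R \<nu> (\<pi> y) = y)"

definition real_analytic_variation :: "real \<Rightarrow> (real \<Rightarrow> (complex \<times> complex) set) \<Rightarrow> bool" where
  "real_analytic_variation \<delta> D \<longleftrightarrow>
     (\<exists>\<nu> W \<pi> \<sigma> h.
        unit_normal_field (D 0) \<nu> \<and> normal_coordinates (D 0) \<nu> W \<pi> \<sigma> \<and>
        real_analytic_on (\<lambda>(x, t). h x t) (frontier (D 0) \<times> {-\<delta><..<\<delta>}) \<and>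
        (\<forall>x\<in>frontier (D 0). h x 0 = 0) \<and>
        (\<forall>t\<in>{-\<delta><..<\<delta>}. \<forall>x\<in>frontier (D 0).
           x + h x t *\<^sub>R \<nu> x \<in> W \<and>
           \<pi> (x + h x t *\<^sub>R \<nu> x) = x \<and> \<sigma> (x + h x t *\<^sub>R \<nu> x) = h x t) \<and>
        (\<forall>t\<in>{-\<delta><..<\<delta>}. frontier (D t) = (\<lambda>x. x + h x t *\<^sub>R \<nu> x) ` frontier (D 0)))"

definition holomorphic2_on :: "(complex \<times> complex \<Rightarrow> complex) \<Rightarrow> (complex \<times> complex) set \<Rightarrow> bool" where
  "holomorphic2_on F D \<longleftrightarrow>
     (\<forall>p\<in>D. \<exists>a b. (F has_derivative (\<lambda>(u, v). a * u + b * v)) (at p within D))"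

text \<open>Extensions of boundary functions are understood to be continuous up to the boundary.\<close>

definition CR_function :: "(complex \<times> complex) set \<Rightarrow> (complex \<times> complex \<Rightarrow> complex) \<Rightarrow> bool" where
  "CR_function D f \<longleftrightarrow> continuous_on (frontier D) f \<and>
     (\<exists>F. continuous_on (closure D) F \<and> holomorphic2_on F D \<and> (\<forall>p\<in>frontier D. F p = f p))"

definition CRH_function :: "(complex \<times> complex) set \<Rightarrow> (complex \<times> complex \<Rightarrow> complex) \<Rightarrow> bool" where
  "CRH_function D f \<longleftrightarrow> continuous_on (frontier D) f \<and>
     (\<forall>c. {w. (c, w) \<in> D} \<noteq> {} \<longrightarrow>
        (\<exists>g. continuous_on {w. (c, w) \<in> closure D} g \<and> g holomorphic_on {w. (c, w) \<in> D} \<and>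
             (\<forall>w. (c, w) \<in> frontier D \<longrightarrow> g w = f (c, w)))) \<and>
     (\<forall>c. {z. (z, c) \<in> D} \<noteq> {} \<longrightarrow>
        (\<exists>g. continuous_on {z. (z, c) \<in> closure D} g \<and> g holomorphic_on {z. (z, c) \<in> D} \<and>
             (\<forall>z. (z, c) \<in> frontier D \<longrightarrow> g z = f (z, c))))"

definition CRH_eq_CR :: "(complex \<times> complex) set \<Rightarrow> bool" where
  "CRH_eq_CR D \<longleftrightarrow> (\<forall>f. CRH_function D f \<longrightarrow> CR_function D f)"

definition real_analytic_CRH_variation ::
    "real \<Rightarrow> (real \<Rightarrow> (complex \<times> complex) set) \<Rightarrow> (real \<Rightarrow> complex \<times> complex \<Rightarrow> complex) \<Rightarrow> bool" where
  "real_analytic_CRH_variation \<delta> D f \<longleftrightarrow>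
     (\<exists>U. open U \<and> frontier (D 0) \<subseteq> U \<and> (\<Union>t\<in>{-\<delta><..<\<delta>}. frontier (D t)) \<subseteq> U \<and>
          real_analytic_on (\<lambda>(p, t). f t p) (U \<times> {-\<delta><..<\<delta>})) \<and>
     (\<forall>t\<in>{-\<delta><..<\<delta>}. CRH_function (D t) (f t))"

end

theory Submission
  imports Defs
begin

text \<open>
  Let \<open>F\<^sub>t\<close> be the function on \<open>D\<^sub>t\<close> that extends \<open>f\<^sub>t\<close> holomorphically in every slice \<open>z = const\<close>, and let
  \<open>F'\<^sub>t\<close> be its counterpart for the slices \<open>w = const\<close>. If \<open>F\<^sub>t = F'\<^sub>t\<close>, then the common function is bounded and
  separately holomorphic, hence holomorphic, and it has the boundary values \<open>f\<^sub>t\<close>, so \<open>f\<^sub>t\<close> is CR. The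
  proof shows that \<open>F\<^sub>t - F'\<^sub>t\<close> is real analytic in \<open>(z, w, t)\<close> along real lines and vanishes to infinite order
  at \<open>t = 0\<close>.

  Analyticity. Consider a boundary point whose slice \<open>z = const\<close> meets the domain. By convexity the
  slice crosses the boundary transversally there, so the complexified equation of the moving boundary
  can be solved for the conjugate of \<open>w\<close> (\<open>holomorphic_implicit_function\<close>). The solution is the Schwarz
  function of the boundary curve of the slice. Substituting it for the conjugate of \<open>w\<close> in the
  complexification of \<open>f\<close> gives a function that is holomorphic in \<open>w\<close>, depends analytically on all
  variables and agrees with \<open>f\<^sub>t\<close> on the boundary. By uniqueness of boundary values
  (\<open>boundary_uniqueness_convex\<close>) it agrees with \<open>F\<^sub>t\<close> inside; this is \<open>ext_across_boundary\<close>. The maximum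
  principle carries the expansions in power series from the neighbourhood of the boundary of a slice
  to its interior (\<open>power_series_from_frontier\<close>, \<open>ext_line_series\<close>). The equation of the moving boundary is
  nondegenerate because normal coordinates are immersive (\<open>variation_locally_complexified\<close>), and every boundary
  point lies on a slice meeting the domain in at least one of the two directions
  (\<open>slice_nonempty_cases\<close>).

  Infinite order. Suppose that the Taylor coefficients in \<open>t\<close> of \<open>F\<^sub>t\<close> and \<open>F'\<^sub>t\<close> at \<open>t = 0\<close> agree on \<open>D\<^sub>0\<close> below
  order \<open>n\<close>. Both functions equal \<open>f\<^sub>t\<close> on the boundary of \<open>D\<^sub>t\<close>; following a boundary point of \<open>D\<^sub>t\<close> along a
  normal of the boundary of \<open>D\<^sub>0\<close> as \<open>t\<close> tends to 0, one finds that the coefficients of order \<open>n\<close> have the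
  same boundary values, wherever both are defined (\<open>bcoef_agree_at_boundary\<close>). Together these boundary
  values form a CR Hartogs function on \<open>D\<^sub>0\<close>. By hypothesis it is CR, and its holomorphic extension equals both
  coefficients of order \<open>n\<close> (\<open>coefs_agree\<close>).

  Hence the difference vanishes near the points of \<open>D\<^sub>0\<close> for small \<open>t\<close>, and the identity theorem along real lines
  propagates this to the whole family (\<open>gap_zero\<close>).

  Functions of several complex variables enter as bounded functions that are holomorphic along all
  holomorphic curves (\<open>curve_holomorphic\<close>). With this notion composition, power series, parameters and
  the implicit function theorem reduce to one complex variable.
\<close>

section \<open>Holomorphic functions on plane domains and their boundary values\<close>

lemma bounded_holomorphic_Lipschitz:
  fixes f :: "complex \<Rightarrow> complex"
  assumes hol: "f holomorphic_on ball a r" and bd: "\<And>z. z \<in> ball a r \<Longrightarrow> norm (f z) \<le> M"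
    and x: "x \<in> ball a (r/2)" and y: "y \<in> ball a (r/2)"
  shows "norm (f x - f y) \<le> 4 * M / r * norm (x - y)"
proof -
  have "0 \<le> dist a x" "dist a x < r/2" using x by simp_all
  then have r: "r > 0" by linarith
  show ?thesis
  proof (rule field_differentiable_bound[where S = "ball a (r/2)" and f' = "deriv f"])
    fix z assume z: "z \<in> ball a (r/2)"
    have sub: "cball z (r/4) \<subseteq> ball a r"
    proof
      fix w assume "w \<in> cball z (r/4)"
      then show "w \<in> ball a r" using z dist_triangle[of a w z] r by simp
    qed
    have "z \<in> ball a r" using sub r by (auto simp: subset_iff)
    then show "(f has_field_derivative deriv f z) (at z within ball a (r/2))"
      using hol holomorphic_derivI open_ball has_field_derivative_at_within by blast
    have "norm ((deriv ^^ 1) f z) \<le> fact 1 * M / (r/4) ^ 1"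
    proof (rule Cauchy_inequality)
      show "f holomorphic_on ball z (r/4)"
        using hol sub by (meson ball_subset_cball holomorphic_on_subset order_trans)
      show "continuous_on (cball z (r/4)) f"
        using hol sub by (meson holomorphic_on_imp_continuous_on holomorphic_on_subset)
      fix w assume "norm (z - w) = r/4"
      then have "w \<in> cball z (r/4)" by (simp add: dist_norm)
      then show "norm (f w) \<le> M" using bd sub by blast
    qed (use r in auto)
    then show "norm (deriv f z) \<le> 4 * M / r" by (simp add: field_simps)
  qed (use x y in auto)
qed

lemma Taylor_coefficient_bound:
  fixes f :: "complex \<Rightarrow> complex"
  assumes hol: "f holomorphic_on ball a r" and bd: "\<And>z. z \<in> ball a r \<Longrightarrow> norm (f z) \<le> M"
    and s: "0 < s" "s < r"
  shows "norm ((deriv ^^ k) f a / fact k) \<le> M / s ^ k"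
proof -
  have sub: "cball a s \<subseteq> ball a r" using s by auto
  have "norm ((deriv ^^ k) f a) \<le> fact k * M / s ^ k"
  proof (rule Cauchy_inequality)
    show "f holomorphic_on ball a s"
      using hol sub by (meson ball_subset_cball holomorphic_on_subset order_trans)
    show "continuous_on (cball a s) f"
      using hol sub by (meson holomorphic_on_imp_continuous_on holomorphic_on_subset)
    fix w assume "norm (a - w) = s"
    then have "w \<in> cball a s" by (simp add: dist_norm)
    then show "norm (f w) \<le> M" using bd sub by blast
  qed (use s in auto)
  then show ?thesis by (simp add: norm_divide field_simps)
qed

lemma holomorphic_eq_if_eq_on_frontier:
  fixes f g :: "complex \<Rightarrow> complex"
  assumes "open \<Omega>" "bounded \<Omega>"
    and "continuous_on (closure \<Omega>) f" "f holomorphic_on \<Omega>"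
    and "continuous_on (closure \<Omega>) g" "g holomorphic_on \<Omega>"
    and eq: "\<And>w. w \<in> frontier \<Omega> \<Longrightarrow> f w = g w" and w: "w \<in> closure \<Omega>"
  shows "f w = g w"
proof -
  have "norm (f w - g w) \<le> 0" if "w \<in> \<Omega>"
  proof (rule maximum_modulus_frontier[where S = \<Omega> and f = "\<lambda>w. f w - g w"])
    show "(\<lambda>w. f w - g w) holomorphic_on interior \<Omega>"
      using assms by (auto intro!: holomorphic_intros simp: interior_open)
    show "continuous_on (closure \<Omega>) (\<lambda>w. f w - g w)"
      using assms by (auto intro!: continuous_intros)
  qed (use assms that in auto)
  then show ?thesis using eq w assms(1) by (cases "w \<in> \<Omega>") (auto simp: frontier_def interior_open)
qed

text \<open>Rotating by quarter turns about an interior point \<open>b'\<close> that is close to the boundary point \<open>b\<close>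
  turns the supporting half plane at \<open>b\<close> into four half planes enclosing a small square about \<open>b'\<close>.
  The product of the four rotated copies of \<open>u\<close> therefore vanishes on the boundary of the small
  convex set where it is defined, so it vanishes at \<open>b'\<close>, where it equals \<open>u(b')^4\<close>.\<close>

lemma boundary_uniqueness_convex:
  fixes u :: "complex \<Rightarrow> complex"
  assumes op: "open \<Omega>" and cvx: "convex \<Omega>"
    and cont: "continuous_on (closure \<Omega> \<inter> ball a R) u"
    and hol: "u holomorphic_on \<Omega> \<inter> ball a R"
    and zero: "\<And>w. w \<in> frontier \<Omega> \<Longrightarrow> w \<in> ball a R \<Longrightarrow> u w = 0"
    and ne: "frontier \<Omega> \<inter> ball a R \<noteq> {}"
    and w: "w \<in> closure \<Omega>" "w \<in> ball a R"
  shows "u w = 0"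
proof -
  obtain b where b: "b \<in> frontier \<Omega>" "b \<in> ball a R" using ne by blast
  have bO: "b \<notin> \<Omega>" using b op by (simp add: frontier_def interior_open)
  obtain e where e: "e > 0" "ball b e \<subseteq> ball a R" using b(2) open_ball openE by blast
  \<comment> \<open>the rotated points stay within \<open>4 d\<close> of \<open>b\<close>\<close>
  define d where "d = e / 8"
  have d: "d > 0" using e by (simp add: d_def)
  show ?thesis
  proof (cases "\<Omega> = {}")
    case True then show ?thesis using w by simp
  next
    case False
    obtain m c where m: "m \<noteq> 0" "\<forall>x\<in>\<Omega>. inner m x \<le> c" "\<forall>x\<in>{b}. inner m x \<ge> c"
      using separating_hyperplane_sets[of \<Omega> "{b}"] cvx False bO by auto
    define n where "n = sgn m"
    have n1: "norm n = 1" using m by (simp add: n_def norm_sgn)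
    have half: "inner n x \<le> inner n b" if "x \<in> closure \<Omega>" for x
    proof -
      have "closure \<Omega> \<subseteq> {x. inner m x \<le> inner m b}"
        by (rule closure_minimal) (use m in \<open>auto simp: closed_halfspace_le\<close>)
      then have "inner m x \<le> inner m b" using that by auto
      then show ?thesis unfolding n_def sgn_div_norm by (simp add: mult_left_mono)
    qed
    have near: "u b' = 0" if b': "b' \<in> \<Omega>" "b' \<in> ball b d" for b'
    proof -
      define rot where "rot = (\<lambda>(k::nat) w. b' + \<i>^k * (w - b'))"
      define K where "K = (\<Inter>k\<in>{..<4}. rot k -` \<Omega>)"
      have rcont: "continuous_on A (rot k)" for A k unfolding rot_def by (intro continuous_intros)
      have opK: "open K" unfolding K_def
        by (intro open_INT finite_lessThan ballI open_vimage op rcont)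
      have clK: "rot k x \<in> closure \<Omega>" if "k < 4" "x \<in> closure K" for k x
      proof -
        have "closure K \<subseteq> rot k -` closure \<Omega>"
        proof (rule closure_minimal)
          show "K \<subseteq> rot k -` closure \<Omega>" using that(1) closure_subset[of \<Omega>] by (auto simp: K_def)
          show "closed (rot k -` closure \<Omega>)"
            by (intro closed_vimage closed_closure rcont)
        qed
        then show ?thesis using that by auto
      qed
      have dist_rot: "norm (rot k x - b') = norm (x - b')" for k x
        by (simp add: rot_def norm_mult norm_power)
      have small: "norm (x - b') \<le> 2 * d" if x: "x \<in> closure K" for x
      proof -
        define y where "y = cnj n * (x - b')"
        have ny: "norm y = norm (x - b')" by (simp add: y_def norm_mult n1)
        have ins: "inner n z = Re (cnj n * z)" for z by (simp add: inner_complex_def)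
        have *: "Re (\<i>^k * y) \<le> d" if "k < 4" for k
        proof -
          have "inner n (rot k x) \<le> inner n b" using half clK that x by blast
          then have "inner n (\<i>^k * (x - b')) \<le> inner n (b - b')"
            by (simp add: rot_def inner_add_right inner_diff_right)
          also have "\<dots> \<le> norm n * norm (b - b')" by (rule norm_cauchy_schwarz)
          also have "\<dots> \<le> d" using b'(2) n1 by (simp add: dist_norm norm_minus_commute)
          finally show ?thesis by (simp add: ins y_def mult.left_commute mult.commute)
        qed
        have "Re y \<le> d" "- Im y \<le> d" "- Re y \<le> d" "Im y \<le> d"
          using *[of 0] *[of 1] *[of 2] *[of 3] by (simp_all add: power3_eq_cube)
        then have "\<bar>Re y\<bar> + \<bar>Im y\<bar> \<le> 2 * d" by linarith
        then show ?thesis using cmod_le[of y] ny by linarith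
      qed
      have inb: "rot k x \<in> ball a R" if "x \<in> closure K" for k x
      proof -
        have "dist b (rot k x) \<le> dist b b' + norm (rot k x - b')"
          by (metis dist_commute dist_norm dist_triangle)
        also have "\<dots> < e" using small[OF that] b'(2) e d by (simp add: dist_rot d_def)
        finally show ?thesis using e(2) by auto
      qed
      have bK: "b' \<in> K" using b' by (simp add: K_def rot_def)
      define P where "P = (\<lambda>x. \<Prod>k<4. u (rot k x))"
      have "norm (P b') \<le> 0"
      proof (rule maximum_modulus_frontier[where S = K and f = P])
        show "P holomorphic_on interior K" unfolding P_def interior_open[OF opK]
        proof (intro holomorphic_on_prod)
          fix k :: nat assume k: "k \<in> {..<4}"
          have "(u \<circ> rot k) holomorphic_on K"
          proof (rule holomorphic_on_compose_gen)
            show "rot k holomorphic_on K" unfolding rot_def by (intro holomorphic_intros)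
            show "u holomorphic_on \<Omega> \<inter> ball a R" by (rule hol)
            show "rot k ` K \<subseteq> \<Omega> \<inter> ball a R" using inb closure_subset[of K] k by (auto simp: K_def)
          qed
          then show "(\<lambda>x. u (rot k x)) holomorphic_on K" by (simp add: o_def)
        qed
        show "continuous_on (closure K) P" unfolding P_def
        proof (intro continuous_on_prod)
          fix k :: nat assume k: "k \<in> {..<4}"
          show "continuous_on (closure K) (\<lambda>x. u (rot k x))"
            by (rule continuous_on_compose2[OF cont rcont]) (use clK inb k in auto)
        qed
        show "bounded K"
        proof (rule boundedI[where B = "norm b' + 2 * d"])
          fix x assume "x \<in> K"
          then have "norm (x - b') \<le> 2 * d" using small closure_subset by blast
          then show "norm x \<le> norm b' + 2 * d" using norm_triangle_sub[of x b'] by linarith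
        qed
        show "b' \<in> K" by (rule bK)
        fix x assume x: "x \<in> frontier K"
        then have xc: "x \<in> closure K" and "x \<notin> K" using opK by (auto simp: frontier_def interior_open)
        then obtain k where k: "k < 4" "rot k x \<notin> \<Omega>" by (auto simp: K_def)
        then have "rot k x \<in> frontier \<Omega>" using clK xc op by (auto simp: frontier_def interior_open)
        then have "u (rot k x) = 0" using zero inb xc by blast
        then show "norm (P x) \<le> 0" using k by (auto simp: P_def)
      qed
      then show ?thesis by (auto simp: P_def rot_def)
    qed
    have inside: "u x = 0" if x: "x \<in> \<Omega>" "x \<in> ball a R" for x
    proof (rule analytic_continuation_open[where s = "\<Omega> \<inter> ball b d" and s' = "\<Omega> \<inter> ball a R" and f = u and g = "\<lambda>_. 0"])
      have "b \<in> closure \<Omega>" using b by (simp add: frontier_def)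
      then show "\<Omega> \<inter> ball b d \<noteq> {}" using d
        by (metis Int_commute centre_in_ball disjoint_iff open_Int_closure_eq_empty open_ball)
      show "connected (\<Omega> \<inter> ball a R)" by (intro convex_connected convex_Int cvx convex_ball)
      show "\<Omega> \<inter> ball b d \<subseteq> \<Omega> \<inter> ball a R" using e d by (auto simp: d_def subset_iff)
    qed (use op hol near x in auto)
    show ?thesis using inside zero w op by (cases "w \<in> \<Omega>") (auto simp: frontier_def interior_open)
  qed
qed

text \<open>Zeros of a nonzero power series are isolated, whereas the difference of the two series vanishes at
  all small real points.\<close>

lemma powser_real_coeffs_eq:
  fixes a b :: "nat \<Rightarrow> complex"
  assumes e: "e > 0"
    and a: "\<And>s::real. \<bar>s\<bar> < e \<Longrightarrow> (\<lambda>k. a k * of_real s ^ k) sums g s"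
    and b: "\<And>s::real. \<bar>s\<bar> < e \<Longrightarrow> (\<lambda>k. b k * of_real s ^ k) sums g s"
  shows "a k = b k"
proof (rule ccontr)
  assume ne: "a k \<noteq> b k"
  define c where "c = (\<lambda>k. a k - b k)"
  have c0: "(\<lambda>k. c k * of_real s ^ k) sums 0" if "\<bar>s\<bar> < e" for s :: real
    using sums_diff[OF a[OF that] b[OF that]] by (simp add: c_def algebra_simps)
  define f where "f = (\<lambda>z. \<Sum>k. c k * z ^ k)"
  have sm: "summable (\<lambda>k. c k * z ^ k)" if "norm z < e/2" for z
    by (rule powser_inside[where x = "of_real (e/2)"]) (use c0[of "e/2"] e that in \<open>auto simp: sums_iff\<close>)
  have z0: "c 0 = 0"
    using sums_unique2[OF powser_sums_zero c0[of 0, unfolded of_real_0]] e by simp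
  have kpos: "k > 0" using ne z0 by (cases k) (auto simp: c_def)
  obtain s where s: "0 < s" "\<And>z. z \<in> cball 0 s - {0} \<Longrightarrow> f z \<noteq> 0"
  proof (rule powser_0_nonzero[where r = "e/2" and a = c and \<xi> = 0 and f = f and m = k])
    fix z :: complex assume "norm (z - 0) < e/2"
    then show "(\<lambda>n. c n * (z - 0) ^ n) sums f z" using sm by (simp add: f_def summable_sums)
  next
    show "f 0 = 0" using z0 by (simp add: f_def)
  qed (use e ne kpos in \<open>auto simp: c_def\<close>)
  define t where "t = min s (e/2)"
  have "f (of_real t) = 0" using c0[of t] s(1) e by (simp add: f_def t_def sums_iff min_less_iff_disj)
  moreover have "f (of_real t) \<noteq> 0" using s e by (intro s(2)) (auto simp: t_def)
  ultimately show False by simp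
qed

lemma sums_tail_bound:
  fixes a :: "nat \<Rightarrow> complex"
  assumes bd: "\<And>k. norm (a k) \<le> M / \<rho> ^ k" and \<rho>: "\<rho> > 0" and s: "\<bar>s\<bar> \<le> \<rho> / 2"
    and sums: "(\<lambda>k. a k * of_real s ^ k) sums v"
  shows "norm (v - (\<Sum>k<n. a k * of_real s ^ k)) \<le> 2 * M * (\<bar>s\<bar> / \<rho>) ^ n"
proof -
  define x where "x = \<bar>s\<bar> / \<rho>"
  have x: "0 \<le> x" "x \<le> 1/2" using s \<rho> by (auto simp: x_def field_simps)
  have M0: "M \<ge> 0" using order_trans[OF norm_ge_zero bd[of 0]] by simp
  have tb: "norm (a k * of_real s ^ k) \<le> M * x ^ k" for k
  proof -
    have "norm (a k * of_real s ^ k) = norm (a k) * \<bar>s\<bar> ^ k" by (simp add: norm_mult norm_power)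
    also have "\<dots> \<le> M / \<rho> ^ k * \<bar>s\<bar> ^ k" by (intro mult_right_mono bd) auto
    finally show ?thesis by (simp add: x_def power_divide)
  qed
  have "(\<lambda>k. a (k+n) * of_real s ^ (k+n)) sums (v - (\<Sum>k<n. a k * of_real s ^ k))"
    using sums sums_iff_shift'[of "\<lambda>k. a k * of_real s ^ k" n v] by simp
  moreover have "(\<lambda>k. M * x ^ n * x ^ k) sums (M * x ^ n * (1 / (1 - x)))"
    using x by (intro sums_mult geometric_sums) auto
  ultimately have "norm (v - (\<Sum>k<n. a k * of_real s ^ k)) \<le> M * x ^ n * (1 / (1 - x))"
  proof -
    assume 1: "(\<lambda>k. a (k+n) * of_real s ^ (k+n)) sums (v - (\<Sum>k<n. a k * of_real s ^ k))"
      and 2: "(\<lambda>k. M * x ^ n * x ^ k) sums (M * x ^ n * (1 / (1 - x)))"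
    have "norm (a (k+n) * of_real s ^ (k+n)) \<le> M * x ^ n * x ^ k" for k
      using tb[of "k+n"] by (simp add: power_add mult_ac)
    then have "norm (\<Sum>k. a (k+n) * of_real s ^ (k+n)) \<le> (\<Sum>k. M * x ^ n * x ^ k)"
      using 2 by (intro norm_suminf_le) (auto simp: sums_iff)
    then show ?thesis using 1 2 by (simp add: sums_iff)
  qed
  also have "\<dots> \<le> M * x ^ n * 2"
    using x M0 by (intro mult_left_mono) (auto simp: field_simps)
  finally show ?thesis by (simp add: x_def mult_ac)
qed

text \<open>By the maximum principle a sequence that converges uniformly on the boundary is uniformly Cauchy on
  the closure.\<close>

lemma uniform_limit_from_frontier:
  fixes q :: "nat \<Rightarrow> complex \<Rightarrow> complex"
  assumes op: "open \<Omega>" and bdd: "bounded \<Omega>"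
    and cont: "\<And>n. continuous_on (closure \<Omega>) (q n)" and hol: "\<And>n. q n holomorphic_on \<Omega>"
    and lim: "\<And>n c. c \<in> frontier \<Omega> \<Longrightarrow> norm (q n c - a c) \<le> \<eta> n" and eta: "\<eta> \<longlonglongrightarrow> 0"
  shows "\<exists>\<alpha>. continuous_on (closure \<Omega>) \<alpha> \<and> \<alpha> holomorphic_on \<Omega> \<and> (\<forall>c\<in>frontier \<Omega>. \<alpha> c = a c)"
proof -
  have mm: "norm (q n c - q m c) \<le> \<eta> n + \<eta> m" if c: "c \<in> closure \<Omega>" for n m c
  proof -
    have fr: "norm (q n x - q m x) \<le> \<eta> n + \<eta> m" if "x \<in> frontier \<Omega>" for x
      using norm_triangle_ineq4[of "q n x - a x" "q m x - a x"] lim[OF that, of n] lim[OF that, of m] by simp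
    show ?thesis
    proof (cases "c \<in> \<Omega>")
      case True
      show ?thesis
        by (rule maximum_modulus_frontier[where S = \<Omega> and f = "\<lambda>x. q n x - q m x"])
           (use True fr bdd in \<open>auto intro!: holomorphic_intros continuous_intros cont hol simp: interior_open[OF op]\<close>)
    qed (use c fr op in \<open>auto simp: frontier_def interior_open\<close>)
  qed
  have "uniformly_Cauchy_on (closure \<Omega>) q"
  proof (rule uniformly_Cauchy_onI)
    fix e :: real assume e: "e > 0"
    obtain N where N: "\<And>n. n \<ge> N \<Longrightarrow> \<bar>\<eta> n\<bar> < e/2"
      using eta e unfolding lim_sequentially dist_real_def by (metis diff_zero half_gt_zero)
    show "\<exists>M. \<forall>x\<in>closure \<Omega>. \<forall>m\<ge>M. \<forall>n\<ge>M. dist (q m x) (q n x) < e"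
    proof (intro exI[of _ N] ballI allI impI)
      fix x m n assume "x \<in> closure \<Omega>" "N \<le> m" "N \<le> n"
      then show "dist (q m x) (q n x) < e"
        using mm[of x m n] N[of m] N[of n] by (simp add: dist_norm)
    qed
  qed
  then obtain \<alpha> where \<alpha>: "uniform_limit (closure \<Omega>) q \<alpha> sequentially"
    using Cauchy_uniformly_convergent uniformly_convergent_on_def by blast
  have c: "continuous_on (closure \<Omega>) \<alpha>"
    by (rule uniform_limit_theorem[OF _ \<alpha>]) (use cont in auto)
  have h: "\<alpha> holomorphic_on \<Omega>"
  proof (rule holomorphic_uniform_sequence[OF op hol])
    fix x assume "x \<in> \<Omega>"
    then obtain d where "d > 0" "cball x d \<subseteq> \<Omega>" using op open_contains_cball by blast
    then show "\<exists>d>0. cball x d \<subseteq> \<Omega> \<and> uniform_limit (cball x d) q \<alpha> sequentially"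
      using uniform_limit_on_subset[OF \<alpha>] closure_subset by (meson order_trans)
  qed
  have "\<alpha> c = a c" if c: "c \<in> frontier \<Omega>" for c
  proof -
    have "(\<lambda>n. q n c) \<longlonglongrightarrow> \<alpha> c"
      using tendsto_uniform_limitI[OF \<alpha>] c by (auto simp: frontier_def)
    moreover have "(\<lambda>n. q n c) \<longlonglongrightarrow> a c"
    proof (rule Lim_null_comparison[THEN LIM_zero_cancel])
      show "\<forall>\<^sub>F n in sequentially. norm (q n c - a c) \<le> \<eta> n" using lim c by auto
    qed (rule eta)
    ultimately show ?thesis using LIMSEQ_unique by blast
  qed
  then show ?thesis using c h by blast
qed

text \<open>The functions that extend holomorphically to \<open>\<Omega>\<close> form a closed subspace of the continuous
  functions on the boundary. A power series in \<open>s\<close> with values in the larger space whose sums at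
  real \<open>s\<close> lie in the subspace has its coefficients in the subspace; by the maximum principle it
  converges on \<open>\<Omega>\<close> as it does on the boundary.\<close>

lemma power_series_from_frontier:
  fixes F :: "real \<Rightarrow> complex \<Rightarrow> complex"
  assumes op: "open \<Omega>" and bdd: "bounded \<Omega>" and e: "e > 0"
    and cont: "\<And>s. \<bar>s\<bar> < e \<Longrightarrow> continuous_on (closure \<Omega>) (F s)"
    and hol: "\<And>s. \<bar>s\<bar> < e \<Longrightarrow> F s holomorphic_on \<Omega>"
    and ext: "\<And>c. c \<in> frontier \<Omega> \<Longrightarrow> \<exists>H. H holomorphic_on ball 0 e \<and>
               (\<forall>z\<in>ball 0 e. norm (H z) \<le> M) \<and> (\<forall>s. \<bar>s\<bar> < e \<longrightarrow> H (of_real s) = F s c)"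
  shows "\<exists>\<alpha>. (\<forall>k. continuous_on (closure \<Omega>) (\<alpha> k) \<and> \<alpha> k holomorphic_on \<Omega>) \<and>
           (\<forall>k. \<forall>c\<in>closure \<Omega>. norm (\<alpha> k c) \<le> M / (e/2) ^ k) \<and>
           (\<forall>s. \<forall>c\<in>closure \<Omega>. \<bar>s\<bar> \<le> e/4 \<longrightarrow> (\<lambda>k. \<alpha> k c * of_real s ^ k) sums F s c)"
proof -
  define \<rho> where "\<rho> = e/2"
  have \<rho>: "\<rho> > 0" "\<rho> < e" using e by (auto simp: \<rho>_def)
  have "\<forall>c\<in>frontier \<Omega>. \<exists>H. H holomorphic_on ball 0 e \<and>
               (\<forall>z\<in>ball 0 e. norm (H z) \<le> M) \<and> (\<forall>s. \<bar>s\<bar> < e \<longrightarrow> H (of_real s) = F s c)"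
    using ext by blast
  from bchoice[OF this] obtain H where HH: "\<forall>c\<in>frontier \<Omega>. H c holomorphic_on ball 0 e \<and>
               (\<forall>z\<in>ball 0 e. norm (H c z) \<le> M) \<and> (\<forall>s. \<bar>s\<bar> < e \<longrightarrow> H c (of_real s) = F s c)" ..
  then have H: "\<And>c. c \<in> frontier \<Omega> \<Longrightarrow> H c holomorphic_on ball 0 e"
      "\<And>c z. c \<in> frontier \<Omega> \<Longrightarrow> z \<in> ball 0 e \<Longrightarrow> norm (H c z) \<le> M"
      "\<And>c s. c \<in> frontier \<Omega> \<Longrightarrow> \<bar>s\<bar> < e \<Longrightarrow> H c (of_real s) = F s c"
    by blast+
  define a where "a = (\<lambda>k c. (deriv ^^ k) (H c) 0 / fact k)"
  have ab: "norm (a k c) \<le> M / \<rho> ^ k" if "c \<in> frontier \<Omega>" for k c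
    unfolding a_def by (rule Taylor_coefficient_bound[OF H(1)[OF that] H(2)[OF that]]) (use \<rho> in auto)
  have asum: "(\<lambda>k. a k c * of_real s ^ k) sums F s c" if "c \<in> frontier \<Omega>" "\<bar>s\<bar> < e" for s c
    using holomorphic_power_series[OF H(1)[OF that(1)], of "of_real s"] H(3)[OF that] that
    by (simp add: a_def)
  have claim: "\<exists>\<alpha>. continuous_on (closure \<Omega>) \<alpha> \<and> \<alpha> holomorphic_on \<Omega> \<and> (\<forall>c\<in>frontier \<Omega>. \<alpha> c = a k c)" for k
  proof (induction k rule: less_induct)
    case (less k)
    then obtain \<beta> where \<beta>: "\<And>j. j < k \<Longrightarrow> continuous_on (closure \<Omega>) (\<beta> j)"
       "\<And>j. j < k \<Longrightarrow> \<beta> j holomorphic_on \<Omega>" "\<And>j c. j < k \<Longrightarrow> c \<in> frontier \<Omega> \<Longrightarrow> \<beta> j c = a j c"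
      by metis
    \<comment> \<open>the coefficient \<open>a k\<close> is the limit of the remainder quotients \<open>q n\<close> at the real points \<open>s n\<close>\<close>
    define s where "s = (\<lambda>n::nat. \<rho> / 2 * inverse (real (Suc n)))"
    have s: "0 < s n" "s n \<le> \<rho> / 2" for n using \<rho> by (auto simp: s_def field_simps)
    have se: "\<bar>s n\<bar> < e" for n using s(1)[of n] s(2)[of n] \<rho> by linarith
    define q where "q = (\<lambda>n c. (F (s n) c - (\<Sum>j<k. \<beta> j c * of_real (s n) ^ j)) / of_real (s n) ^ k)"
    show ?case
    proof (rule uniform_limit_from_frontier[OF op bdd, where q = q and \<eta> = "\<lambda>n. 2 * M / \<rho> ^ Suc k * s n"])
      fix n
      show "continuous_on (closure \<Omega>) (q n)" unfolding q_def
        using s[of n] by (intro continuous_intros cont se \<beta>) auto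
      show "q n holomorphic_on \<Omega>" unfolding q_def
        using s[of n] by (intro holomorphic_intros hol se \<beta>) auto
      fix c assume c: "c \<in> frontier \<Omega>"
      have "norm (F (s n) c - (\<Sum>j<Suc k. a j c * of_real (s n) ^ j)) \<le> 2 * M * (\<bar>s n\<bar> / \<rho>) ^ Suc k"
        by (rule sums_tail_bound[where a = "\<lambda>j. a j c"]) (use ab c \<rho> s[of n] asum se in \<open>auto simp: abs_if\<close>)
      moreover have "q n c - a k c = (F (s n) c - (\<Sum>j<Suc k. a j c * of_real (s n) ^ j)) / of_real (s n) ^ k"
        using s[of n] \<beta>(3)[OF _ c] by (simp add: q_def field_simps)
      ultimately have "norm (q n c - a k c) \<le> 2 * M * (\<bar>s n\<bar> / \<rho>) ^ Suc k / s n ^ k"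
        using s[of n] by (simp only: norm_divide norm_power norm_of_real abs_of_pos divide_right_mono
            zero_le_power less_imp_le)
      also have "\<dots> = 2 * M / \<rho> ^ Suc k * s n"
        using s[of n] \<rho> by (simp add: power_divide field_simps abs_of_pos)
      finally show "norm (q n c - a k c) \<le> 2 * M / \<rho> ^ Suc k * s n" .
    next
      have "s \<longlonglongrightarrow> 0" unfolding s_def by (rule tendsto_mult_right_zero[OF LIMSEQ_inverse_real_of_nat])
      then show "(\<lambda>n. 2 * M / \<rho> ^ Suc k * s n) \<longlonglongrightarrow> 0" using tendsto_mult_right_zero by blast
    qed
  qed
  then obtain \<alpha> where \<alpha>: "\<And>k. continuous_on (closure \<Omega>) (\<alpha> k)" "\<And>k. \<alpha> k holomorphic_on \<Omega>"
     "\<And>k c. c \<in> frontier \<Omega> \<Longrightarrow> \<alpha> k c = a k c" by metis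
  have \<alpha>b: "norm (\<alpha> k c) \<le> M / \<rho> ^ k" if c: "c \<in> closure \<Omega>" for k c
  proof (cases "c \<in> \<Omega>")
    case True
    show ?thesis
    proof (rule maximum_modulus_frontier[where S = \<Omega> and f = "\<alpha> k"])
      show "\<alpha> k holomorphic_on interior \<Omega>" using \<alpha>(2) by (simp add: interior_open[OF op])
      fix x assume "x \<in> frontier \<Omega>"
      then show "norm (\<alpha> k x) \<le> M / \<rho> ^ k" using \<alpha>(3) ab by metis
    qed (use True bdd \<alpha>(1) in auto)
  next
    case False
    then have "c \<in> frontier \<Omega>" using c op by (simp add: frontier_def interior_open)
    then show ?thesis using \<alpha>(3) ab by metis
  qed
  have "(\<lambda>k. \<alpha> k c * of_real s ^ k) sums F s c" if s: "\<bar>s\<bar> \<le> \<rho>/2" and c: "c \<in> closure \<Omega>" for s c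
  proof -
    have se: "\<bar>s\<bar> < e" using s \<rho> by linarith
    have fr: "norm (F s c - (\<Sum>k<n. \<alpha> k c * of_real s ^ k)) \<le> 2 * M * (\<bar>s\<bar> / \<rho>) ^ n"
      if c: "c \<in> frontier \<Omega>" for n c
      unfolding \<alpha>(3)[OF c] by (rule sums_tail_bound[OF ab[OF c] \<rho>(1) s asum[OF c se]])
    have "norm (F s c - (\<Sum>k<n. \<alpha> k c * of_real s ^ k)) \<le> 2 * M * (\<bar>s\<bar> / \<rho>) ^ n" for n
    proof (cases "c \<in> \<Omega>")
      case True
      show ?thesis
        by (rule maximum_modulus_frontier[where S = \<Omega> and f = "\<lambda>c. F s c - (\<Sum>k<n. \<alpha> k c * of_real s ^ k)"])
           (use True bdd fr se in \<open>auto intro!: holomorphic_intros continuous_intros hol cont \<alpha>(1,2) simp: interior_open[OF op]\<close>)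
    qed (use c fr op in \<open>auto simp: frontier_def interior_open\<close>)
    note bound = this
    have lim0: "(\<lambda>n. 2 * M * (\<bar>s\<bar> / \<rho>) ^ n) \<longlonglongrightarrow> 0"
      using s \<rho> by (intro tendsto_mult_right_zero LIMSEQ_power_zero) (auto simp: field_simps)
    have "(\<lambda>n. F s c - (\<Sum>k<n. \<alpha> k c * of_real s ^ k)) \<longlonglongrightarrow> 0"
      by (rule Lim_null_comparison[OF always_eventually lim0]) (use bound in blast)
    from tendsto_minus[OF this]
    have "(\<lambda>n. (\<Sum>k<n. \<alpha> k c * of_real s ^ k) - F s c) \<longlonglongrightarrow> 0"
      by (simp only: minus_diff_eq minus_zero)
    then show ?thesis unfolding sums_def by (rule LIM_zero_cancel)
  qed
  then have "\<forall>s. \<forall>c\<in>closure \<Omega>. \<bar>s\<bar> \<le> e/4 \<longrightarrow> (\<lambda>k. \<alpha> k c * of_real s ^ k) sums F s c"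
    by (simp add: \<rho>_def)
  then show ?thesis using \<alpha>(1,2) \<alpha>b unfolding \<rho>_def by blast
qed

text \<open>A weak form of Osgood's lemma. The mixed second difference of \<open>h\<close> is Lipschitz in each variable
  and vanishes on both axes, hence is bounded by a multiple of \<open>|u| |v|\<close>.\<close>

lemma separately_holomorphic_has_derivative:
  fixes h :: "complex \<times> complex \<Rightarrow> complex"
  assumes r: "r > 0"
    and bd: "\<And>u v. u \<in> ball a r \<Longrightarrow> v \<in> ball b r \<Longrightarrow> norm (h (u, v)) \<le> M"
    and h1: "\<And>v. v \<in> ball b r \<Longrightarrow> (\<lambda>u. h (u, v)) holomorphic_on ball a r"
    and h2: "\<And>u. u \<in> ball a r \<Longrightarrow> (\<lambda>v. h (u, v)) holomorphic_on ball b r"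
  shows "(h has_derivative (\<lambda>(u, v). deriv (\<lambda>u. h (u, b)) a * u + deriv (\<lambda>v. h (a, v)) b * v)) (at (a, b))"
proof -
  define A B where "A = deriv (\<lambda>u. h (u, b)) a" and "B = deriv (\<lambda>v. h (a, v)) b"
  have ab: "a \<in> ball a r" "b \<in> ball b r" using r by auto
  have M0: "M \<ge> 0" using bd[OF ab] norm_ge_zero order_trans by blast
  have dA: "((\<lambda>u. h (u, b)) has_derivative (\<lambda>u. A * u)) (at a)"
    using holomorphic_derivI[OF h1[OF ab(2)] open_ball ab(1)] by (simp add: A_def has_field_derivative_def)
  have dB: "((\<lambda>v. h (a, v)) has_derivative (\<lambda>v. B * v)) (at b)"
    using holomorphic_derivI[OF h2[OF ab(1)] open_ball ab(2)] by (simp add: B_def has_field_derivative_def)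
  define C where "C = 32 * M / (r * r)"
  have C0: "C \<ge> 0" using M0 r by (simp add: C_def)
  define \<psi> where "\<psi> = (\<lambda>u v. h (u, v) - h (a, v) - h (u, b) + h (a, b))"
  have psi: "norm (\<psi> u v) \<le> C * norm (u - a) * norm (v - b)"
    if u: "u \<in> ball a (r/2)" and v: "v \<in> ball b (r/2)" for u v
  proof -
    have ur: "u \<in> ball a r" using u r by auto
    have "norm (\<psi> u v - \<psi> u b) \<le> 4 * (8 * M / r * norm (u - a)) / r * norm (v - b)"
    proof (rule bounded_holomorphic_Lipschitz[where a = b and f = "\<psi> u"])
      show "\<psi> u holomorphic_on ball b r" unfolding \<psi>_def
        by (intro holomorphic_intros h2 ur ab)
      fix y assume y: "y \<in> ball b r"
      have 1: "norm (h (u, y) - h (a, y)) \<le> 4 * M / r * norm (u - a)"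
        by (rule bounded_holomorphic_Lipschitz[OF h1[OF y]]) (use bd y u r in auto)
      have 2: "norm (h (u, b) - h (a, b)) \<le> 4 * M / r * norm (u - a)"
        by (rule bounded_holomorphic_Lipschitz[OF h1[OF ab(2)]]) (use bd ab u r in auto)
      have "\<psi> u y = (h (u, y) - h (a, y)) - (h (u, b) - h (a, b))" by (simp add: \<psi>_def)
      then have "norm (\<psi> u y) \<le> norm (h (u, y) - h (a, y)) + norm (h (u, b) - h (a, b))"
        using norm_triangle_ineq4 by metis
      moreover have "8 * M / r * norm (u - a) = 4 * M / r * norm (u - a) + 4 * M / r * norm (u - a)" by simp
      ultimately show "norm (\<psi> u y) \<le> 8 * M / r * norm (u - a)" using 1 2 by linarith
    qed (use v r in auto)
    moreover have "\<psi> u b = 0" by (simp add: \<psi>_def)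
    moreover have "4 * (8 * M / r * norm (u - a)) / r * norm (v - b) \<le> C * norm (u - a) * norm (v - b)"
      unfolding C_def by simp
    ultimately show ?thesis by simp
  qed
  have lin1: "((\<lambda>p. h (fst p, b)) has_derivative (\<lambda>p. A * fst p)) (at (a, b))"
  proof (rule has_derivative_compose[where f = fst and f' = fst and g = "\<lambda>u. h (u, b)"])
    show "(fst has_derivative fst) (at (a, b))"
      by (rule bounded_linear_imp_has_derivative[OF bounded_linear_fst])
    show "((\<lambda>u. h (u, b)) has_derivative (*) A) (at (fst (a, b)))" using dA by simp
  qed
  have lin2: "((\<lambda>p. h (a, snd p)) has_derivative (\<lambda>p. B * snd p)) (at (a, b))"
  proof (rule has_derivative_compose[where f = snd and f' = snd and g = "\<lambda>v. h (a, v)"])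
    show "(snd has_derivative snd) (at (a, b))"
      by (rule bounded_linear_imp_has_derivative[OF bounded_linear_snd])
    show "((\<lambda>v. h (a, v)) has_derivative (*) B) (at (snd (a, b)))" using dB by simp
  qed
  have lin3: "((\<lambda>p. \<psi> (fst p) (snd p)) has_derivative (\<lambda>p. 0)) (at (a, b))"
  proof (rule has_derivativeI_sandwich[where e = "r/2" and H = "\<lambda>p. C * norm (p - (a, b))"])
    have "((\<lambda>p. norm (p - (a, b))) \<longlongrightarrow> 0) (at (a, b))"
      using tendsto_norm_zero[OF LIM_zero[OF tendsto_ident_at]] by blast
    then show "((\<lambda>p. C * norm (p - (a, b))) \<longlongrightarrow> 0) (at (a, b))"
      by (rule tendsto_mult_right_zero)
    fix p assume p: "p \<noteq> (a, b)" "dist p (a, b) < r/2"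
    obtain u v where uv: "p = (u, v)" by (cases p)
    have n1: "norm (u - a) \<le> norm (p - (a, b))" "norm (v - b) \<le> norm (p - (a, b))"
      using norm_fst_le[of "u - a" "v - b"] norm_snd_le[of "v - b" "u - a"]
      by (simp_all add: uv)
    have "norm (u - a) < r/2" "norm (v - b) < r/2" using n1 p(2) unfolding dist_norm by linarith+
    then have "norm (\<psi> u v) \<le> C * norm (u - a) * norm (v - b)"
      by (intro psi) (simp_all add: dist_norm norm_minus_commute)
    also have "\<dots> \<le> C * norm (p - (a, b)) * norm (p - (a, b))"
      using C0 n1 by (intro mult_mono) auto
    finally have "norm (\<psi> u v) / norm (p - (a, b)) \<le> C * norm (p - (a, b))"
      using p(1) by (subst pos_divide_le_eq) auto
    moreover have "\<psi> a b = 0" by (simp add: \<psi>_def)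
    ultimately show "norm (\<psi> (fst p) (snd p) - \<psi> (fst (a, b)) (snd (a, b)) - 0) / norm (p - (a, b)) \<le> C * norm (p - (a, b))"
      by (simp only: uv fst_conv snd_conv diff_zero)
  qed (use r in auto)
  have "((\<lambda>p. h (fst p, b) + h (a, snd p) - h (a, b) + \<psi> (fst p) (snd p)) has_derivative
     (\<lambda>p. A * fst p + B * snd p - 0 + 0)) (at (a, b))"
    by (rule has_derivative_add[OF has_derivative_diff[OF has_derivative_add[OF lin1 lin2] has_derivative_const] lin3])
  moreover have "h (fst p, b) + h (a, snd p) - h (a, b) + \<psi> (fst p) (snd p) = h p" for p
    by (simp add: \<psi>_def)
  moreover have "A * fst p + B * snd p - 0 + 0 = (case p of (u, v) \<Rightarrow> A * u + B * v)" for p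
    by (simp add: case_prod_unfold)
  ultimately show ?thesis unfolding A_def[symmetric] B_def[symmetric] by simp
qed

section \<open>Functions of several complex variables tested along curves\<close>

definition polydisc :: "'i set \<Rightarrow> ('i \<Rightarrow> complex) \<Rightarrow> real \<Rightarrow> ('i \<Rightarrow> complex) set" where
  "polydisc B c r = {x. \<forall>b\<in>B. dist (x b) (c b) < r}"

text \<open>The bound \<open>M\<close> makes continuity a consequence, by the Cauchy estimates on complex lines. Only the
  coordinates in \<open>B\<close> of a curve have to be holomorphic; hence the function ignores all others.\<close>

definition curve_holomorphic ::
    "(('i \<Rightarrow> complex) \<Rightarrow> complex) \<Rightarrow> 'i set \<Rightarrow> ('i \<Rightarrow> complex) \<Rightarrow> real \<Rightarrow> real \<Rightarrow> bool" where
  "curve_holomorphic \<phi> B c r M \<longleftrightarrow>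
     (\<forall>x\<in>polydisc B c r. norm (\<phi> x) \<le> M) \<and>
     (\<forall>U \<gamma>. open U \<longrightarrow> (\<forall>b\<in>B. (\<lambda>u. \<gamma> u b) holomorphic_on U) \<longrightarrow> \<gamma> ` U \<subseteq> polydisc B c r \<longrightarrow>
        (\<lambda>u. \<phi> (\<gamma> u)) holomorphic_on U)"

lemma curve_holomorphic_bound:
  "curve_holomorphic \<phi> B c r M \<Longrightarrow> x \<in> polydisc B c r \<Longrightarrow> norm (\<phi> x) \<le> M"
  by (simp add: curve_holomorphic_def)

lemma curve_holomorphic_along:
  assumes "curve_holomorphic \<phi> B c r M" "open U" "\<And>b. b \<in> B \<Longrightarrow> (\<lambda>u. \<gamma> u b) holomorphic_on U"
    "\<And>u. u \<in> U \<Longrightarrow> \<gamma> u \<in> polydisc B c r"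
  shows "(\<lambda>u. \<phi> (\<gamma> u)) holomorphic_on U"
  using assms unfolding curve_holomorphic_def by (meson image_subsetI)

lemma polydisc_mono: "r \<le> s \<Longrightarrow> polydisc B c r \<subseteq> polydisc B c s"
  by (force simp: polydisc_def)

lemma polydisc_centre: "r > 0 \<Longrightarrow> c \<in> polydisc B c r"
  by (simp add: polydisc_def)

lemma curve_holomorphic_nonneg: "curve_holomorphic \<phi> B c r M \<Longrightarrow> r > 0 \<Longrightarrow> M \<ge> 0"
  using curve_holomorphic_bound[of \<phi> B c r M c] polydisc_centre[of r c B] norm_ge_zero order_trans by blast

lemma curve_holomorphic_mono:
  assumes "curve_holomorphic \<phi> B c r M" "s \<le> r" "M \<le> N"
  shows "curve_holomorphic \<phi> B c s N"
  using assms polydisc_mono[OF assms(2), of B c] unfolding curve_holomorphic_def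
  by (meson order_trans subset_iff)

lemma curve_holomorphic_recentre:
  assumes "curve_holomorphic \<phi> B c r M" "c' \<in> polydisc B c (r - s)"
  shows "curve_holomorphic \<phi> B c' s M"
proof -
  have "polydisc B c' s \<subseteq> polydisc B c r"
  proof
    fix x assume x: "x \<in> polydisc B c' s"
    have "dist (x b) (c b) < r" if "b \<in> B" for b
      using dist_triangle[of "x b" "c b" "c' b"] x assms(2) that unfolding polydisc_def by force
    then show "x \<in> polydisc B c r" by (simp add: polydisc_def)
  qed
  then show ?thesis using assms(1) unfolding curve_holomorphic_def by (meson order_trans subset_iff)
qed

text \<open>The Cauchy estimate applies on the complex line through \<open>x\<close> and \<open>y\<close>. Points that agree on \<open>B\<close> are the
  case \<open>\<eta> = 0\<close>, where the curve jumps in the coordinates outside \<open>B\<close> and continuity of \<open>\<phi>\<close> along it forces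
  equal values.\<close>

lemma curve_holomorphic_Lipschitz:
  assumes \<phi>: "curve_holomorphic \<phi> B c r M" and r: "r > 0"
    and x: "x \<in> polydisc B c (r/2)" and y: "y \<in> polydisc B c (r/2)"
    and \<eta>: "\<And>b. b \<in> B \<Longrightarrow> dist (x b) (y b) \<le> \<eta>" "\<eta> \<ge> 0"
  shows "norm (\<phi> x - \<phi> y) \<le> 8 * M / r * \<eta>"
proof -
  have M: "M \<ge> 0" using curve_holomorphic_nonneg[OF \<phi> r] .
  have xr: "x \<in> polydisc B c r" "y \<in> polydisc B c r"
    using x y polydisc_mono[of "r/2" r B c] r by auto
  define \<gamma> where "\<gamma> = (\<lambda>u b. if b \<in> B then x b + u * (y b - x b) else if u = 0 then x b else y b)"
  have ends: "\<gamma> 0 = x" "\<gamma> 1 = y" by (auto simp: \<gamma>_def)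
  have hol: "(\<lambda>u. \<gamma> u b) holomorphic_on U" if "b \<in> B" for b U
    using that unfolding \<gamma>_def by (simp, intro holomorphic_intros)
  have inP: "\<gamma> u \<in> polydisc B c r" if u: "norm u * \<eta> < r/2" for u
    unfolding polydisc_def
  proof (clarsimp)
    fix b assume b: "b \<in> B"
    have "dist (\<gamma> u b) (x b) = norm u * dist (x b) (y b)"
      using b by (simp add: \<gamma>_def dist_norm norm_mult norm_minus_commute)
    also have "\<dots> \<le> norm u * \<eta>" using \<eta>(1)[OF b] by (simp add: mult_left_mono)
    finally have "dist (\<gamma> u b) (x b) < r/2" using u by simp
    moreover have "dist (x b) (c b) < r/2" using x b by (simp add: polydisc_def)
    ultimately show "dist (\<gamma> u b) (c b) < r" using dist_triangle[of "\<gamma> u b" "c b" "x b"] by linarith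
  qed
  show ?thesis
  proof (cases "\<eta> = 0")
    case True
    have "(\<lambda>u. \<phi> (\<gamma> u)) holomorphic_on UNIV"
      by (rule curve_holomorphic_along[OF \<phi> open_UNIV hol]) (use inP True r in auto)
    then have "isCont (\<lambda>u. \<phi> (\<gamma> u)) 0"
      using holomorphic_on_imp_continuous_on continuous_on_eq_continuous_at open_UNIV by blast
    then have "((\<lambda>u. \<phi> (\<gamma> u)) \<longlongrightarrow> \<phi> x) (at 0)" by (simp add: isCont_def ends)
    moreover have "\<phi> (\<gamma> u) = \<phi> y" if "u \<noteq> 0" for u
    proof -
      have "\<gamma> u = y" using that \<eta>(1) True by (auto simp: \<gamma>_def)
      then show ?thesis by simp
    qed
    then have "((\<lambda>u. \<phi> (\<gamma> u)) \<longlongrightarrow> \<phi> y) (at 0)"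
      by (intro tendsto_eventually) (auto simp: eventually_at_filter)
    ultimately have "\<phi> x = \<phi> y" using tendsto_unique trivial_limit_at by blast
    then show ?thesis using \<eta> M r by simp
  next
    case False
    then have \<eta>0: "\<eta> > 0" using \<eta> by simp
    define R where "R = r / (2 * \<eta>)"
    show ?thesis
    proof (cases "R > 2")
      case True
      have "norm (\<phi> (\<gamma> 0) - \<phi> (\<gamma> 1)) \<le> 4 * M / R * norm (0 - 1 :: complex)"
      proof (rule bounded_holomorphic_Lipschitz[where a = 0 and r = R and f = "\<lambda>u. \<phi> (\<gamma> u)"])
        have *: "\<gamma> u \<in> polydisc B c r" if "u \<in> ball 0 R" for u
          using that \<eta>0 by (intro inP) (simp add: R_def field_simps)
        show "(\<lambda>u. \<phi> (\<gamma> u)) holomorphic_on ball 0 R"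
          by (rule curve_holomorphic_along[OF \<phi> open_ball hol *])
        show "norm (\<phi> (\<gamma> u)) \<le> M" if "u \<in> ball 0 R" for u
          using curve_holomorphic_bound[OF \<phi> *[OF that]] .
      qed (use True in auto)
      then show ?thesis by (simp add: ends R_def mult_ac)
    next
      case False
      then have "r \<le> 4 * \<eta>" using \<eta>0 by (simp add: R_def field_simps)
      then have "2 * M * r \<le> 2 * M * (4 * \<eta>)" using M by (intro mult_left_mono) auto
      then have "2 * M \<le> 8 * M / r * \<eta>" using r by (simp add: field_simps)
      moreover have "norm (\<phi> x - \<phi> y) \<le> M + M"
        using norm_triangle_ineq4[of "\<phi> x" "\<phi> y"] curve_holomorphic_bound[OF \<phi>] xr by (meson add_mono order_trans)
      ultimately show ?thesis by simp
    qed
  qed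
qed

definition dirderiv :: "(('i \<Rightarrow> complex) \<Rightarrow> complex) \<Rightarrow> ('i \<Rightarrow> complex) \<Rightarrow> ('i \<Rightarrow> complex) \<Rightarrow> complex" where
  "dirderiv \<phi> x v = deriv (\<lambda>u. \<phi> (\<lambda>b. x b + u * v b)) 0"

lemma line_in_polydisc:
  assumes "x \<in> polydisc B c s" "\<And>b. b \<in> B \<Longrightarrow> norm (v b) \<le> K" "norm u * K \<le> t"
  shows "(\<lambda>b. x b + u * v b) \<in> polydisc B c (s + t)"
  unfolding polydisc_def
proof (clarsimp)
  fix b assume b: "b \<in> B"
  have "norm (u * v b) \<le> t"
    using mult_left_mono[OF assms(2)[OF b], of "norm u"] assms(3) by (simp add: norm_mult)
  then have "dist (x b + u * v b) (x b) \<le> t" by (simp add: dist_norm)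
  moreover have "dist (x b) (c b) < s" using assms(1) b by (simp add: polydisc_def)
  ultimately show "dist (x b + u * v b) (c b) < s + t"
    using dist_triangle[of "x b + u * v b" "c b" "x b"] by linarith
qed

lemma curve_holomorphic_line:
  assumes \<phi>: "curve_holomorphic \<phi> B c r M" and "x \<in> polydisc B c s" "\<And>b. b \<in> B \<Longrightarrow> norm (v b) \<le> K"
    and "R * K \<le> r - s" "K \<ge> 0"
  shows "(\<lambda>u. \<phi> (\<lambda>b. x b + u * v b)) holomorphic_on ball 0 R"
    and "\<And>u. u \<in> ball 0 R \<Longrightarrow> norm (\<phi> (\<lambda>b. x b + u * v b)) \<le> M"
proof -
  have *: "(\<lambda>b. x b + u * v b) \<in> polydisc B c r" if "u \<in> ball 0 R" for u
  proof -
    have "norm u * K \<le> R * K" using that assms(5) by (intro mult_right_mono) auto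
    then have "norm u * K \<le> r - s" using assms(4) by linarith
    from line_in_polydisc[OF assms(2,3) this] show ?thesis by simp
  qed
  show "(\<lambda>u. \<phi> (\<lambda>b. x b + u * v b)) holomorphic_on ball 0 R"
    by (rule curve_holomorphic_along[OF \<phi> open_ball _ *]) (auto intro!: holomorphic_intros)
  show "\<And>u. u \<in> ball 0 R \<Longrightarrow> norm (\<phi> (\<lambda>b. x b + u * v b)) \<le> M"
    using curve_holomorphic_bound[OF \<phi> *] .
qed

text \<open>The restrictions of \<open>\<phi>\<close> to two parallel lines differ by a multiple of \<open>\<eta>\<close>, and the Cauchy estimate bounds the
  derivative of the difference.\<close>

lemma dirderiv_Lipschitz:
  assumes \<phi>: "curve_holomorphic \<phi> B c r M" and r: "r > 0"
    and x: "x \<in> polydisc B c (r/4)" and y: "y \<in> polydisc B c (r/4)"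
    and \<eta>: "\<And>b. b \<in> B \<Longrightarrow> dist (x b) (y b) \<le> \<eta>" "\<eta> \<ge> 0"
    and v: "\<And>b. b \<in> B \<Longrightarrow> norm (v b) \<le> 1"
  shows "norm (dirderiv \<phi> x v - dirderiv \<phi> y v) \<le> 64 * M / r\<^sup>2 * \<eta>"
proof -
  let ?f = "\<lambda>x u. \<phi> (\<lambda>b. x b + u * v b)"
  have hx: "?f x holomorphic_on ball 0 (r/4)" and hy: "?f y holomorphic_on ball 0 (r/4)"
    by (rule curve_holomorphic_line[OF \<phi> x v]; use r in simp)
       (rule curve_holomorphic_line[OF \<phi> y v]; use r in simp)
  have "norm ((deriv ^^ 1) (\<lambda>u. ?f x u - ?f y u) 0 / fact 1) \<le> (8 * M / r * \<eta>) / (r/8) ^ 1"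
  proof (rule Taylor_coefficient_bound[where r = "r/4"])
    show "(\<lambda>u. ?f x u - ?f y u) holomorphic_on ball 0 (r/4)" by (intro holomorphic_intros hx hy)
    fix u :: complex assume u: "u \<in> ball 0 (r/4)"
    show "norm (?f x u - ?f y u) \<le> 8 * M / r * \<eta>"
    proof (rule curve_holomorphic_Lipschitz[OF \<phi> r])
      show "(\<lambda>b. x b + u * v b) \<in> polydisc B c (r/2)"
        using line_in_polydisc[OF x v, where u = u and t = "r/4"] u by simp
      show "(\<lambda>b. y b + u * v b) \<in> polydisc B c (r/2)"
        using line_in_polydisc[OF y v, where u = u and t = "r/4"] u by simp
    qed (use \<eta> in \<open>auto simp: dist_norm\<close>)
  qed (use r in auto)
  moreover have "deriv (\<lambda>u. ?f x u - ?f y u) 0 = dirderiv \<phi> x v - dirderiv \<phi> y v"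
    unfolding dirderiv_def
    using holomorphic_on_imp_differentiable_at[OF hx open_ball, of 0]
      holomorphic_on_imp_differentiable_at[OF hy open_ball, of 0] r
    by (intro deriv_diff) auto
  ultimately show ?thesis by (simp add: power2_eq_square)
qed

lemma dirderiv_has_field_derivative:
  assumes \<phi>: "curve_holomorphic \<phi> B c r M" and fin: "finite B" and x: "(\<lambda>b. x b + u0 * v b) \<in> polydisc B c s" "s < r"
  shows "((\<lambda>u. \<phi> (\<lambda>b. x b + u * v b)) has_field_derivative dirderiv \<phi> (\<lambda>b. x b + u0 * v b) v) (at u0)"
proof -
  define K where "K = 1 + (\<Sum>b\<in>B. norm (v b))"
  have K: "norm (v b) \<le> K" if "b \<in> B" for b
    using member_le_sum[of b B "\<lambda>b. norm (v b)"] that fin by (simp add: K_def)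
  have K0: "K > 0" using sum_nonneg[of B "\<lambda>b. norm (v b)"] by (simp add: K_def add_pos_nonneg)
  define R where "R = (r - s) / K"
  have R: "R > 0" "R * K \<le> r - s" using K0 x by (auto simp: R_def)
  let ?g = "\<lambda>w. \<phi> (\<lambda>b. (x b + u0 * v b) + w * v b)"
  have "?g holomorphic_on ball 0 R"
    by (rule curve_holomorphic_line[OF \<phi> x(1) K R(2)]) (use K0 in auto)
  then have "(?g has_field_derivative dirderiv \<phi> (\<lambda>b. x b + u0 * v b) v) (at (u0 + - u0))"
    unfolding dirderiv_def using holomorphic_derivI[OF _ open_ball, of ?g 0 R 0] R by simp
  then have "((\<lambda>u. ?g (u + - u0)) has_field_derivative dirderiv \<phi> (\<lambda>b. x b + u0 * v b) v) (at u0)"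
    by (simp only: DERIV_shift[of ?g _ u0 "-u0"])
  moreover have "?g (u + - u0) = \<phi> (\<lambda>b. x b + u * v b)" for u
    by (simp add: algebra_simps)
  ultimately show ?thesis by simp
qed

lemma dirderiv_scale:
  assumes \<phi>: "curve_holomorphic \<phi> B c r M" and fin: "finite B" and x: "x \<in> polydisc B c s" "s < r"
  shows "dirderiv \<phi> x (\<lambda>b. a * v b) = a * dirderiv \<phi> x v"
proof -
  have "((\<lambda>u. \<phi> (\<lambda>b. x b + u * v b)) has_field_derivative dirderiv \<phi> x v) (at (a * 0))"
    using dirderiv_has_field_derivative[OF \<phi> fin, of x 0 v s] x by simp
  from DERIV_chain2[where g = "\<lambda>u. a * u" and x = 0 and s = UNIV and Db = a, OF this]
  have "((\<lambda>u. \<phi> (\<lambda>b. x b + (a * u) * v b)) has_field_derivative dirderiv \<phi> x v * a) (at 0)"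
    by (auto intro!: derivative_eq_intros)
  then have "deriv (\<lambda>u. \<phi> (\<lambda>b. x b + (a * u) * v b)) 0 = dirderiv \<phi> x v * a" by (rule DERIV_imp_deriv)
  then show ?thesis by (simp add: dirderiv_def mult_ac)
qed

text \<open>On the plane spanned by \<open>v\<close> and \<open>w\<close> the function is separately holomorphic and bounded, hence
  differentiable; the sum rule is its chain rule along the diagonal.\<close>

lemma dirderiv_add:
  assumes \<phi>: "curve_holomorphic \<phi> B c r M" and fin: "finite B" and x: "x \<in> polydisc B c s" "s < r"
  shows "dirderiv \<phi> x (\<lambda>b. v b + w b) = dirderiv \<phi> x v + dirderiv \<phi> x w"
proof -
  define K where "K = 1 + (\<Sum>b\<in>B. norm (v b)) + (\<Sum>b\<in>B. norm (w b))"
  have s0: "0 \<le> (\<Sum>b\<in>B. norm (v b))" "0 \<le> (\<Sum>b\<in>B. norm (w b))" by (simp_all add: sum_nonneg)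
  have K: "norm (v b) \<le> K" "norm (w b) \<le> K" if "b \<in> B" for b
    using member_le_sum[of b B "\<lambda>b. norm (v b)"] member_le_sum[of b B "\<lambda>b. norm (w b)"] that fin s0
    by (auto simp: K_def)
  have K0: "K > 0" using s0 by (simp add: K_def)
  define R where "R = (r - s) / 2 / K"
  have R: "R > 0" "R * K = (r - s)/2" using K0 x by (auto simp: R_def)
  define h where "h = (\<lambda>(a, b'). \<phi> (\<lambda>b. x b + a * v b + b' * w b))"
  have inP: "(\<lambda>b. x b + a * v b) \<in> polydisc B c (s + (r-s)/2)"
            "(\<lambda>b. x b + a * w b) \<in> polydisc B c (s + (r-s)/2)" if "a \<in> ball 0 R" for a
  proof -
    have "norm a * K \<le> R * K" using that K0 by (intro mult_right_mono) auto
    then have "norm a * K \<le> (r-s)/2" using R by simp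
    then show "(\<lambda>b. x b + a * v b) \<in> polydisc B c (s + (r-s)/2)"
       "(\<lambda>b. x b + a * w b) \<in> polydisc B c (s + (r-s)/2)"
      using line_in_polydisc[OF x(1)] K by blast+
  qed
  have RK: "R * K \<le> r - (s + (r-s)/2)" using R(2) by (simp add: field_simps)
  have "(h has_derivative (\<lambda>(p, q). deriv (\<lambda>p. h (p, 0)) 0 * p + deriv (\<lambda>q. h (0, q)) 0 * q)) (at (0, 0))"
  proof (rule separately_holomorphic_has_derivative[where M = M and r = R])
    fix p q :: complex assume p: "p \<in> ball 0 R" and q: "q \<in> ball 0 R"
    show "norm (h (p, q)) \<le> M"
      using curve_holomorphic_line(2)[OF \<phi> inP(1)[OF p] K(2) RK _ q] K0 by (simp add: h_def)
  next
    fix q :: complex assume q: "q \<in> ball 0 R"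
    show "(\<lambda>p. h (p, q)) holomorphic_on ball 0 R"
    proof -
      have "(\<lambda>p. \<phi> (\<lambda>b. (x b + q * w b) + p * v b)) holomorphic_on ball 0 R"
        by (rule curve_holomorphic_line(1)[OF \<phi> inP(2)[OF q] K(1) RK]) (use K0 in auto)
      then show ?thesis by (simp add: h_def algebra_simps)
    qed
    show "(\<lambda>p. h (q, p)) holomorphic_on ball 0 R"
      using curve_holomorphic_line(1)[OF \<phi> inP(1)[OF q] K(2) RK] K0 by (simp add: h_def)
  qed (use R in auto)
  then have "(h has_derivative (\<lambda>(p, q). dirderiv \<phi> x v * p + dirderiv \<phi> x w * q)) (at (0, 0))"
    by (simp add: h_def dirderiv_def)
  then have hd: "(h has_derivative (\<lambda>(p, q). dirderiv \<phi> x v * p + dirderiv \<phi> x w * q)) (at ((\<lambda>u. (u, u)) 0))"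
    by simp
  have "((\<lambda>u::complex. (u, u)) has_derivative (\<lambda>u. (u, u))) (at 0)"
    by (intro has_derivative_Pair has_derivative_ident)
  from has_derivative_compose[OF this hd]
  have "((\<lambda>u. h (u, u)) has_field_derivative (dirderiv \<phi> x v + dirderiv \<phi> x w)) (at 0)"
    unfolding has_field_derivative_def by (simp add: distrib_right[symmetric])
  then have "deriv (\<lambda>u. h (u, u)) 0 = dirderiv \<phi> x v + dirderiv \<phi> x w" by (rule DERIV_imp_deriv)
  then show ?thesis by (simp add: h_def dirderiv_def algebra_simps)
qed

text \<open>The real point \<open>y\<close> of the complexified space.\<close>

definition cx :: "'a::euclidean_space \<Rightarrow> 'a \<Rightarrow> complex" where
  "cx y = (\<lambda>b. of_real (y \<bullet> b))"

lemma cx_in_polydisc: "dist y p < r \<Longrightarrow> cx y \<in> polydisc Basis (cx p) r"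
proof -
  assume d: "dist y p < r"
  have "dist (cx y b) (cx p b) < r" if "b \<in> Basis" for b
    using Basis_le_norm[OF that, of "y - p"] d
    by (simp add: cx_def dist_norm inner_diff_left flip: of_real_diff)
  then show ?thesis by (simp add: polydisc_def)
qed

text \<open>The derivative is linear by the previous lemmas, and the remainder is quadratic because directional
  derivatives are Lipschitz. The map \<open>E\<close> parametrises the real points of the polydisc, either by real
  coordinates or by complex coordinates together with their conjugates.\<close>

lemma curve_holomorphic_has_derivative_affine:
  fixes p :: "'a::euclidean_space" and E :: "'a \<Rightarrow> 'i \<Rightarrow> complex"
  assumes \<phi>: "curve_holomorphic \<phi> B c r M" and r: "r > 0" and fin: "finite B"
    and lin: "\<And>b. linear (\<lambda>v. E v b)" and bd: "\<And>v b. b \<in> B \<Longrightarrow> norm (E v b) \<le> norm v"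
  shows "((\<lambda>y. \<phi> (\<lambda>b. c b + E (y - p) b)) has_derivative (\<lambda>v. dirderiv \<phi> c (E v))) (at p)"
proof -
  let ?D = "dirderiv \<phi> c"
  have pc: "c \<in> polydisc B c (r/2)" "r/2 < r" using r by (auto intro: polydisc_centre)
  have linD: "linear (\<lambda>v. ?D (E v))"
  proof (rule linearI)
    fix v w :: 'a and a :: real
    have "E (v + w) = (\<lambda>b. E v b + E w b)" using linear_add[OF lin] by blast
    then show "?D (E (v + w)) = ?D (E v) + ?D (E w)"
      using dirderiv_add[OF \<phi> fin pc] by simp
    have "E (a *\<^sub>R v) = (\<lambda>b. of_real a * E v b)"
      using linear_scale[OF lin] by (auto simp: scaleR_conv_of_real)
    then show "?D (E (a *\<^sub>R v)) = a *\<^sub>R ?D (E v)"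
      using dirderiv_scale[OF \<phi> fin pc] by (simp add: scaleR_conv_of_real)
  qed
  define C where "C = 64 * M / r\<^sup>2"
  show ?thesis
  proof (rule has_derivativeI_sandwich[where e = "r/4" and H = "\<lambda>y. C * norm (y - p)"])
    show "bounded_linear (\<lambda>v. ?D (E v))" using linD linear_conv_bounded_linear by blast
    have "((\<lambda>y. norm (y - p)) \<longlongrightarrow> 0) (at p)"
      using tendsto_norm_zero[OF LIM_zero[OF tendsto_ident_at]] by blast
    then show "((\<lambda>y. C * norm (y - p)) \<longlongrightarrow> 0) (at p)" by (rule tendsto_mult_right_zero)
    fix y assume y: "y \<noteq> p" "dist y p < r/4"
    define \<eta> where "\<eta> = norm (y - p)"
    have \<eta>: "\<eta> > 0" "\<eta> < r/4" using y by (auto simp: \<eta>_def dist_norm)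
    define w where "w = (\<lambda>b. E (y - p) b / of_real \<eta>)"
    have w: "norm (w b) \<le> 1" if "b \<in> B" for b
      using bd[OF that, of "y - p"] \<eta>
      by (simp add: w_def norm_divide \<eta>_def divide_le_eq)
    define g where "g = (\<lambda>u. \<phi> (\<lambda>b. c b + u * w b))"
    have inP: "(\<lambda>b. c b + u * w b) \<in> polydisc B c (r/4)" if "norm u \<le> \<eta>" for u
    proof -
      have "(\<lambda>b. c b + u * w b) \<in> polydisc B c ((r/4 - \<eta>) + \<eta>)"
        by (rule line_in_polydisc[where K = 1]) (use \<eta> w that in \<open>auto intro: polydisc_centre\<close>)
      then show ?thesis by simp
    qed
    have gd: "(g has_field_derivative dirderiv \<phi> (\<lambda>b. c b + u * w b) w) (at u)" if "norm u \<le> \<eta>" for u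
      unfolding g_def by (rule dirderiv_has_field_derivative[OF \<phi> fin inP[OF that]]) (use r in auto)
    have "norm ((g (of_real \<eta>) - of_real \<eta> * ?D w) - (g 0 - 0 * ?D w)) \<le> (C * \<eta>) * norm (of_real \<eta> - 0 :: complex)"
    proof (rule field_differentiable_bound[where S = "cball 0 \<eta>" and f' = "\<lambda>u. dirderiv \<phi> (\<lambda>b. c b + u * w b) w - ?D w" and f = "\<lambda>u. g u - u * ?D w"])
      fix u :: complex assume "u \<in> cball 0 \<eta>"
      then have u: "norm u \<le> \<eta>" by simp
      have "((\<lambda>u. g u - u * ?D w) has_field_derivative dirderiv \<phi> (\<lambda>b. c b + u * w b) w - ?D w) (at u)"
        by (rule DERIV_diff[OF gd[OF u]]) (auto intro!: derivative_eq_intros)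
      then show "((\<lambda>u. g u - u * ?D w) has_field_derivative dirderiv \<phi> (\<lambda>b. c b + u * w b) w - ?D w) (at u within cball 0 \<eta>)"
        by (rule has_field_derivative_at_within)
      show "norm (dirderiv \<phi> (\<lambda>b. c b + u * w b) w - ?D w) \<le> C * \<eta>"
        unfolding C_def
      proof (rule dirderiv_Lipschitz[OF \<phi> r inP[OF u]])
        show "c \<in> polydisc B c (r/4)" using r by (intro polydisc_centre) simp
        fix b assume b: "b \<in> B"
        show "norm (w b) \<le> 1" by (rule w[OF b])
        have "dist (c b + u * w b) (c b) = norm u * norm (w b)" by (simp add: dist_norm norm_mult)
        also have "\<dots> \<le> \<eta> * 1" using u w[OF b] \<eta> by (intro mult_mono) auto
        finally show "dist (c b + u * w b) (c b) \<le> \<eta>" by simp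
      qed (use \<eta> in simp)
    qed (use \<eta> in auto)
    moreover have "g (of_real \<eta>) = \<phi> (\<lambda>b. c b + E (y - p) b)"
      using \<eta> by (simp add: g_def w_def)
    moreover have "g 0 = \<phi> c" by (simp add: g_def)
    moreover have "of_real \<eta> * ?D w = ?D (E (y - p))"
    proof -
      have "(\<lambda>b. of_real \<eta> * w b) = E (y - p)" using \<eta> by (simp add: w_def)
      then show ?thesis using dirderiv_scale[OF \<phi> fin pc, of "of_real \<eta>" w] by simp
    qed
    moreover have "E (p - p) b = 0" for b using linear_0[OF lin] by simp
    ultimately have "norm (\<phi> (\<lambda>b. c b + E (y - p) b) - \<phi> (\<lambda>b. c b + E (p - p) b) - ?D (E (y - p))) \<le> C * \<eta> * \<eta>"
      using \<eta> by (simp add: algebra_simps)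
    then show "norm (\<phi> (\<lambda>b. c b + E (y - p) b) - \<phi> (\<lambda>b. c b + E (p - p) b) - ?D (E (y - p))) / norm (y - p) \<le> C * norm (y - p)"
      using \<eta> unfolding \<eta>_def by (subst pos_divide_le_eq) auto
  qed (use r in auto)
qed

lemma curve_holomorphic_has_derivative:
  fixes p :: "'a::euclidean_space"
  assumes \<phi>: "curve_holomorphic \<phi> Basis (cx p) r M" and r: "r > 0"
  shows "((\<lambda>y. \<phi> (cx y)) has_derivative (\<lambda>v. dirderiv \<phi> (cx p) (cx v))) (at p)"
proof -
  have "linear (\<lambda>v::'a. cx v b)" for b
    by (rule linearI) (simp_all add: cx_def inner_add_left scaleR_conv_of_real)
  moreover have "norm (cx v b) \<le> norm v" if "b \<in> Basis" for v b :: 'a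
    using Basis_le_norm[OF that, of v] by (simp add: cx_def)
  ultimately have "((\<lambda>y. \<phi> (\<lambda>b. cx p b + cx (y - p) b)) has_derivative (\<lambda>v. dirderiv \<phi> (cx p) (cx v))) (at p)"
    by (rule curve_holomorphic_has_derivative_affine[OF \<phi> r finite_Basis])
  moreover have "(\<lambda>b. cx p b + cx (y - p) b) = cx y" for y
    by (simp add: cx_def inner_diff_left)
  ultimately show ?thesis by simp
qed

text \<open>Composition of functions that are holomorphic along curves needs no chain rule.\<close>

lemma curve_holomorphic_compose:
  assumes \<phi>: "curve_holomorphic \<phi> B c r M"
    and \<Psi>: "\<And>b. b \<in> B \<Longrightarrow> \<exists>N. curve_holomorphic (\<lambda>x. \<Psi> x b) J d s N"
    and into: "\<And>x. x \<in> polydisc J d s \<Longrightarrow> \<Psi> x \<in> polydisc B c r"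
  shows "curve_holomorphic (\<lambda>x. \<phi> (\<Psi> x)) J d s M"
  unfolding curve_holomorphic_def
proof (intro conjI ballI allI impI)
  show "norm (\<phi> (\<Psi> x)) \<le> M" if "x \<in> polydisc J d s" for x
    using curve_holomorphic_bound[OF \<phi> into[OF that]] .
  fix U \<gamma> assume U: "open U" "\<forall>b\<in>J. (\<lambda>u. \<gamma> u b) holomorphic_on U" "\<gamma> ` U \<subseteq> polydisc J d s"
  show "(\<lambda>u. \<phi> (\<Psi> (\<gamma> u))) holomorphic_on U"
  proof (rule curve_holomorphic_along[OF \<phi> U(1)])
    fix b assume "b \<in> B"
    then obtain N where N: "curve_holomorphic (\<lambda>x. \<Psi> x b) J d s N" using \<Psi> by blast
    show "(\<lambda>u. \<Psi> (\<gamma> u) b) holomorphic_on U"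
      by (rule curve_holomorphic_along[OF N U(1)]) (use U in auto)
  qed (use U into in blast)
qed

text \<open>The coordinates of \<open>\<Psi>\<close> are Lipschitz, so a small polydisc about \<open>d\<close> is mapped close to \<open>c\<close>.\<close>

lemma curve_holomorphic_shrink_into:
  assumes fin: "finite B" and s: "s > 0" and r: "r > 0"
    and \<Psi>: "\<And>b. b \<in> B \<Longrightarrow> \<exists>N. curve_holomorphic (\<lambda>x. \<Psi> x b) J d s N"
    and c: "\<And>b. b \<in> B \<Longrightarrow> \<Psi> d b = c b"
  shows "\<exists>s'>0. s' \<le> s \<and> (\<forall>x\<in>polydisc J d s'. \<Psi> x \<in> polydisc B c r)"
proof -
  have "\<exists>s'>0. \<forall>x\<in>polydisc J d s'. dist (\<Psi> x b) (c b) < r" if b: "b \<in> B" for b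
  proof -
    obtain N where N: "curve_holomorphic (\<lambda>x. \<Psi> x b) J d s N" using \<Psi>[OF b] by blast
    have N0: "N \<ge> 0" by (rule curve_holomorphic_nonneg[OF N s])
    define s' where "s' = min (s/2) (r / (8 * N / s + 1))"
    have K: "8 * N / s + 1 > 0" using N0 s by (simp add: add_nonneg_pos)
    have "s' \<le> s/2" unfolding s'_def by (rule min.cobounded1)
    moreover have "s' > 0" using s r K by (simp add: s'_def)
    ultimately have s': "s' > 0" "s' \<le> s/2" by blast+
    have "dist (\<Psi> x b) (c b) < r" if x: "x \<in> polydisc J d s'" for x
    proof -
      have "norm (\<Psi> x b - \<Psi> d b) \<le> 8 * N / s * s'"
        by (rule curve_holomorphic_Lipschitz[OF N s])
           (use x s' polydisc_mono[OF s'(2), of J d] s in \<open>auto simp: polydisc_def less_imp_le\<close>)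
      also have "\<dots> < (8 * N / s + 1) * s'" using s' by (simp add: algebra_simps)
      also have "\<dots> \<le> (8 * N / s + 1) * (r / (8 * N / s + 1))"
        using K by (intro mult_left_mono) (auto simp: s'_def)
      also have "\<dots> = r" using K by simp
      finally show ?thesis by (simp add: dist_norm c[OF b])
    qed
    then show ?thesis using s' by blast
  qed
  then have "\<forall>b\<in>B. \<exists>s'>0. \<forall>x\<in>polydisc J d s'. dist (\<Psi> x b) (c b) < r" by blast
  from bchoice[OF this] obtain t where t: "\<forall>b\<in>B. t b > 0 \<and> (\<forall>x\<in>polydisc J d (t b). dist (\<Psi> x b) (c b) < r)" ..
  define s' where "s' = Min (insert s (t ` B))"
  have "s' > 0" using t s fin by (simp add: s'_def)
  moreover have "s' \<le> s" using fin by (simp add: s'_def)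
  moreover have "\<Psi> x \<in> polydisc B c r" if x: "x \<in> polydisc J d s'" for x
  proof -
    have "x \<in> polydisc J d (t b)" if "b \<in> B" for b
      using x polydisc_mono[of s' "t b" J d] fin that by (auto simp: s'_def)
    then show ?thesis using t by (auto simp: polydisc_def)
  qed
  ultimately show ?thesis by blast
qed

lemma curve_holomorphic_compose_shrink:
  assumes \<phi>: "curve_holomorphic \<phi> B c r M" and fin: "finite B" and s: "s > 0" and r: "r > 0"
    and \<Psi>: "\<And>b. b \<in> B \<Longrightarrow> \<exists>N. curve_holomorphic (\<lambda>x. \<Psi> x b) J d s N"
    and c: "\<And>b. b \<in> B \<Longrightarrow> \<Psi> d b = c b"
  shows "\<exists>s'>0. s' \<le> s \<and> curve_holomorphic (\<lambda>x. \<phi> (\<Psi> x)) J d s' M \<and>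
           (\<forall>x\<in>polydisc J d s'. \<Psi> x \<in> polydisc B c r)"
proof -
  obtain s' where s': "s' > 0" "s' \<le> s" "\<And>x. x \<in> polydisc J d s' \<Longrightarrow> \<Psi> x \<in> polydisc B c r"
    using curve_holomorphic_shrink_into[where \<Psi> = \<Psi> and B = B and c = c, OF fin s r \<Psi> c] by blast
  have "curve_holomorphic (\<lambda>x. \<phi> (\<Psi> x)) J d s' M"
  proof (rule curve_holomorphic_compose[OF \<phi> _ s'(3)])
    fix b assume "b \<in> B"
    then obtain N where "curve_holomorphic (\<lambda>x. \<Psi> x b) J d s N" using \<Psi> by blast
    then show "\<exists>N. curve_holomorphic (\<lambda>x. \<Psi> x b) J d s' N"
      using curve_holomorphic_mono[OF _ s'(2) order_refl] by blast
  qed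
  then show ?thesis using s' by blast
qed

lemma curve_holomorphic_linear:
  assumes "finite B" "A \<subseteq> B" "r > 0"
  shows "curve_holomorphic (\<lambda>x. \<Sum>j\<in>A. k j * x j) B c r (\<Sum>j\<in>A. norm (k j) * (norm (c j) + r))"
  unfolding curve_holomorphic_def
proof (intro conjI ballI allI impI)
  fix x assume x: "x \<in> polydisc B c r"
  show "norm (\<Sum>j\<in>A. k j * x j) \<le> (\<Sum>j\<in>A. norm (k j) * (norm (c j) + r))"
  proof (rule sum_norm_le)
    fix j assume "j \<in> A"
    then have "norm (x j - c j) < r" using x assms by (auto simp: polydisc_def dist_norm)
    then have "norm (x j) \<le> norm (c j) + r" using norm_triangle_sub[of "x j" "c j"] by linarith
    then show "norm (k j * x j) \<le> norm (k j) * (norm (c j) + r)"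
      by (simp add: norm_mult mult_left_mono)
  qed
next
  fix U \<gamma> assume "open U" "\<forall>b\<in>B. (\<lambda>u. \<gamma> u b) holomorphic_on U"
  then show "(\<lambda>u. \<Sum>j\<in>A. k j * \<gamma> u j) holomorphic_on U"
    using assms by (intro holomorphic_intros) auto
qed

section \<open>Complexification of real analytic functions\<close>

lemma curve_holomorphic_add:
  assumes "curve_holomorphic \<phi> B c r M" "curve_holomorphic \<psi> B c s N"
  shows "curve_holomorphic (\<lambda>x. \<phi> x + k * \<psi> x) B c (min r s) (M + norm k * N)"
proof -
  have sub: "polydisc B c (min r s) \<subseteq> polydisc B c r" "polydisc B c (min r s) \<subseteq> polydisc B c s"
    by (simp_all add: polydisc_mono)
  show ?thesis unfolding curve_holomorphic_def
  proof (intro conjI ballI allI impI)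
    fix x assume "x \<in> polydisc B c (min r s)"
    then have "norm (\<phi> x) \<le> M" "norm (\<psi> x) \<le> N"
      using sub curve_holomorphic_bound[OF assms(1)] curve_holomorphic_bound[OF assms(2)] by blast+
    then show "norm (\<phi> x + k * \<psi> x) \<le> M + norm k * N"
      by (intro norm_triangle_le add_mono) (auto simp: norm_mult mult_left_mono)
  next
    fix U \<gamma> assume U: "open U" "\<forall>b\<in>B. (\<lambda>u. \<gamma> u b) holomorphic_on U" "\<gamma> ` U \<subseteq> polydisc B c (min r s)"
    show "(\<lambda>u. \<phi> (\<gamma> u) + k * \<psi> (\<gamma> u)) holomorphic_on U"
      by (intro holomorphic_intros curve_holomorphic_along[OF assms(1) U(1)] curve_holomorphic_along[OF assms(2) U(1)])
         (use U sub in blast)+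
  qed
qed

text \<open>An absolutely convergent power series converges uniformly along every holomorphic curve in
  the polydisc, so its sum is holomorphic along the curve.\<close>

lemma curve_holomorphic_power_series:
  fixes k :: "('i \<Rightarrow> nat) \<Rightarrow> real" and c :: "'i \<Rightarrow> complex"
  assumes fin: "finite B" and s: "s > 0"
    and sm: "(\<lambda>\<alpha>. (\<Prod>b\<in>B. s ^ \<alpha> b) * \<bar>k \<alpha>\<bar>) summable_on X"
  shows "curve_holomorphic (\<lambda>x. \<Sum>\<^sub>\<infinity>\<alpha>\<in>X. (\<Prod>b\<in>B. (x b - c b) ^ \<alpha> b) * of_real (k \<alpha>)) B c s
           (\<Sum>\<^sub>\<infinity>\<alpha>\<in>X. (\<Prod>b\<in>B. s ^ \<alpha> b) * \<bar>k \<alpha>\<bar>)"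
proof -
  let ?t = "\<lambda>\<alpha> x. (\<Prod>b\<in>B. (x b - c b) ^ \<alpha> b) * complex_of_real (k \<alpha>)"
  have tb: "norm (?t \<alpha> x) \<le> (\<Prod>b\<in>B. s ^ \<alpha> b) * \<bar>k \<alpha>\<bar>" if x: "x \<in> polydisc B c s" for \<alpha> x
  proof -
    have "(\<Prod>b\<in>B. norm (x b - c b) ^ \<alpha> b) \<le> (\<Prod>b\<in>B. s ^ \<alpha> b)"
      using x by (intro prod_mono conjI power_mono) (auto simp: polydisc_def dist_norm less_imp_le)
    then show ?thesis by (simp add: norm_mult prod_norm[symmetric] norm_power mult_right_mono)
  qed
  have ul: "uniform_limit (polydisc B c s) (\<lambda>Y x. \<Sum>\<alpha>\<in>Y. ?t \<alpha> x) (\<lambda>x. \<Sum>\<^sub>\<infinity>\<alpha>\<in>X. ?t \<alpha> x) (finite_subsets_at_top X)"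
    by (rule Weierstrass_m_test_general[OF tb sm])
  show ?thesis unfolding curve_holomorphic_def
  proof (intro conjI ballI allI impI)
    fix x assume x: "x \<in> polydisc B c s"
    have abs: "(\<lambda>\<alpha>. norm (?t \<alpha> x)) summable_on X"
      by (rule summable_on_comparison_test[OF sm]) (use tb[OF x] in auto)
    have "norm (\<Sum>\<^sub>\<infinity>\<alpha>\<in>X. ?t \<alpha> x) \<le> (\<Sum>\<^sub>\<infinity>\<alpha>\<in>X. norm (?t \<alpha> x))"
      by (rule norm_infsum_bound[OF abs])
    also have "\<dots> \<le> (\<Sum>\<^sub>\<infinity>\<alpha>\<in>X. (\<Prod>b\<in>B. s ^ \<alpha> b) * \<bar>k \<alpha>\<bar>)"
      by (rule infsum_mono[OF abs sm tb[OF x]])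
    finally show "norm (\<Sum>\<^sub>\<infinity>\<alpha>\<in>X. ?t \<alpha> x) \<le> (\<Sum>\<^sub>\<infinity>\<alpha>\<in>X. (\<Prod>b\<in>B. s ^ \<alpha> b) * \<bar>k \<alpha>\<bar>)" .
  next
    fix U \<gamma> assume U: "open U" "\<forall>b\<in>B. (\<lambda>u. \<gamma> u b) holomorphic_on U" "\<gamma> ` U \<subseteq> polydisc B c s"
    have ulU: "uniform_limit U (\<lambda>Y u. \<Sum>\<alpha>\<in>Y. ?t \<alpha> (\<gamma> u)) (\<lambda>u. \<Sum>\<^sub>\<infinity>\<alpha>\<in>X. ?t \<alpha> (\<gamma> u)) (finite_subsets_at_top X)"
      using uniform_limit_compose'[OF ul, of \<gamma> U] U(3) by blast
    have parts: "(\<lambda>u. \<Sum>\<alpha>\<in>Y. ?t \<alpha> (\<gamma> u)) holomorphic_on U" for Y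
      using U(2) by (intro holomorphic_intros) auto
    have "\<exists>r>0. ball z r \<subseteq> U \<and> (\<lambda>u. \<Sum>\<^sub>\<infinity>\<alpha>\<in>X. ?t \<alpha> (\<gamma> u)) holomorphic_on ball z r" if z: "z \<in> U" for z
    proof -
      obtain r where r: "r > 0" "cball z r \<subseteq> U" using U(1) z open_contains_cball by blast
      have ev: "\<forall>\<^sub>F Y in finite_subsets_at_top X. continuous_on (cball z r) (\<lambda>u. \<Sum>\<alpha>\<in>Y. ?t \<alpha> (\<gamma> u)) \<and>
              (\<lambda>u. \<Sum>\<alpha>\<in>Y. ?t \<alpha> (\<gamma> u)) holomorphic_on ball z r"
      proof (intro always_eventually allI conjI)
        fix Y
        have h: "(\<lambda>u. \<Sum>\<alpha>\<in>Y. ?t \<alpha> (\<gamma> u)) holomorphic_on cball z r"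
          by (rule holomorphic_on_subset[OF parts r(2)])
        show "continuous_on (cball z r) (\<lambda>u. \<Sum>\<alpha>\<in>Y. ?t \<alpha> (\<gamma> u))"
          by (rule holomorphic_on_imp_continuous_on[OF h])
        show "(\<lambda>u. \<Sum>\<alpha>\<in>Y. ?t \<alpha> (\<gamma> u)) holomorphic_on ball z r"
          by (rule holomorphic_on_subset[OF h ball_subset_cball])
      qed
      have "(\<lambda>u. \<Sum>\<^sub>\<infinity>\<alpha>\<in>X. ?t \<alpha> (\<gamma> u)) holomorphic_on ball z r"
        by (rule holomorphic_uniform_limit[OF ev uniform_limit_on_subset[OF ulU r(2)]]) auto
      then show ?thesis using r ball_subset_cball by (meson order_trans)
    qed
    then have "\<forall>z\<in>U. \<exists>r>0. ball z r \<subseteq> U \<and> (\<lambda>u. \<Sum>\<^sub>\<infinity>\<alpha>\<in>X. ?t \<alpha> (\<gamma> u)) holomorphic_on ball z r" ..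
    from bchoice[OF this] obtain r where r: "\<forall>z\<in>U. r z > 0 \<and> ball z (r z) \<subseteq> U \<and>
        (\<lambda>u. \<Sum>\<^sub>\<infinity>\<alpha>\<in>X. ?t \<alpha> (\<gamma> u)) holomorphic_on ball z (r z)" ..
    have "(\<lambda>u. \<Sum>\<^sub>\<infinity>\<alpha>\<in>X. ?t \<alpha> (\<gamma> u)) holomorphic_on (\<Union>z\<in>U. ball z (r z))"
      using r by (intro holomorphic_on_UN_open) auto
    moreover have "(\<Union>z\<in>U. ball z (r z)) = U"
    proof
      show "(\<Union>z\<in>U. ball z (r z)) \<subseteq> U" using r by blast
      show "U \<subseteq> (\<Union>z\<in>U. ball z (r z))" using r centre_in_ball by blast
    qed
    ultimately show "(\<lambda>u. \<Sum>\<^sub>\<infinity>\<alpha>\<in>X. ?t \<alpha> (\<gamma> u)) holomorphic_on U" by simp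
  qed
qed

text \<open>At the point whose offset from \<open>p\<close> has all coordinates equal to \<open>s\<close>, the series converges absolutely; this
  dominates the series with complex arguments on the polydisc of radius \<open>s\<close>.\<close>

lemma real_analytic_complexification:
  fixes f :: "'a::euclidean_space \<Rightarrow> 'b::euclidean_space"
  assumes f: "real_analytic_on f S" and p: "p \<in> S" and i: "i \<in> Basis"
  shows "\<exists>r>0. \<exists>M \<phi>. curve_holomorphic \<phi> Basis (cx p) r M \<and>
           (\<forall>x. (\<forall>b\<in>Basis. \<bar>(x - p) \<bullet> b\<bar> < r) \<longrightarrow>
              Im (\<phi> (cx x)) = 0 \<and> (x \<in> S \<longrightarrow> \<phi> (cx x) = of_real (f x \<bullet> i)))"
proof -
  define X where "X = (Basis :: 'a set) \<rightarrow>\<^sub>E (UNIV :: nat set)"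
  have "\<exists>r>0. \<exists>(c :: ('a \<Rightarrow> nat) \<Rightarrow> 'b) F. \<forall>x\<in>ball p r.
     ((\<lambda>\<alpha>. (\<Prod>b\<in>Basis. ((x - p) \<bullet> b) ^ \<alpha> b) *\<^sub>R c \<alpha>) has_sum F x) X \<and> (x \<in> S \<longrightarrow> f x = F x)"
    using bspec[OF f[unfolded real_analytic_on_def] p] unfolding X_def .
  then obtain r and c :: "('a \<Rightarrow> nat) \<Rightarrow> 'b" and F where r: "r > 0" and F: "\<forall>x\<in>ball p r.
     ((\<lambda>\<alpha>. (\<Prod>b\<in>Basis. ((x - p) \<bullet> b) ^ \<alpha> b) *\<^sub>R c \<alpha>) has_sum F x) X \<and> (x \<in> S \<longrightarrow> f x = F x)"
    by (elim exE conjE)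
  define k where "k = (\<lambda>\<alpha>. c \<alpha> \<bullet> i)"
  \<comment> \<open>the cube of half side \<open>s\<close> about \<open>p\<close> lies in the ball of convergence\<close>
  define s where "s = r / (2 * real DIM('a))"
  have n0: "real DIM('a) \<ge> 1" using DIM_positive[where 'a='a] by simp
  then have s: "s > 0" using r by (simp add: s_def)
  have near: "x \<in> ball p r" if "\<forall>b\<in>Basis. \<bar>(x - p) \<bullet> b\<bar> \<le> s" for x
  proof -
    have "norm (x - p) \<le> (\<Sum>b\<in>Basis. \<bar>(x - p) \<bullet> b\<bar>)" by (rule norm_le_l1)
    also have "\<dots> \<le> (\<Sum>b\<in>(Basis::'a set). s)" using that by (intro sum_mono) auto
    also have "\<dots> < r" using r n0 by (simp add: s_def)
    finally show ?thesis by (simp add: dist_norm norm_minus_commute)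
  qed
  have comp: "((\<lambda>\<alpha>. (\<Prod>b\<in>Basis. ((x - p) \<bullet> b) ^ \<alpha> b) * k \<alpha>) has_sum (F x \<bullet> i)) X" if "x \<in> ball p r" for x
    using has_sum_bounded_linear[OF bounded_linear_inner_left conjunct1[OF bspec[OF F that]], of i]
    by (simp add: k_def)
  define x1 where "x1 = p + (\<Sum>b\<in>Basis. s *\<^sub>R b)"
  have x1: "(x1 - p) \<bullet> b = s" if "b \<in> Basis" for b
    using that by (simp add: x1_def inner_sum_left inner_Basis if_distrib sum.delta cong: if_cong)
  have "x1 \<in> ball p r" using near[of x1] x1 s by simp
  from comp[OF this] have "((\<lambda>\<alpha>. (\<Prod>b\<in>Basis. s ^ \<alpha> b) * k \<alpha>) has_sum (F x1 \<bullet> i)) X"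
    by (simp add: x1 cong: prod.cong)
  then have "(\<lambda>\<alpha>. norm ((\<Prod>b\<in>Basis. s ^ \<alpha> b) * k \<alpha>)) summable_on X"
    by (rule summable_on_iff_abs_summable_on_real[THEN iffD1, OF has_sum_imp_summable])
  then have sm: "(\<lambda>\<alpha>. (\<Prod>b\<in>Basis. s ^ \<alpha> b) * \<bar>k \<alpha>\<bar>) summable_on X"
    using s by (simp add: abs_mult prod_nonneg abs_of_nonneg)
  define \<phi> where "\<phi> = (\<lambda>x. \<Sum>\<^sub>\<infinity>\<alpha>\<in>X. (\<Prod>b\<in>Basis. (x b - cx p b) ^ \<alpha> b) * complex_of_real (k \<alpha>))"
  have ch: "curve_holomorphic \<phi> Basis (cx p) s (\<Sum>\<^sub>\<infinity>\<alpha>\<in>X. (\<Prod>b\<in>Basis. s ^ \<alpha> b) * \<bar>k \<alpha>\<bar>)"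
    unfolding \<phi>_def by (rule curve_holomorphic_power_series[OF finite_Basis s sm])
  have val: "\<phi> (cx x) = of_real (F x \<bullet> i)" if "x \<in> ball p r" for x
  proof -
    have "((\<lambda>\<alpha>. of_real ((\<Prod>b\<in>Basis. ((x - p) \<bullet> b) ^ \<alpha> b) * k \<alpha>)) has_sum complex_of_real (F x \<bullet> i)) X"
      by (rule has_sum_bounded_linear[OF bounded_linear_of_real comp[OF that]])
    then have "((\<lambda>\<alpha>. (\<Prod>b\<in>Basis. (cx x b - cx p b) ^ \<alpha> b) * complex_of_real (k \<alpha>)) has_sum complex_of_real (F x \<bullet> i)) X"
      by (simp add: cx_def inner_diff_left)
    then show ?thesis unfolding \<phi>_def by (rule infsumI)
  qed
  have "Im (\<phi> (cx x)) = 0 \<and> (x \<in> S \<longrightarrow> \<phi> (cx x) = of_real (f x \<bullet> i))"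
    if "\<forall>b\<in>Basis. \<bar>(x - p) \<bullet> b\<bar> < s" for x
  proof -
    have x: "x \<in> ball p r" using near that less_imp_le by blast
    show ?thesis using val[OF x] bspec[OF F x] by simp
  qed
  note val' = this
  show ?thesis
    by (rule exI[of _ s], rule conjI[OF s], rule exI, rule exI[of _ \<phi>], rule conjI[OF ch])
       (intro allI impI val')
qed

lemma real_analytic_complexification_complex:
  fixes f :: "'a::euclidean_space \<Rightarrow> complex"
  assumes f: "real_analytic_on f S" and p: "p \<in> S"
  shows "\<exists>r>0. \<exists>M \<phi>. curve_holomorphic \<phi> Basis (cx p) r M \<and>
           (\<forall>x\<in>S. (\<forall>b\<in>Basis. \<bar>(x - p) \<bullet> b\<bar> < r) \<longrightarrow> \<phi> (cx x) = f x)"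
proof -
  obtain r1 M1 \<phi>1 where 1: "r1 > 0" "curve_holomorphic \<phi>1 Basis (cx p) r1 M1"
    "\<And>x. (\<forall>b\<in>Basis. \<bar>(x - p) \<bullet> b\<bar> < r1) \<Longrightarrow> x \<in> S \<Longrightarrow> \<phi>1 (cx x) = of_real (f x \<bullet> 1)"
    using real_analytic_complexification[OF f p, of 1] by (auto simp: Basis_complex_def)
  obtain r2 M2 \<phi>2 where 2: "r2 > 0" "curve_holomorphic \<phi>2 Basis (cx p) r2 M2"
    "\<And>x. (\<forall>b\<in>Basis. \<bar>(x - p) \<bullet> b\<bar> < r2) \<Longrightarrow> x \<in> S \<Longrightarrow> \<phi>2 (cx x) = of_real (f x \<bullet> \<i>)"
    using real_analytic_complexification[OF f p, of \<i>] by (auto simp: Basis_complex_def)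
  show ?thesis
  proof (intro exI conjI ballI impI)
    show "min r1 r2 > 0" using 1 2 by simp
    show "curve_holomorphic (\<lambda>x. \<phi>1 x + \<i> * \<phi>2 x) Basis (cx p) (min r1 r2) (M1 + norm \<i> * M2)"
      by (rule curve_holomorphic_add[OF 1(2) 2(2)])
    fix x assume "x \<in> S" "\<forall>b\<in>Basis. \<bar>(x - p) \<bullet> b\<bar> < min r1 r2"
    then show "\<phi>1 (cx x) + \<i> * \<phi>2 (cx x) = f x"
      using 1(3)[of x] 2(3)[of x] by (simp add: complex_eq_iff)
  qed
qed

lemma real_analytic_on_has_derivative:
  fixes f :: "'a::euclidean_space \<Rightarrow> 'b::euclidean_space"
  assumes f: "real_analytic_on f S" and S: "open S" and p: "p \<in> S"
  shows "\<exists>L. (f has_derivative L) (at p)"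
proof -
  have "\<exists>L. ((\<lambda>x. f x \<bullet> i) has_derivative L) (at p)" if i: "i \<in> Basis" for i
  proof -
    obtain r M \<phi> where r: "r > 0" and \<phi>: "curve_holomorphic \<phi> Basis (cx p) r M" and
      val: "\<And>x. (\<forall>b\<in>Basis. \<bar>(x - p) \<bullet> b\<bar> < r) \<Longrightarrow> x \<in> S \<Longrightarrow> \<phi> (cx x) = of_real (f x \<bullet> i)"
      using real_analytic_complexification[OF f p i] by blast
    have "((\<lambda>x. Re (\<phi> (cx x))) has_derivative (\<lambda>v. Re (dirderiv \<phi> (cx p) (cx v)))) (at p)"
      by (rule bounded_linear.has_derivative[OF bounded_linear_Re curve_holomorphic_has_derivative[OF \<phi> r]])
    moreover have "eventually (\<lambda>x. x \<in> S \<inter> ball p r) (at p)"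
      using S p r by (intro eventually_at_in_open') auto
    then have "eventually (\<lambda>x. Re (\<phi> (cx x)) = f x \<bullet> i) (at p)"
    proof (rule eventually_mono)
      fix x assume x: "x \<in> S \<inter> ball p r"
      have "\<bar>(x - p) \<bullet> b\<bar> < r" if "b \<in> Basis" for b
        using Basis_le_norm[OF that, of "x - p"] x by (simp add: dist_norm norm_minus_commute)
      then show "Re (\<phi> (cx x)) = f x \<bullet> i" using val[of x] x by simp
    qed
    moreover have "Re (\<phi> (cx p)) = f p \<bullet> i" using val[of p] r p by simp
    ultimately have "((\<lambda>x. f x \<bullet> i) has_derivative (\<lambda>v. Re (dirderiv \<phi> (cx p) (cx v)))) (at p)"
      by (rule has_derivative_transform_eventually) auto
    then show ?thesis by blast
  qed
  then obtain L where L: "\<And>i. i \<in> Basis \<Longrightarrow> ((\<lambda>x. f x \<bullet> i) has_derivative L i) (at p)" by metis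
  have "(f has_derivative (\<lambda>v. \<Sum>i\<in>Basis. L i v *\<^sub>R i)) (at p)"
    by (subst has_derivative_componentwise_within)
       (use L in \<open>simp add: inner_sum_left inner_Basis if_distrib sum.delta cong: if_cong\<close>)
  then show ?thesis by blast
qed

lemma real_analytic_on_imp_continuous_on:
  fixes f :: "'a::euclidean_space \<Rightarrow> 'b::euclidean_space"
  assumes f: "real_analytic_on f S"
  shows "continuous_on S f"
proof (subst continuous_on_componentwise, intro ballI)
  fix i :: 'b assume i: "i \<in> Basis"
  show "continuous_on S (\<lambda>x. f x \<bullet> i)" unfolding continuous_on_eq_continuous_within
  proof
    fix p assume p: "p \<in> S"
    obtain r M \<phi> where r: "r > 0" and \<phi>: "curve_holomorphic \<phi> Basis (cx p) r M" and
      val: "\<And>x. (\<forall>b\<in>Basis. \<bar>(x - p) \<bullet> b\<bar> < r) \<Longrightarrow> x \<in> S \<Longrightarrow> \<phi> (cx x) = of_real (f x \<bullet> i)"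
      using real_analytic_complexification[OF f p i] by blast
    have "continuous (at p within S) (\<lambda>x. Re (\<phi> (cx x)))"
      using has_derivative_continuous[OF bounded_linear.has_derivative[OF bounded_linear_Re
          curve_holomorphic_has_derivative[OF \<phi> r]]] continuous_at_imp_continuous_within by blast
    then show "continuous (at p within S) (\<lambda>x. f x \<bullet> i)"
    proof (rule continuous_transform_within[OF _ r p])
      fix x assume x: "x \<in> S" "dist x p < r"
      have "\<bar>(x - p) \<bullet> b\<bar> < r" if "b \<in> Basis" for b
        using Basis_le_norm[OF that, of "x - p"] x by (simp add: dist_norm)
      then show "Re (\<phi> (cx x)) = f x \<bullet> i" using val[of x] x by simp
    qed
  qed
qed

section \<open>The unit normal of a real analytic hypersurface\<close>

lemma norm_sgn_diff_le:
  fixes a b :: "'a::real_normed_vector"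
  assumes "a \<noteq> 0" "b \<noteq> 0"
  shows "norm (sgn a - sgn b) \<le> 2 * norm (a - b) / norm b"
proof -
  have na: "norm a > 0" "norm b > 0" using assms by auto
  have "sgn a - sgn b = (a - b) /\<^sub>R norm b + (inverse (norm a) - inverse (norm b)) *\<^sub>R a"
    by (simp add: sgn_div_norm algebra_simps)
  then have "norm (sgn a - sgn b) \<le> norm ((a - b) /\<^sub>R norm b) + norm ((inverse (norm a) - inverse (norm b)) *\<^sub>R a)"
    using norm_triangle_ineq by metis
  also have "norm ((inverse (norm a) - inverse (norm b)) *\<^sub>R a) = \<bar>norm b - norm a\<bar> / norm b"
  proof -
    have "(inverse (norm a) - inverse (norm b)) * norm a = (norm b - norm a) / norm b"
      using na by (simp add: field_simps)
    then have "\<bar>inverse (norm a) - inverse (norm b)\<bar> * norm a = \<bar>norm b - norm a\<bar> / norm b"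
      using na by (metis abs_divide abs_mult abs_norm_cancel)
    then show ?thesis by simp
  qed
  also have "\<dots> \<le> norm (a - b) / norm b"
    using norm_triangle_ineq3[of b a] by (intro divide_right_mono) (auto simp: norm_minus_commute)
  finally show ?thesis by (simp add: divide_inverse mult_ac)
qed

lemma has_derivative_along_line:
  fixes \<rho> :: "'a::euclidean_space \<Rightarrow> real"
  assumes "(\<rho> has_derivative (\<lambda>v. g \<bullet> v)) (at q)"
  shows "((\<lambda>s. \<rho> (q + s *\<^sub>R v)) has_real_derivative g \<bullet> v) (at 0)"
proof -
  have 1: "((\<lambda>s::real. q + s *\<^sub>R v) has_derivative (\<lambda>s. 0 + s *\<^sub>R v)) (at 0)"
    by (intro has_derivative_add has_derivative_const has_derivative_scaleR_left has_derivative_ident)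
  have "(\<rho> has_derivative (\<lambda>v. g \<bullet> v)) (at (q + 0 *\<^sub>R v))" using assms by simp
  note 2 = has_derivative_compose[OF 1 this]
  have "(\<lambda>s. g \<bullet> (0 + s *\<^sub>R v)) = (*) (g \<bullet> v)" by (simp add: fun_eq_iff)
  with 2 show ?thesis unfolding has_field_derivative_def by simp
qed

lemma line_eventually_in_open:
  fixes q v :: "'a::euclidean_space"
  assumes "open V" "q \<in> V"
  shows "\<exists>e>0. \<forall>s::real. \<bar>s\<bar> < e \<longrightarrow> q + s *\<^sub>R v \<in> V"
proof -
  obtain e where e: "e > 0" "ball q e \<subseteq> V" using assms openE by blast
  have "q + s *\<^sub>R v \<in> V" if s: "\<bar>s\<bar> < e / (norm v + 1)" for s :: real
  proof -
    have n1: "norm v + 1 > 0" by (simp add: add_nonneg_pos)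
    have "\<bar>s\<bar> * norm v \<le> \<bar>s\<bar> * (norm v + 1)" by (simp add: mult_left_mono)
    also have "\<dots> < e" using s n1 by (simp add: pos_less_divide_eq)
    finally show ?thesis using e(2) by (auto simp: dist_norm subset_iff)
  qed
  then show ?thesis using e by (intro exI[of _ "e / (norm v + 1)"]) (auto simp: add_nonneg_pos)
qed

lemma inward_direction_enters:
  assumes df: "analytic_defining_function D q V \<rho> g" and q: "q \<in> frontier D" and v: "g \<bullet> v < 0"
  shows "\<exists>e>0. \<forall>s. 0 < s \<and> s < e \<longrightarrow> q + s *\<^sub>R v \<in> D \<inter> V"
proof -
  have V: "open V" "q \<in> V" "V \<inter> D = {x\<in>V. \<rho> x < 0}" "V \<inter> frontier D = {x\<in>V. \<rho> x = 0}"
    "(\<rho> has_derivative (\<lambda>v. g \<bullet> v)) (at q)"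
    using df by (simp_all add: analytic_defining_function_def)
  have "\<rho> q = 0" using V q by blast
  obtain d where d: "d > 0" "\<And>h. 0 < h \<Longrightarrow> h < d \<Longrightarrow> \<rho> (q + h *\<^sub>R v) < \<rho> q"
    using DERIV_neg_dec_right[OF has_derivative_along_line[OF V(5)] v] by auto
  obtain e where e: "e > 0" "\<And>s. \<bar>s\<bar> < e \<Longrightarrow> q + s *\<^sub>R v \<in> V"
    using line_eventually_in_open[OF V(1,2)] by blast
  have "q + s *\<^sub>R v \<in> D \<inter> V" if "0 < s" "s < min d e" for s
  proof -
    have "q + s *\<^sub>R v \<in> V" "\<rho> (q + s *\<^sub>R v) < 0" using that d(2)[of s] e(2)[of s] \<open>\<rho> q = 0\<close> by auto
    then show ?thesis using V(3) by blast
  qed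
  then show ?thesis using d e by (intro exI[of _ "min d e"]) auto
qed

text \<open>If the unit normals \<open>a\<close> and \<open>b\<close> were different, then \<open>b - a\<close> would point into the domain according to the first
  defining function and out of it according to the second.\<close>

lemma unit_normal_unique:
  assumes df: "analytic_defining_function D q V \<rho> g" and df': "analytic_defining_function D q V' \<rho>' g'"
    and q: "q \<in> frontier D"
  shows "sgn g = sgn g'"
proof (rule ccontr)
  assume ne: "sgn g \<noteq> sgn g'"
  have g0: "g \<noteq> 0" "g' \<noteq> 0" using df df' by (simp_all add: analytic_defining_function_def)
  define a b where "a = sgn g" and "b = sgn g'"
  have n1: "norm a = 1" "norm b = 1" using g0 by (simp_all add: a_def b_def norm_sgn)
  have aa: "a \<bullet> a = 1" "b \<bullet> b = 1" using n1 by (simp_all add: dot_square_norm)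
  have ab: "a \<bullet> b < 1"
  proof -
    have "a - b \<noteq> 0" using ne by (simp add: a_def b_def)
    then have "0 < (a - b) \<bullet> (a - b)" by simp
    then show ?thesis using aa by (simp add: inner_diff_left inner_diff_right inner_commute)
  qed
  define v where "v = b - a"
  have gv: "g = norm g *\<^sub>R a" "g' = norm g' *\<^sub>R b" using g0 by (simp_all add: a_def b_def sgn_div_norm)
  have v1: "g \<bullet> v < 0"
  proof -
    have "a \<bullet> v < 0" using ab aa by (simp add: v_def inner_diff_right)
    then show ?thesis using g0 gv(1) by (metis inner_scaleR_left mult_pos_neg zero_less_norm_iff)
  qed
  have v2: "g' \<bullet> v > 0"
  proof -
    have "b \<bullet> v > 0" using ab aa by (simp add: v_def inner_diff_right inner_commute)
    then show ?thesis using g0 gv(2) by (metis inner_scaleR_left mult_pos_pos zero_less_norm_iff)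
  qed
  obtain e where e: "e > 0" "\<And>s. 0 < s \<Longrightarrow> s < e \<Longrightarrow> q + s *\<^sub>R v \<in> D"
    using inward_direction_enters[OF df q v1] by blast
  have V: "open V'" "q \<in> V'" "V' \<inter> D = {x\<in>V'. \<rho>' x < 0}" "V' \<inter> frontier D = {x\<in>V'. \<rho>' x = 0}"
    "(\<rho>' has_derivative (\<lambda>v. g' \<bullet> v)) (at q)"
    using df' by (simp_all add: analytic_defining_function_def)
  have "\<rho>' q = 0" using V q by blast
  obtain d where d: "d > 0" "\<And>h. 0 < h \<Longrightarrow> h < d \<Longrightarrow> \<rho>' (q + h *\<^sub>R v) > \<rho>' q"
    using DERIV_pos_inc_right[OF has_derivative_along_line[OF V(5)] v2] by auto
  obtain e' where e': "e' > 0" "\<And>s. \<bar>s\<bar> < e' \<Longrightarrow> q + s *\<^sub>R v \<in> V'"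
    using line_eventually_in_open[OF V(1,2)] by blast
  define s where "s = min e (min d e') / 2"
  have s: "0 < s" "s < e" "s < d" "\<bar>s\<bar> < e'" using e d e' by (auto simp: s_def)
  have "q + s *\<^sub>R v \<in> V' \<inter> D" using e(2)[OF s(1,2)] e'(2)[OF s(4)] by blast
  then have "\<rho>' (q + s *\<^sub>R v) < 0" using V(3) by blast
  then show False using d(2)[OF s(1,3)] \<open>\<rho>' q = 0\<close> by simp
qed

text \<open>Near a boundary point the unit normal is the normalised gradient of one defining function, so
  it is Lipschitz there.\<close>

lemma unit_normal_field_Lipschitz:
  assumes \<nu>: "unit_normal_field D \<nu>" and x: "x \<in> frontier D"
  shows "\<exists>C. \<exists>e>0. \<forall>q\<in>frontier D. dist q x < e \<longrightarrow> norm (\<nu> q - \<nu> x) \<le> C * norm (q - x)"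
proof -
  obtain V \<rho> g where df: "analytic_defining_function D x V \<rho> g" and nx: "\<nu> x = sgn g"
    using \<nu> x unfolding unit_normal_field_def by blast
  have V: "open V" "x \<in> V" "real_analytic_on \<rho> V" "V \<inter> D = {x\<in>V. \<rho> x < 0}"
    "V \<inter> frontier D = {x\<in>V. \<rho> x = 0}" "(\<rho> has_derivative (\<lambda>v. g \<bullet> v)) (at x)" "g \<noteq> 0"
    using df by (simp_all add: analytic_defining_function_def)
  obtain r M \<phi> where r: "r > 0" and \<phi>: "curve_holomorphic \<phi> Basis (cx x) r M" and
    val: "\<And>y. (\<forall>b\<in>Basis. \<bar>(y - x) \<bullet> b\<bar> < r) \<Longrightarrow> y \<in> V \<Longrightarrow> \<phi> (cx y) = of_real (\<rho> y)"
    using real_analytic_complexification[OF V(3,2), of 1] by auto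
  obtain e0 where e0: "e0 > 0" "ball x e0 \<subseteq> V" using V openE by blast
  define e where "e = min e0 (r/4)"
  have e: "e > 0" "e \<le> e0" "e \<le> r/4" using e0 r by (auto simp: e_def)
  define G where "G = (\<lambda>q. \<Sum>b\<in>Basis. Re (dirderiv \<phi> (cx q) (cx b)) *\<^sub>R b)"
  have G: "(\<rho> has_derivative (\<lambda>v. G q \<bullet> v)) (at q)" if q: "dist q x < e" for q
  proof -
    have "cx q \<in> polydisc Basis (cx x) (r - r/2)"
      by (rule cx_in_polydisc) (use q e r in simp)
    then have \<phi>q: "curve_holomorphic \<phi> Basis (cx q) (r/2) M" by (rule curve_holomorphic_recentre[OF \<phi>])
    have hd: "((\<lambda>y. Re (\<phi> (cx y))) has_derivative (\<lambda>v. Re (dirderiv \<phi> (cx q) (cx v)))) (at q)"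
      by (rule bounded_linear.has_derivative[OF bounded_linear_Re curve_holomorphic_has_derivative[OF \<phi>q]])
         (use r in simp)
    have "Re (dirderiv \<phi> (cx q) (cx v)) = G q \<bullet> v" for v
    proof -
      have l: "linear (\<lambda>v. Re (dirderiv \<phi> (cx q) (cx v)))"
        using hd has_derivative_bounded_linear bounded_linear.linear by blast
      have "Re (dirderiv \<phi> (cx q) (cx (\<Sum>b\<in>Basis. (v \<bullet> b) *\<^sub>R b))) = (\<Sum>b\<in>Basis. (v \<bullet> b) * Re (dirderiv \<phi> (cx q) (cx b)))"
        unfolding linear_sum[OF l] linear_scale[OF l] by simp
      then show ?thesis
        by (simp add: G_def inner_sum_right inner_commute[of _ v] mult.commute euclidean_representation
            inner_commute[of "\<Sum>b\<in>Basis. _ b"])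
    qed
    with hd have hd': "((\<lambda>y. Re (\<phi> (cx y))) has_derivative (\<lambda>v. G q \<bullet> v)) (at q)" by simp
    show ?thesis
    proof (rule has_derivative_transform_within_open[OF hd'])
      show "open (ball x e)" "q \<in> ball x e" using q by (simp_all add: dist_commute)
      fix y assume y: "y \<in> ball x e"
      have "\<bar>(y - x) \<bullet> b\<bar> < r" if "b \<in> Basis" for b
        using Basis_le_norm[OF that, of "y - x"] y e r by (simp add: dist_norm norm_minus_commute)
      moreover have "y \<in> V" using y e(2) e0(2) by (auto simp: subset_iff)
      ultimately show "Re (\<phi> (cx y)) = \<rho> y" using val[of y] by simp
    qed
  qed
  have gx: "g = G x"
  proof -
    have "(\<lambda>v. g \<bullet> v) = (\<lambda>v. G x \<bullet> v)"
      by (rule has_derivative_unique[OF V(6) G]) (use e in simp)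
    then show ?thesis using vector_eq_ldot[of g "G x"] by (simp add: inner_commute) (metis inner_commute)
  qed
  define C1 where "C1 = real DIM('a) * (64 * M / r\<^sup>2)"
  have GL: "norm (G q - G x) \<le> C1 * norm (q - x)" if q: "dist q x < e" for q
  proof -
    have "norm (G q - G x) = norm (\<Sum>b\<in>(Basis::'a set). Re (dirderiv \<phi> (cx q) (cx b) - dirderiv \<phi> (cx x) (cx b)) *\<^sub>R b)"
      by (simp add: G_def sum_subtractf scaleR_left_diff_distrib)
    also have "\<dots> \<le> (\<Sum>b\<in>(Basis::'a set). 64 * M / r\<^sup>2 * norm (q - x))"
    proof (rule sum_norm_le)
      fix b :: 'a assume b: "b \<in> Basis"
      have "norm (dirderiv \<phi> (cx q) (cx b) - dirderiv \<phi> (cx x) (cx b)) \<le> 64 * M / r\<^sup>2 * norm (q - x)"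
      proof (rule dirderiv_Lipschitz[OF \<phi> r])
        show "cx q \<in> polydisc Basis (cx x) (r/4)" by (rule cx_in_polydisc) (use q e in simp)
        show "cx x \<in> polydisc Basis (cx x) (r/4)" by (rule cx_in_polydisc) (use r in simp)
        fix b' :: 'a assume b': "b' \<in> Basis"
        show "dist (cx q b') (cx x b') \<le> norm (q - x)"
          using Basis_le_norm[OF b', of "q - x"] by (simp add: cx_def dist_norm inner_diff_left flip: of_real_diff)
        show "norm (cx b b') \<le> 1" using b b' by (simp add: cx_def inner_Basis)
      qed simp
      moreover have "norm (Re z *\<^sub>R b) \<le> norm z" for z using b abs_Re_le_cmod[of z] by simp
      ultimately show "norm (Re (dirderiv \<phi> (cx q) (cx b) - dirderiv \<phi> (cx x) (cx b)) *\<^sub>R b) \<le> 64 * M / r\<^sup>2 * norm (q - x)"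
        using order_trans by blast
    qed
    also have "\<dots> = C1 * norm (q - x)" by (simp add: C1_def)
    finally show ?thesis .
  qed
  have C10: "C1 \<ge> 0" using curve_holomorphic_nonneg[OF \<phi> r] by (simp add: C1_def)
  define e1 where "e1 = min e (norm g / (C1 + 1))"
  have e1: "e1 > 0" "e1 \<le> e" using e C10 V(7) by (auto simp: e1_def add_nonneg_pos)
  have "norm (\<nu> q - \<nu> x) \<le> (2 * C1 / norm g) * norm (q - x)" if q: "q \<in> frontier D" "dist q x < e1" for q
  proof -
    have qe: "dist q x < e" using q e1 by simp
    have "norm (G q - g) < norm g"
    proof -
      have "norm (G q - g) \<le> C1 * norm (q - x)" using GL[OF qe] gx by simp
      also have "\<dots> \<le> C1 * (norm g / (C1 + 1))"
        using q C10 by (intro mult_left_mono) (auto simp: e1_def dist_norm)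
      also have "\<dots> < norm g" using C10 V(7) by (simp add: field_simps)
      finally show ?thesis .
    qed
    then have Gq: "G q \<noteq> 0" by auto
    have qV: "q \<in> V" using qe e e0 by (auto simp: dist_commute)
    have "analytic_defining_function D q V \<rho> (G q)"
      unfolding analytic_defining_function_def using V qV G[OF qe] Gq by simp
    moreover obtain V' \<rho>' g' where "analytic_defining_function D q V' \<rho>' g'" "\<nu> q = sgn g'"
      using \<nu> q(1) unfolding unit_normal_field_def by blast
    ultimately have "\<nu> q = sgn (G q)" using unit_normal_unique[OF _ _ q(1)] by metis
    then have "norm (\<nu> q - \<nu> x) \<le> 2 * norm (G q - g) / norm g"
      using norm_sgn_diff_le[OF Gq V(7)] nx by simp
    also have "\<dots> \<le> 2 * (C1 * norm (q - x)) / norm g"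
      using GL[OF qe] gx by (intro divide_right_mono mult_left_mono) auto
    finally show ?thesis by simp
  qed
  then show ?thesis using e1 by blast
qed

text \<open>The zero derivative of \<open>\<pi>\<close> and \<open>\<sigma>\<close> in a direction \<open>v\<close> would make the derivative of
  \<open>\<pi> + \<sigma> \<nu>(\<pi>) = id\<close> vanish on \<open>v\<close>; the normal field enters only through its Lipschitz constant.\<close>

lemma normal_coordinates_immersive:
  fixes \<nu> :: "'a::euclidean_space \<Rightarrow> 'a"
  assumes \<nu>: "unit_normal_field D \<nu>" and nc: "normal_coordinates D \<nu> W \<pi> \<sigma>" and p: "p \<in> W"
    and d\<pi>: "(\<pi> has_derivative \<pi>') (at p)" and d\<sigma>: "(\<sigma> has_derivative \<sigma>') (at p)"
    and v: "\<pi>' v = 0" "\<sigma>' v = 0"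
  shows "v = 0"
proof -
  have W: "open W" "\<And>y. y \<in> W \<Longrightarrow> \<pi> y \<in> frontier D" "\<And>y. y \<in> W \<Longrightarrow> \<pi> y + \<sigma> y *\<^sub>R \<nu> (\<pi> y) = y"
    using nc by (auto simp: normal_coordinates_def)
  obtain C e where e: "e > 0" "\<And>q. q \<in> frontier D \<Longrightarrow> dist q (\<pi> p) < e \<Longrightarrow> norm (\<nu> q - \<nu> (\<pi> p)) \<le> C * norm (q - \<pi> p)"
    using unit_normal_field_Lipschitz[OF \<nu> W(2)[OF p]] by blast
  define y where "y = (\<lambda>s::real. p + s *\<^sub>R v)"
  have y0: "y 0 = p" by (simp add: y_def)
  have dy: "(y has_derivative (\<lambda>s. s *\<^sub>R v)) (at 0)" unfolding y_def
    by (auto intro!: derivative_eq_intros)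
  have lin: "linear \<pi>'" "linear \<sigma>'"
    using has_derivative_bounded_linear[OF d\<pi>] has_derivative_bounded_linear[OF d\<sigma>] bounded_linear.linear by blast+
  have dpy: "((\<lambda>s. \<pi> (y s)) has_derivative (\<lambda>s. 0)) (at 0)"
    using has_derivative_compose[OF dy, of \<pi> \<pi>'] d\<pi> v lin by (simp add: y0 linear_scale)
  have dsy: "((\<lambda>s. \<sigma> (y s)) has_derivative (\<lambda>s. 0)) (at 0)"
    using has_derivative_compose[OF dy, of \<sigma> \<sigma>'] d\<sigma> v lin by (simp add: y0 linear_scale)
  obtain e2 where e2: "e2 > 0" "\<And>s. \<bar>s\<bar> < e2 \<Longrightarrow> y s \<in> W"
    using line_eventually_in_open[OF W(1) p] unfolding y_def by blast
  have "isCont (\<lambda>s. \<pi> (y s)) 0" using dpy has_derivative_continuous by blast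
  then obtain e3 where e3: "e3 > 0" "\<And>s. \<bar>s\<bar> < e3 \<Longrightarrow> dist (\<pi> (y s)) (\<pi> p) < e"
    unfolding continuous_at_eps_delta using e(1) by (metis y0 diff_zero dist_real_def)
  have dny: "((\<lambda>s. \<nu> (\<pi> (y s))) has_derivative (\<lambda>s. 0)) (at 0)"
  proof (rule has_derivativeI_sandwich[where e = "min e2 e3" and H = "\<lambda>s. C * (norm (\<pi> (y s) - \<pi> (y 0) - 0) / norm (s - 0))"])
    have "((\<lambda>s. norm (\<pi> (y s) - \<pi> (y 0) - 0) / norm (s - 0)) \<longlongrightarrow> 0) (at 0)"
      using dpy unfolding has_derivative_iff_norm by simp
    then show "((\<lambda>s. C * (norm (\<pi> (y s) - \<pi> (y 0) - 0) / norm (s - 0))) \<longlongrightarrow> 0) (at 0)"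
      by (rule tendsto_mult_right_zero)
    fix s :: real assume s: "s \<noteq> 0" "dist s 0 < min e2 e3"
    have "norm (\<nu> (\<pi> (y s)) - \<nu> (\<pi> (y 0))) \<le> C * norm (\<pi> (y s) - \<pi> (y 0))"
      using e(2)[OF W(2)[OF e2(2)[of s]] e3(2)[of s]] s by (simp add: y0)
    then show "norm (\<nu> (\<pi> (y s)) - \<nu> (\<pi> (y 0)) - 0) / norm (s - 0) \<le> C * (norm (\<pi> (y s) - \<pi> (y 0) - 0) / norm (s - 0))"
      by (simp add: divide_right_mono)
  qed (use e2 e3 in auto)
  have "((\<lambda>s. \<pi> (y s) + \<sigma> (y s) *\<^sub>R \<nu> (\<pi> (y s))) has_derivative (\<lambda>s. 0 + (\<sigma> (y 0) *\<^sub>R 0 + 0 *\<^sub>R \<nu> (\<pi> (y 0))))) (at 0)"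
    by (rule has_derivative_add[OF dpy has_derivative_scaleR[OF dsy dny]])
  then have "((\<lambda>s. \<pi> (y s) + \<sigma> (y s) *\<^sub>R \<nu> (\<pi> (y s))) has_derivative (\<lambda>s. 0)) (at 0)" by simp
  then have "(y has_derivative (\<lambda>s. 0)) (at 0)"
  proof (rule has_derivative_transform_within[where d = e2])
    fix s :: real assume "dist s 0 < e2"
    then show "\<pi> (y s) + \<sigma> (y s) *\<^sub>R \<nu> (\<pi> (y s)) = y s" using W(3) e2(2) by simp
  qed (use e2 in auto)
  then have "(\<lambda>s::real. s *\<^sub>R v) = (\<lambda>s. 0)" using has_derivative_unique[OF dy] by blast
  then show ?thesis by (metis scaleR_one)
qed

section \<open>Complexified equations of the moving boundary\<close>

text \<open>The variables \<open>z\<close>, \<open>w\<close>, their conjugates and \<open>t\<close> become five independent complex variables, in the order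
  \<open>z\<close>, conjugate of \<open>z\<close>, \<open>w\<close>, conjugate of \<open>w\<close>, \<open>t\<close>. The real points are the points \<open>pt5 z w t\<close>.\<close>

definition vec5 :: "complex \<Rightarrow> complex \<Rightarrow> complex \<Rightarrow> complex \<Rightarrow> complex \<Rightarrow> nat \<Rightarrow> complex" where
  "vec5 a b c d e = (\<lambda>i. if i = 0 then a else if i = 1 then b else if i = 2 then c
     else if i = 3 then d else if i = 4 then e else 0)"

definition pt5 :: "complex \<Rightarrow> complex \<Rightarrow> real \<Rightarrow> nat \<Rightarrow> complex" where
  "pt5 z w t = vec5 z (cnj z) w (cnj w) (of_real t)"

text \<open>The inner product of \<open>z\<close> with \<open>b\<close> is half the sum of \<open>cnj b * z\<close> and its conjugate; in this form it makes sense
  for independent \<open>z\<close> and conjugate of \<open>z\<close>.\<close>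

definition real_coords :: "(nat \<Rightarrow> complex) \<Rightarrow> (complex \<times> complex) \<times> real \<Rightarrow> complex" where
  "real_coords x b = (\<Sum>j<5. vec5 (cnj (fst (fst b)) / 2) (fst (fst b) / 2) (cnj (snd (fst b)) / 2)
     (snd (fst b) / 2) (of_real (snd b)) j * x j)"

lemma lessThan_5: "{..<5::nat} = {0, 1, 2, 3, 4}"
  by auto

lemma sum_lessThan_5: "(\<Sum>j<5. g j) = g 0 + g 1 + g 2 + g 3 + g (4::nat)" for g :: "nat \<Rightarrow> complex"
  by (simp add: lessThan_5 add.assoc)

lemma real_coords_pt5: "real_coords (pt5 z w t) = cx ((z, w), t)"
proof
  fix b
  show "real_coords (pt5 z w t) b = cx ((z, w), t) b"
    by (cases b, cases "fst b")
       (simp add: real_coords_def sum_lessThan_5 pt5_def vec5_def cx_def inner_complex_def complex_eq_iff field_simps)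
qed

lemma real_coords_pt5_0: "(\<lambda>b. real_coords (pt5 z w t) (b, 0)) = cx (z, w)"
  by (simp add: real_coords_pt5 cx_def fun_eq_iff)

lemma curve_holomorphic_real_coords:
  "r > 0 \<Longrightarrow> \<exists>N. curve_holomorphic (\<lambda>x. real_coords x b) {..<5} c r N"
  unfolding real_coords_def using curve_holomorphic_linear[of "{..<5}" "{..<5}" r] by blast

lemma curve_holomorphic_coordinate:
  assumes "finite B" "b \<in> B" "r > 0"
  shows "\<exists>N. curve_holomorphic (\<lambda>x. x b) B c r N"
  using curve_holomorphic_linear[of B "{b}" r "\<lambda>_. 1" c] assms by auto

lemma curve_holomorphic_cong_on:
  assumes "curve_holomorphic \<phi> B c r M" "r > 0" "x \<in> polydisc B c (r/2)" "y \<in> polydisc B c (r/2)"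
    "\<And>b. b \<in> B \<Longrightarrow> x b = y b"
  shows "\<phi> x = \<phi> y"
  using curve_holomorphic_Lipschitz[OF assms(1-4), of 0] assms(5) by simp

lemma pt5_in_polydisc:
  "dist z z0 < r \<Longrightarrow> dist w w0 < r \<Longrightarrow> \<bar>t - t0\<bar> < r \<Longrightarrow> pt5 z w t \<in> polydisc {..<5} (pt5 z0 w0 t0) r"
proof -
  have cd: "dist (cnj a) (cnj b) = dist a b" for a b
    by (simp add: dist_norm flip: complex_cnj_diff)
  assume "dist z z0 < r" "dist w w0 < r" "\<bar>t - t0\<bar> < r"
  then show ?thesis
    unfolding polydisc_def lessThan_5 by (simp add: pt5_def vec5_def cd) (simp add: dist_norm flip: of_real_diff)
qed

text \<open>The projection \<open>\<pi>\<close> takes values in a hypersurface, so its derivative has a kernel. On the kernel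
  the derivative of \<open>\<sigma>\<close> cannot vanish as well.\<close>

lemma normal_graph_gradient_nonzero:
  fixes \<nu> :: "'a::euclidean_space \<Rightarrow> 'a"
  assumes \<nu>: "unit_normal_field D \<nu>" and nc: "normal_coordinates D \<nu> W \<pi> \<sigma>" and p: "p \<in> W"
    and d\<pi>: "(\<pi> has_derivative \<pi>') (at p)" and d\<sigma>: "(\<sigma> has_derivative \<sigma>') (at p)"
    and H: "linear H"
  shows "\<exists>v. \<sigma>' v - H (\<pi>' v) \<noteq> (0::real)"
proof -
  have W: "open W" "\<And>y. y \<in> W \<Longrightarrow> \<pi> y \<in> frontier D"
    using nc by (auto simp: normal_coordinates_def)
  obtain V \<rho> g where df: "analytic_defining_function D (\<pi> p) V \<rho> g"
    using \<nu> W(2)[OF p] unfolding unit_normal_field_def by blast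
  have V: "open V" "\<pi> p \<in> V" "V \<inter> frontier D = {x\<in>V. \<rho> x = 0}"
    "(\<rho> has_derivative (\<lambda>v. g \<bullet> v)) (at (\<pi> p))" "g \<noteq> 0"
    using df by (simp_all add: analytic_defining_function_def)
  have lin: "linear \<pi>'" using has_derivative_bounded_linear[OF d\<pi>] bounded_linear.linear by blast
  have "g \<bullet> \<pi>' v = 0" for v
  proof -
    have cp: "isCont \<pi> p" using d\<pi> has_derivative_continuous by blast
    obtain T where T: "open T" "p \<in> T" "\<And>y. y \<in> T \<Longrightarrow> \<pi> y \<in> V"
      using cp[unfolded continuous_at_open, rule_format, OF conjI[OF V(1,2)]] by auto
    have "((\<lambda>y. \<rho> (\<pi> y)) has_derivative (\<lambda>v. g \<bullet> \<pi>' v)) (at p)"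
      by (rule has_derivative_compose[OF d\<pi> V(4)])
    then have "((\<lambda>y. 0) has_derivative (\<lambda>v. g \<bullet> \<pi>' v)) (at p)"
    proof (rule has_derivative_transform_within_open)
      show "open (T \<inter> W)" "p \<in> T \<inter> W" using T W(1) p by auto
      fix y assume "y \<in> T \<inter> W"
      then show "\<rho> (\<pi> y) = 0" using T(3) W(2) V(3) by blast
    qed
    from fun_cong[OF has_derivative_unique[OF this has_derivative_const]] show ?thesis .
  qed
  then have "\<not> surj \<pi>'" using V(5) by (metis inner_eq_zero_iff surj_def)
  then have "\<not> inj \<pi>'" using linear_injective_imp_surjective[OF lin] by blast
  then obtain v where v: "v \<noteq> 0" "\<pi>' v = 0" using linear_injective_0[OF lin] by blast
  have "\<sigma>' v \<noteq> 0" using normal_coordinates_immersive[OF \<nu> nc p d\<pi> d\<sigma> v(2)] v(1) by blast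
  then show ?thesis using v(2) linear_0[OF H] by (intro exI[of _ v]) simp
qed

lemma linear_vec5_conj: "linear (\<lambda>v. vec5 (fst v) (cnj (fst v)) (snd v) (cnj (snd v)) 0 b)"
  by (rule linearI) (simp_all add: vec5_def scaleR_conv_of_real)

lemma norm_vec5_conj_le: "norm (vec5 (fst v) (cnj (fst v)) (snd v) (cnj (snd v)) 0 b) \<le> norm v"
  using norm_fst_le[of "fst v" "snd v"] norm_snd_le[of "snd v" "fst v"] by (simp add: vec5_def)

lemma pt5_has_derivative:
  assumes \<phi>: "curve_holomorphic \<phi> {..<5} (pt5 z0 w0 t0) r M" and r: "r > 0"
  shows "((\<lambda>y. \<phi> (pt5 (fst y) (snd y) t0)) has_derivative
          (\<lambda>v. dirderiv \<phi> (pt5 z0 w0 t0) (vec5 (fst v) (cnj (fst v)) (snd v) (cnj (snd v)) 0))) (at (z0, w0))"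
proof -
  have "((\<lambda>y. \<phi> (\<lambda>b. pt5 z0 w0 t0 b + vec5 (fst (y - (z0, w0))) (cnj (fst (y - (z0, w0)))) (snd (y - (z0, w0)))
     (cnj (snd (y - (z0, w0)))) 0 b)) has_derivative
          (\<lambda>v. dirderiv \<phi> (pt5 z0 w0 t0) (vec5 (fst v) (cnj (fst v)) (snd v) (cnj (snd v)) 0))) (at (z0, w0))"
    by (rule curve_holomorphic_has_derivative_affine[OF \<phi> r finite_lessThan linear_vec5_conj norm_vec5_conj_le])
  moreover have "(\<lambda>b. pt5 z0 w0 t0 b + vec5 (fst (y - (z0, w0))) (cnj (fst (y - (z0, w0)))) (snd (y - (z0, w0)))
     (cnj (snd (y - (z0, w0)))) 0 b) = pt5 (fst y) (snd y) t0" for y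
    by (simp add: fun_eq_iff pt5_def vec5_def)
  ultimately show ?thesis by simp
qed

text \<open>Here \<open>\<rho>\<close> is the complexification of a real equation of the boundaries of all \<open>D t\<close> near \<open>(z0, w0, t0)\<close>, and \<open>g\<close> that of
  \<open>f\<close>. The last condition says that the real gradient of the equation in \<open>(z, w)\<close> does not vanish.\<close>

definition locally_complexified ::
    "real \<Rightarrow> (real \<Rightarrow> (complex \<times> complex) set) \<Rightarrow> (real \<Rightarrow> complex \<times> complex \<Rightarrow> complex) \<Rightarrow>
     complex \<Rightarrow> complex \<Rightarrow> real \<Rightarrow> bool" where
  "locally_complexified \<delta> D f z0 w0 t0 \<longleftrightarrow>
     (\<exists>r>0. \<exists>M N \<rho> g. curve_holomorphic \<rho> {..<5} (pt5 z0 w0 t0) r M \<and>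
        curve_holomorphic g {..<5} (pt5 z0 w0 t0) r N \<and>
        (\<forall>z w t. dist z z0 < r \<longrightarrow> dist w w0 < r \<longrightarrow> \<bar>t - t0\<bar> < r \<longrightarrow>
           \<bar>t\<bar> < \<delta> \<and> Im (\<rho> (pt5 z w t)) = 0 \<and> ((z, w) \<in> frontier (D t) \<longleftrightarrow> \<rho> (pt5 z w t) = 0) \<and>
           g (pt5 z w t) = f t (z, w)) \<and>
        (\<exists>v1 v2. Re (dirderiv \<rho> (pt5 z0 w0 t0) (vec5 v1 (cnj v1) v2 (cnj v2) 0)) \<noteq> 0))"

text \<open>In normal coordinates the boundary of \<open>D t\<close> is the graph of \<open>h\<close>, so \<open>\<sigma> - h(\<pi>, t)\<close> is an equation for it. Its
  complexification is composed of those of \<open>\<sigma>\<close>, \<open>h\<close> and the components of \<open>\<pi>\<close>.\<close>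

lemma variation_locally_complexified:
  assumes var: "real_analytic_variation \<delta> D" and crh: "real_analytic_CRH_variation \<delta> D f"
    and t0: "\<bar>t0\<bar> < \<delta>" and p: "(z0, w0) \<in> frontier (D t0)"
  shows "locally_complexified \<delta> D f z0 w0 t0"
proof -
  define I where "I = {-\<delta><..<\<delta>}"
  have t0I: "t0 \<in> I" using t0 by (auto simp: I_def)
  obtain \<nu> W \<pi> \<sigma> h where \<nu>: "unit_normal_field (D 0) \<nu>" and nc: "normal_coordinates (D 0) \<nu> W \<pi> \<sigma>"
    and han: "real_analytic_on (\<lambda>(x, t). h x t) (frontier (D 0) \<times> I)"
    and inW: "\<forall>t\<in>I. \<forall>x\<in>frontier (D 0). x + h x t *\<^sub>R \<nu> x \<in> W \<and>
           \<pi> (x + h x t *\<^sub>R \<nu> x) = x \<and> \<sigma> (x + h x t *\<^sub>R \<nu> x) = h x t"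
    and fr: "\<forall>t\<in>I. frontier (D t) = (\<lambda>x. x + h x t *\<^sub>R \<nu> x) ` frontier (D 0)"
    using var unfolding real_analytic_variation_def I_def by blast
  have W: "open W" "real_analytic_on \<pi> W" "real_analytic_on \<sigma> W"
    "\<And>y. y \<in> W \<Longrightarrow> \<pi> y \<in> frontier (D 0)" "\<And>y. y \<in> W \<Longrightarrow> \<pi> y + \<sigma> y *\<^sub>R \<nu> (\<pi> y) = y"
    using nc by (auto simp: normal_coordinates_def)
  have fr_iff: "y \<in> frontier (D t) \<longleftrightarrow> \<sigma> y - h (\<pi> y) t = 0" if y: "y \<in> W" and t: "t \<in> I" for y t
  proof
    assume "y \<in> frontier (D t)"
    then obtain x where "x \<in> frontier (D 0)" "y = x + h x t *\<^sub>R \<nu> x" using fr t by blast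
    then show "\<sigma> y - h (\<pi> y) t = 0" using inW t by simp
  next
    assume "\<sigma> y - h (\<pi> y) t = 0"
    then have "y = \<pi> y + h (\<pi> y) t *\<^sub>R \<nu> (\<pi> y)" using W(5)[OF y] by simp
    then show "y \<in> frontier (D t)" using fr t W(4)[OF y] by blast
  qed
  define p where "p = (z0, w0)"
  have pW: "p \<in> W" using p fr t0I inW by (auto simp: p_def)
  define x where "x = \<pi> p"
  have x: "x \<in> frontier (D 0)" using W(4)[OF pW] by (simp add: x_def)
  obtain U where U: "open U" "frontier (D t0) \<subseteq> U" and fan: "real_analytic_on (\<lambda>(p, t). f t p) (U \<times> I)"
    using crh t0I unfolding real_analytic_CRH_variation_def I_def by blast
  have pU: "p \<in> U" using U p by (auto simp: p_def)
  define c where "c = pt5 z0 w0 t0"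
  define X2 where "X2 = (\<lambda>y b. real_coords y (b, 0))"
  have X2c: "X2 (pt5 z w t) = cx (z, w)" for z w t unfolding X2_def by (rule real_coords_pt5_0)
  have X2hol: "\<exists>N. curve_holomorphic (\<lambda>y. X2 y b) {..<5} c 1 N" for b
    unfolding X2_def by (rule curve_holomorphic_real_coords) simp
  have box: "(\<forall>b\<in>Basis. \<bar>(q' - q) \<bullet> b\<bar> < r)" if "cx q' \<in> polydisc Basis (cx q) r" for q' q :: "'a::euclidean_space" and r
    using that by (auto simp: polydisc_def cx_def dist_norm inner_diff_left simp flip: of_real_diff)
  obtain r\<sigma> M\<sigma> \<phi>\<sigma> where r\<sigma>: "r\<sigma> > 0" and \<phi>\<sigma>: "curve_holomorphic \<phi>\<sigma> Basis (cx p) r\<sigma> M\<sigma>" and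
    v\<sigma>: "\<And>y. (\<forall>b\<in>Basis. \<bar>(y - p) \<bullet> b\<bar> < r\<sigma>) \<Longrightarrow> y \<in> W \<Longrightarrow> \<phi>\<sigma> (cx y) = of_real (\<sigma> y)"
    using real_analytic_complexification[OF W(3) pW, of 1] by auto
  obtain s\<sigma> where s\<sigma>: "s\<sigma> > 0" "curve_holomorphic (\<lambda>y. \<phi>\<sigma> (X2 y)) {..<5} c s\<sigma> M\<sigma>"
      "\<And>y. y \<in> polydisc {..<5} c s\<sigma> \<Longrightarrow> X2 y \<in> polydisc Basis (cx p) r\<sigma>"
    using curve_holomorphic_compose_shrink[where \<Psi> = X2 and d = c and J = "{..<5}", OF \<phi>\<sigma> finite_Basis zero_less_one r\<sigma> X2hol]
    by (auto simp: c_def X2c p_def)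
  have "\<exists>s>0. \<exists>N \<psi>. curve_holomorphic \<psi> {..<5} c s N \<and>
      (\<forall>z w t. pt5 z w t \<in> polydisc {..<5} c s \<longrightarrow> (z, w) \<in> W \<longrightarrow> \<psi> (pt5 z w t) = of_real (\<pi> (z, w) \<bullet> i))"
    if i: "i \<in> Basis" for i
  proof -
    obtain r M \<phi> where r: "r > 0" and \<phi>: "curve_holomorphic \<phi> Basis (cx p) r M" and
      v: "\<And>y. (\<forall>b\<in>Basis. \<bar>(y - p) \<bullet> b\<bar> < r) \<Longrightarrow> y \<in> W \<Longrightarrow> \<phi> (cx y) = of_real (\<pi> y \<bullet> i)"
      using real_analytic_complexification[OF W(2) pW i] by auto
    obtain s where s: "s > 0" "curve_holomorphic (\<lambda>y. \<phi> (X2 y)) {..<5} c s M"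
      "\<And>y. y \<in> polydisc {..<5} c s \<Longrightarrow> X2 y \<in> polydisc Basis (cx p) r"
      using curve_holomorphic_compose_shrink[where \<Psi> = X2 and d = c and J = "{..<5}", OF \<phi> finite_Basis zero_less_one r X2hol]
      by (auto simp: c_def X2c p_def)
    have "\<phi> (X2 (pt5 z w t)) = of_real (\<pi> (z, w) \<bullet> i)"
      if "pt5 z w t \<in> polydisc {..<5} c s" "(z, w) \<in> W" for z w t
      using v[OF box that(2)] s(3)[OF that(1)] by (simp add: X2c)
    then show ?thesis using s by blast
  qed
  then have "\<forall>i\<in>Basis. \<exists>s>0. \<exists>N \<psi>. curve_holomorphic \<psi> {..<5} c s N \<and>
      (\<forall>z w t. pt5 z w t \<in> polydisc {..<5} c s \<longrightarrow> (z, w) \<in> W \<longrightarrow> \<psi> (pt5 z w t) = of_real (\<pi> (z, w) \<bullet> i))" by blast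
  from bchoice[OF this] obtain s where "\<forall>i\<in>Basis. s i > 0 \<and> (\<exists>N \<psi>. curve_holomorphic \<psi> {..<5} c (s i) N \<and>
      (\<forall>z w t. pt5 z w t \<in> polydisc {..<5} c (s i) \<longrightarrow> (z, w) \<in> W \<longrightarrow> \<psi> (pt5 z w t) = of_real (\<pi> (z, w) \<bullet> i)))" ..
  note s = this
  define s\<pi> where "s\<pi> = Min (insert 1 (s ` Basis))"
  have s\<pi>: "s\<pi> > 0" "s\<pi> \<le> 1" "\<And>i. i \<in> Basis \<Longrightarrow> s\<pi> \<le> s i"
    using s by (simp_all add: s\<pi>_def min.coboundedI2)
  have "\<forall>i\<in>Basis. \<exists>\<psi>. (\<exists>N. curve_holomorphic \<psi> {..<5} c s\<pi> N) \<and>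
      (\<forall>z w t. pt5 z w t \<in> polydisc {..<5} c s\<pi> \<longrightarrow> (z, w) \<in> W \<longrightarrow> \<psi> (pt5 z w t) = of_real (\<pi> (z, w) \<bullet> i))"
  proof
    fix i :: "complex \<times> complex" assume i: "i \<in> Basis"
    obtain N \<psi> where "curve_holomorphic \<psi> {..<5} c (s i) N"
      "\<forall>z w t. pt5 z w t \<in> polydisc {..<5} c (s i) \<longrightarrow> (z, w) \<in> W \<longrightarrow> \<psi> (pt5 z w t) = of_real (\<pi> (z, w) \<bullet> i)"
      using s i by blast
    then show "\<exists>\<psi>. (\<exists>N. curve_holomorphic \<psi> {..<5} c s\<pi> N) \<and>
      (\<forall>z w t. pt5 z w t \<in> polydisc {..<5} c s\<pi> \<longrightarrow> (z, w) \<in> W \<longrightarrow> \<psi> (pt5 z w t) = of_real (\<pi> (z, w) \<bullet> i))"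
      using curve_holomorphic_mono[OF _ s\<pi>(3)[OF i] order_refl] polydisc_mono[OF s\<pi>(3)[OF i], of "{..<5}" c] by blast
  qed
  from bchoice[OF this] obtain \<psi> where \<psi>: "\<forall>i\<in>Basis. (\<exists>N. curve_holomorphic (\<psi> i) {..<5} c s\<pi> N) \<and>
      (\<forall>z w t. pt5 z w t \<in> polydisc {..<5} c s\<pi> \<longrightarrow> (z, w) \<in> W \<longrightarrow> \<psi> i (pt5 z w t) = of_real (\<pi> (z, w) \<bullet> i))" ..
  obtain rh Mh \<phi>h where rh: "rh > 0" and \<phi>h: "curve_holomorphic \<phi>h Basis (cx (x, t0)) rh Mh" and
    vh: "\<And>y t. (\<forall>b\<in>Basis. \<bar>((y, t) - (x, t0)) \<bullet> b\<bar> < rh) \<Longrightarrow> y \<in> frontier (D 0) \<Longrightarrow> t \<in> I \<Longrightarrow> \<phi>h (cx (y, t)) = of_real (h y t)"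
    using real_analytic_complexification[OF han, of "(x, t0)" 1] x t0I by auto
  define \<Psi> where "\<Psi> = (\<lambda>y b. if snd b = (0::real) then \<psi> (fst b) y else y 4)"
  have \<Psi>pt: "\<Psi> (pt5 z w t) b = cx (\<pi> (z, w), t) b"
    if "pt5 z w t \<in> polydisc {..<5} c s\<pi>" "(z, w) \<in> W" "b \<in> Basis" for z w t b
  proof -
    have "b \<in> (\<lambda>u. (u, 0)) ` Basis \<or> b = (0, 1)" using that(3) by (auto simp: Basis_prod_def)
    then show ?thesis
    proof
      assume "b = (0, 1)" then show ?thesis by (simp add: \<Psi>_def cx_def pt5_def vec5_def)
    next
      assume "b \<in> (\<lambda>u. (u, 0)) ` Basis"
      then show ?thesis using \<psi> that(1,2) by (auto simp: \<Psi>_def cx_def)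
    qed
  qed
  have cpt: "c = pt5 z0 w0 t0" "c \<in> polydisc {..<5} c s\<pi>" by (simp_all add: c_def polydisc_centre s\<pi>)
  have \<Psi>hol: "\<exists>N. curve_holomorphic (\<lambda>y. \<Psi> y b) {..<5} c s\<pi> N" if "b \<in> Basis" for b
  proof (cases "snd b = 0")
    case True
    then have "fst b \<in> Basis" using that by (auto simp: Basis_prod_def)
    then show ?thesis using \<psi> True by (simp add: \<Psi>_def)
  next
    case False
    then show ?thesis using curve_holomorphic_coordinate[of "{..<5}" 4 s\<pi> c] s\<pi>(1) by (simp add: \<Psi>_def)
  qed
  have \<Psi>c: "\<Psi> c b = cx (x, t0) b" if "b \<in> Basis" for b
    using \<Psi>pt[of z0 w0 t0 b] that cpt pW by (simp add: p_def x_def)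
  have rh2: "rh/2 > 0" using rh by simp
  obtain sh where sh: "sh > 0" "sh \<le> s\<pi>" "curve_holomorphic (\<lambda>y. \<phi>h (\<Psi> y)) {..<5} c sh Mh"
      "\<And>y. y \<in> polydisc {..<5} c sh \<Longrightarrow> \<Psi> y \<in> polydisc Basis (cx (x, t0)) (rh/2)"
    using curve_holomorphic_compose_shrink[where \<Psi> = \<Psi> and d = c and J = "{..<5}",
        OF curve_holomorphic_mono[OF \<phi>h _ order_refl, of "rh/2"] finite_Basis s\<pi>(1) rh2 \<Psi>hol \<Psi>c] rh by auto
  obtain rf Mf \<phi>f where rf: "rf > 0" and \<phi>f: "curve_holomorphic \<phi>f Basis (cx (p, t0)) rf Mf" and
    vf: "\<And>y t. (\<forall>b\<in>Basis. \<bar>((y, t) - (p, t0)) \<bullet> b\<bar> < rf) \<Longrightarrow> y \<in> U \<Longrightarrow> t \<in> I \<Longrightarrow> \<phi>f (cx (y, t)) = f t y"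
    using real_analytic_complexification_complex[OF fan, of "(p, t0)"] pU t0I by auto
  obtain sf where sf: "sf > 0" "curve_holomorphic (\<lambda>y. \<phi>f (real_coords y)) {..<5} c sf Mf"
      "\<And>y. y \<in> polydisc {..<5} c sf \<Longrightarrow> real_coords y \<in> polydisc Basis (cx (p, t0)) rf"
    using curve_holomorphic_compose_shrink[where \<Psi> = real_coords, OF \<phi>f finite_Basis zero_less_one rf curve_holomorphic_real_coords[OF zero_less_one], of c]
    by (auto simp: c_def real_coords_pt5 p_def)
  obtain e where e: "e > 0" "ball p e \<subseteq> W \<inter> U" using W(1) U(1) pW pU openE[of "W \<inter> U" p] by auto
  obtain e' where e': "e' > 0" "ball t0 e' \<subseteq> I" using t0I openE[of I t0] by (auto simp: I_def)
  define r where "r = min (min s\<sigma> sh) (min sf (min (e/2) e'))"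
  have r: "r > 0" "r \<le> s\<sigma>" "r \<le> sh" "r \<le> sf" "r \<le> e/2" "r \<le> e'"
    using s\<sigma> sh sf e e' by (auto simp: r_def)
  define \<rho> where "\<rho> = (\<lambda>y. \<phi>\<sigma> (X2 y) + (-1) * \<phi>h (\<Psi> y))"
  define g where "g = (\<lambda>y. \<phi>f (real_coords y))"
  have \<rho>hol: "curve_holomorphic \<rho> {..<5} c r (M\<sigma> + norm (-1::complex) * Mh)"
    unfolding \<rho>_def by (rule curve_holomorphic_mono[OF curve_holomorphic_add[OF s\<sigma>(2) sh(3)]]) (use r in auto)
  have ghol: "curve_holomorphic g {..<5} c r Mf"
    unfolding g_def by (rule curve_holomorphic_mono[OF sf(2)]) (use r in auto)
  have pts: "(z, w) \<in> W" "(z, w) \<in> U" "t \<in> I" "\<rho> (pt5 z w t) = of_real (\<sigma> (z, w) - h (\<pi> (z, w)) t)"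
     "g (pt5 z w t) = f t (z, w)" "\<phi>h (\<Psi> (pt5 z w t)) = of_real (h (\<pi> (z, w)) t)"
     "\<phi>h (cx (\<pi> (z, w), t)) = of_real (h (\<pi> (z, w)) t)"
    if zwt: "dist z z0 < r" "dist w w0 < r" "\<bar>t - t0\<bar> < r" for z w t
  proof -
    have "dist (z, w) p \<le> dist z z0 + dist w w0"
      unfolding p_def dist_prod_def by (simp add: sqrt_sum_squares_le_sum)
    also have "\<dots> < e" using zwt r by linarith
    finally show W1: "(z, w) \<in> W" and U1: "(z, w) \<in> U" using e(2) by (auto simp: dist_commute)
    show tI: "t \<in> I" using e'(2) zwt r by (auto simp: dist_real_def)
    have inP: "pt5 z w t \<in> polydisc {..<5} c r" unfolding c_def by (rule pt5_in_polydisc[OF zwt])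
    then have inPs: "pt5 z w t \<in> polydisc {..<5} c s\<sigma>" "pt5 z w t \<in> polydisc {..<5} c sh"
       "pt5 z w t \<in> polydisc {..<5} c sf" "pt5 z w t \<in> polydisc {..<5} c s\<pi>"
      using polydisc_mono r sh(2) by (meson subsetD order_trans)+
    have 1: "\<phi>\<sigma> (X2 (pt5 z w t)) = of_real (\<sigma> (z, w))"
      using v\<sigma>[OF box W1] s\<sigma>(3)[OF inPs(1)] by (simp add: X2c)
    have \<Psi>in: "\<Psi> (pt5 z w t) \<in> polydisc Basis (cx (x, t0)) (rh/2)" by (rule sh(4)[OF inPs(2)])
    have cxin: "cx (\<pi> (z, w), t) \<in> polydisc Basis (cx (x, t0)) (rh/2)"
      using \<Psi>in \<Psi>pt[OF inPs(4) W1] by (simp add: polydisc_def)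
    have 2: "\<phi>h (\<Psi> (pt5 z w t)) = \<phi>h (cx (\<pi> (z, w), t))"
      by (rule curve_holomorphic_cong_on[OF \<phi>h rh \<Psi>in cxin \<Psi>pt[OF inPs(4) W1]])
    have "cx (\<pi> (z, w), t) \<in> polydisc Basis (cx (x, t0)) rh"
      using cxin polydisc_mono[of "rh/2" rh Basis "cx (x, t0)"] rh by auto
    from vh[OF box[OF this] W(4)[OF W1] tI]
    show 3: "\<phi>h (cx (\<pi> (z, w), t)) = of_real (h (\<pi> (z, w)) t)" .
    with 2 show 4: "\<phi>h (\<Psi> (pt5 z w t)) = of_real (h (\<pi> (z, w)) t)" by simp
    show "\<rho> (pt5 z w t) = of_real (\<sigma> (z, w) - h (\<pi> (z, w)) t)" by (simp add: \<rho>_def 1 4)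
    have "cx ((z, w), t) \<in> polydisc Basis (cx (p, t0)) rf"
      using sf(3)[OF inPs(3)] by (simp add: real_coords_pt5)
    from vf[OF box[OF this] U1 tI] show "g (pt5 z w t) = f t (z, w)" by (simp add: g_def real_coords_pt5)
  qed
  obtain \<pi>' where d\<pi>: "(\<pi> has_derivative \<pi>') (at p)" using real_analytic_on_has_derivative[OF W(2,1) pW] by blast
  obtain \<sigma>' where d\<sigma>: "(\<sigma> has_derivative \<sigma>') (at p)" using real_analytic_on_has_derivative[OF W(3,1) pW] by blast
  define H where "H = (\<lambda>q. Re (\<phi>h (cx q)))"
  define H' where "H' = (\<lambda>v. Re (dirderiv \<phi>h (cx (x, t0)) (cx v)))"
  have dH: "(H has_derivative H') (at (\<pi> p, t0))" unfolding H_def H'_def x_def[symmetric]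
    by (rule bounded_linear.has_derivative[OF bounded_linear_Re curve_holomorphic_has_derivative[OF \<phi>h rh]])
  have "((\<lambda>y. (\<pi> y, t0)) has_derivative (\<lambda>v. (\<pi>' v, 0))) (at p)"
    by (rule has_derivative_Pair[OF d\<pi> has_derivative_const])
  from has_derivative_diff[OF d\<sigma> has_derivative_compose[OF this dH]]
  have d1: "((\<lambda>y. \<sigma> y - H (\<pi> y, t0)) has_derivative (\<lambda>v. \<sigma>' v - H' (\<pi>' v, 0))) (at p)" .
  have d2: "((\<lambda>y. Re (\<rho> (pt5 (fst y) (snd y) t0))) has_derivative
      (\<lambda>v. Re (dirderiv \<rho> c (vec5 (fst v) (cnj (fst v)) (snd v) (cnj (snd v)) 0)))) (at p)"
    unfolding p_def c_def
    by (rule bounded_linear.has_derivative[OF bounded_linear_Re pt5_has_derivative[OF \<rho>hol[unfolded c_def] r(1)]])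
  have "((\<lambda>y. \<sigma> y - H (\<pi> y, t0)) has_derivative
      (\<lambda>v. Re (dirderiv \<rho> c (vec5 (fst v) (cnj (fst v)) (snd v) (cnj (snd v)) 0)))) (at p)"
  proof (rule has_derivative_transform_within_open[OF d2])
    show "open (ball z0 r \<times> ball w0 r)" "p \<in> ball z0 r \<times> ball w0 r" using r by (auto simp: p_def open_Times)
    fix y assume "y \<in> ball z0 r \<times> ball w0 r"
    then have "dist (fst y) z0 < r" "dist (snd y) w0 < r" "\<bar>t0 - t0\<bar> < r" using r by (auto simp: dist_commute)
    note pts' = pts[OF this]
    show "Re (\<rho> (pt5 (fst y) (snd y) t0)) = \<sigma> y - H (\<pi> y, t0)"
      using pts'(4,7) by (simp add: H_def)
  qed
  then have eq: "Re (dirderiv \<rho> c (vec5 (fst v) (cnj (fst v)) (snd v) (cnj (snd v)) 0)) = \<sigma>' v - H' (\<pi>' v, 0)" for v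
    using fun_cong[OF has_derivative_unique[OF d1], of _ v] by simp
  have "linear H'" using has_derivative_bounded_linear[OF dH] bounded_linear.linear by blast
  then have "linear (\<lambda>u. H' (u, 0))"
    using linear_compose[of "\<lambda>u. (u, 0::real)" H'] by (auto simp: o_def linear_iff)
  then obtain v where "\<sigma>' v - H' (\<pi>' v, 0) \<noteq> 0"
    using normal_graph_gradient_nonzero[OF \<nu> nc pW d\<pi> d\<sigma>] by blast
  then have nd: "Re (dirderiv \<rho> c (vec5 (fst v) (cnj (fst v)) (snd v) (cnj (snd v)) 0)) \<noteq> 0" by (simp add: eq)
  have all: "\<bar>t\<bar> < \<delta> \<and> Im (\<rho> (pt5 z w t)) = 0 \<and> ((z, w) \<in> frontier (D t) \<longleftrightarrow> \<rho> (pt5 z w t) = 0) \<and>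
           g (pt5 z w t) = f t (z, w)" if zwt: "dist z z0 < r" "dist w w0 < r" "\<bar>t - t0\<bar> < r" for z w t
    using pts[OF zwt] fr_iff[OF pts(1,3)[OF zwt]] by (auto simp: I_def simp del: of_real_diff)
  show ?thesis unfolding locally_complexified_def
    using r(1) \<rho>hol ghol all nd unfolding c_def by blast
qed

section \<open>Families of convex domains and their slices\<close>

text \<open>Otherwise a hyperplane separates \<open>q\<close> from \<open>B\<close>. The ray from \<open>q\<close> in the normal direction leaves \<open>A\<close> at distance at
  least \<open>e\<close> behind the hyperplane, so at a boundary point with distance at least \<open>e\<close> from \<open>B\<close>.\<close>

lemma convex_inside_of_close_frontier:
  fixes A B :: "'a::euclidean_space set"
  assumes A: "bounded A" and B: "convex B" "B \<noteq> {}" and e: "e > 0"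
    and near: "\<And>y. y \<in> frontier A \<Longrightarrow> \<exists>y'\<in>frontier B. dist y y' < e" and q: "ball q e \<subseteq> A"
  shows "q \<in> closure B"
proof (rule ccontr)
  assume nq: "q \<notin> closure B"
  obtain m c where m: "m \<noteq> 0" "\<forall>x\<in>closure B. m \<bullet> x \<le> c" "\<forall>x\<in>{q}. m \<bullet> x \<ge> c"
    using separating_hyperplane_sets[of "closure B" "{q}"] B nq by (auto simp: convex_closure)
  define l where "l = sgn m"
  have l: "norm l = 1" "l \<noteq> 0" using m by (simp_all add: l_def norm_sgn sgn_zero_iff)
  have half: "l \<bullet> x \<le> l \<bullet> q" if "x \<in> closure B" for x
  proof -
    have "m \<bullet> x \<le> m \<bullet> q" using m that by force
    then show ?thesis unfolding l_def sgn_div_norm by (simp add: mult_left_mono)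
  qed
  have "q \<in> interior A" using q e by (meson centre_in_ball interior_maximal open_ball subsetD)
  then obtain d where d: "d > 0" "q + d *\<^sub>R l \<in> frontier A"
    using ray_to_frontier[OF A _ l(2)] by metis
  have "e \<le> d"
  proof (rule ccontr)
    assume "\<not> e \<le> d"
    then have "q + d *\<^sub>R l \<in> ball q e" using d l by (simp add: dist_norm)
    then have "q + d *\<^sub>R l \<in> interior A" using q by (meson interior_maximal open_ball subsetD)
    then show False using d(2) by (simp add: frontier_def)
  qed
  obtain y' where y': "y' \<in> frontier B" "dist (q + d *\<^sub>R l) y' < e" using near[OF d(2)] by blast
  have "l \<bullet> (q + d *\<^sub>R l - y') \<le> norm l * norm (q + d *\<^sub>R l - y')" by (rule norm_cauchy_schwarz)
  also have "\<dots> < e" using y' l by (simp add: dist_norm)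
  finally have "l \<bullet> q + d - l \<bullet> y' < e"
    using l by (simp add: inner_diff_right inner_add_right dot_square_norm)
  moreover have "l \<bullet> y' \<le> l \<bullet> q" using half y' by (simp add: frontier_def)
  ultimately show False using \<open>e \<le> d\<close> by linarith
qed

text \<open>The assumptions are symmetric under exchange of the two coordinates, so everything proved about the
  slices \<open>z = const\<close> holds for the slices \<open>w = const\<close> as well.\<close>

locale hartogs_family =
  fixes \<delta> :: real and D :: "real \<Rightarrow> (complex \<times> complex) set"
    and f :: "real \<Rightarrow> complex \<times> complex \<Rightarrow> complex"
  assumes domain: "\<And>t. \<bar>t\<bar> < \<delta> \<Longrightarrow> bounded (D t) \<and> open (D t) \<and> convex (D t) \<and> D t \<noteq> {}"
    and complexified: "\<And>t z w. \<bar>t\<bar> < \<delta> \<Longrightarrow> (z, w) \<in> frontier (D t) \<Longrightarrow> locally_complexified \<delta> D f z w t"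
    and frontier_near: "\<And>t e. \<bar>t\<bar> < \<delta> \<Longrightarrow> e > 0 \<Longrightarrow> \<exists>\<eta>>0. \<forall>t'. \<bar>t' - t\<bar> < \<eta> \<longrightarrow> \<bar>t'\<bar> < \<delta> \<and>
           (\<forall>y\<in>frontier (D t'). \<exists>y'\<in>frontier (D t). dist y y' < e) \<and>
           (\<forall>y\<in>frontier (D t). \<exists>y'\<in>frontier (D t'). dist y y' < e)"
    and CRH: "\<And>t. \<bar>t\<bar> < \<delta> \<Longrightarrow> CRH_function (D t) (f t)"
begin

lemma domain_props:
  assumes "\<bar>t\<bar> < \<delta>"
  shows "bounded (D t)" "open (D t)" "convex (D t)" "D t \<noteq> {}"
  using domain[OF assms] by blast+

lemma inside_open:
  assumes t: "\<bar>t\<bar> < \<delta>" and q: "q \<in> D t"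
  shows "\<exists>\<eta>>0. \<forall>q' t'. dist q' q < \<eta> \<longrightarrow> \<bar>t' - t\<bar> < \<eta> \<longrightarrow> \<bar>t'\<bar> < \<delta> \<and> q' \<in> D t'"
proof -
  obtain e0 where e0: "e0 > 0" "ball q e0 \<subseteq> D t" using domain_props(2)[OF t] q openE by blast
  define e where "e = e0 / 2"
  have e: "e > 0" using e0 by (simp add: e_def)
  obtain \<eta> where \<eta>: "\<eta> > 0" "\<And>t'. \<bar>t' - t\<bar> < \<eta> \<Longrightarrow> \<bar>t'\<bar> < \<delta>"
     "\<And>t' y. \<bar>t' - t\<bar> < \<eta> \<Longrightarrow> y \<in> frontier (D t) \<Longrightarrow> \<exists>y'\<in>frontier (D t'). dist y y' < e"
    using frontier_near[OF t e] by blast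
  have "q' \<in> D t'" if "dist q' q < e" "\<bar>t' - t\<bar> < \<eta>" for q' t'
  proof -
    have t': "\<bar>t'\<bar> < \<delta>" by (rule \<eta>(2)[OF that(2)])
    have "y \<in> closure (D t')" if y: "y \<in> ball q e" for y
    proof (rule convex_inside_of_close_frontier[OF domain_props(1)[OF t] domain_props(3,4)[OF t'] e \<eta>(3)[OF \<open>\<bar>t' - t\<bar> < \<eta>\<close>]])
      show "ball y e \<subseteq> D t"
      proof
        fix x assume "x \<in> ball y e"
        then have "x \<in> ball q e0" using y dist_triangle[of q x y] by (simp add: e_def)
        then show "x \<in> D t" using e0 by blast
      qed
    qed
    then have "ball q e \<subseteq> interior (closure (D t'))" by (intro interior_maximal) auto
    also have "\<dots> = D t'" using convex_interior_closure[OF domain_props(3)[OF t']] domain_props(2)[OF t'] by (simp add: interior_open)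
    finally show ?thesis using that(1) by (auto simp: dist_commute)
  qed
  then show ?thesis using \<eta> e by (intro exI[of _ "min e \<eta>"]) auto
qed

lemma outside_open:
  assumes t: "\<bar>t\<bar> < \<delta>" and q: "q \<notin> closure (D t)"
  shows "\<exists>\<eta>>0. \<forall>q' t'. dist q' q < \<eta> \<longrightarrow> \<bar>t' - t\<bar> < \<eta> \<longrightarrow> q' \<notin> closure (D t')"
proof -
  obtain e0 where e0: "e0 > 0" "ball q e0 \<subseteq> - closure (D t)"
    using q openE[of "- closure (D t)" q] by auto
  define e where "e = e0 / 3"
  have e: "e > 0" using e0 by (simp add: e_def)
  obtain \<eta> where \<eta>: "\<eta> > 0" "\<And>t'. \<bar>t' - t\<bar> < \<eta> \<Longrightarrow> \<bar>t'\<bar> < \<delta>"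
     "\<And>t' y. \<bar>t' - t\<bar> < \<eta> \<Longrightarrow> y \<in> frontier (D t') \<Longrightarrow> \<exists>y'\<in>frontier (D t). dist y y' < e"
    using frontier_near[OF t e] by blast
  have "q' \<notin> closure (D t')" if "dist q' q < e" "\<bar>t' - t\<bar> < \<eta>" for q' t'
  proof
    assume q': "q' \<in> closure (D t')"
    have t': "\<bar>t'\<bar> < \<delta>" by (rule \<eta>(2)[OF that(2)])
    have "y \<notin> frontier (D t')" if y: "y \<in> ball q (2 * e)" for y
    proof
      assume "y \<in> frontier (D t')"
      then obtain y' where "y' \<in> frontier (D t)" "dist y y' < e" using \<eta>(3)[OF \<open>\<bar>t' - t\<bar> < \<eta>\<close>] by blast
      moreover from this have "y' \<in> ball q e0" using y dist_triangle[of q y' y] by (simp add: e_def)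
      ultimately show False using e0 by (auto simp: frontier_def)
    qed
    then have nofr: "ball q (2 * e) \<inter> frontier (D t') = {}" by blast
    have "q' \<in> ball q (2 * e)" using that(1) e by (simp add: dist_commute)
    then have "ball q (2 * e) \<inter> D t' \<noteq> {}"
      using q' open_Int_closure_eq_empty[of "ball q (2 * e)" "D t'"] by blast
    then have "ball q (2 * e) \<subseteq> D t'"
      using connected_Int_frontier[of "ball q (2 * e)" "D t'"] nofr by blast
    then have "ball q e \<subseteq> D t'" using e by (auto simp: subset_iff)
    then have "q \<in> closure (D t)"
      using convex_inside_of_close_frontier[OF domain_props(1)[OF t'] domain_props(3,4)[OF t] e \<eta>(3)[OF that(2)]] by blast
    then show False using q by blast
  qed
  then show ?thesis using \<eta> e by (intro exI[of _ "min e \<eta>"]) auto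
qed

definition slice :: "complex \<Rightarrow> real \<Rightarrow> complex set" where
  "slice z t = {w. (z, w) \<in> D t}"

lemma slice_open: "\<bar>t\<bar> < \<delta> \<Longrightarrow> open (slice z t)"
proof -
  assume t: "\<bar>t\<bar> < \<delta>"
  have "open (Pair z -` D t)" by (intro open_vimage domain_props t continuous_intros)
  then show ?thesis by (simp add: slice_def vimage_def)
qed

lemma slice_convex:
  assumes t: "\<bar>t\<bar> < \<delta>"
  shows "convex (slice z t)"
proof (rule convexI)
  fix x y and u v :: real
  assume xy: "x \<in> slice z t" "y \<in> slice z t" and uv: "0 \<le> u" "0 \<le> v" "u + v = 1"
  have "u *\<^sub>R (z, x) + v *\<^sub>R (z, y) \<in> D t"
    by (rule convexD[OF domain_props(3)[OF t]]) (use xy uv in \<open>auto simp: slice_def\<close>)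
  moreover have "u *\<^sub>R (z, x) + v *\<^sub>R (z, y) = (z, u *\<^sub>R x + v *\<^sub>R y)"
    using scaleR_add_left[of u v z] uv(3) by simp
  ultimately show "u *\<^sub>R x + v *\<^sub>R y \<in> slice z t" by (simp add: slice_def)
qed

lemma slice_bounded: "\<bar>t\<bar> < \<delta> \<Longrightarrow> bounded (slice z t)"
proof -
  assume t: "\<bar>t\<bar> < \<delta>"
  obtain B where B: "\<And>y. y \<in> D t \<Longrightarrow> norm y \<le> B" using domain_props(1)[OF t] bounded_iff by blast
  show ?thesis
  proof (rule boundedI[of _ B])
    fix w assume "w \<in> slice z t"
    then show "norm w \<le> B" using B[of "(z, w)"] norm_snd_le[of w z] by (simp add: slice_def)
  qed
qed

text \<open>A point of the closure of the domain on a nonempty slice is joined to a point of the slice by a segment whose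
  other points lie in the domain.\<close>

lemma slice_closure:
  assumes t: "\<bar>t\<bar> < \<delta>" and ne: "slice z t \<noteq> {}"
  shows "closure (slice z t) = {w. (z, w) \<in> closure (D t)}"
proof
  have "closed (Pair z -` closure (D t))" by (intro closed_vimage continuous_intros closed_closure)
  then show "closure (slice z t) \<subseteq> {w. (z, w) \<in> closure (D t)}"
    using closure_subset[of "D t"] by (intro closure_minimal) (auto simp: slice_def vimage_def)
  show "{w. (z, w) \<in> closure (D t)} \<subseteq> closure (slice z t)"
  proof
    fix w assume "w \<in> {w. (z, w) \<in> closure (D t)}"
    then have w: "(z, w) \<in> closure (D t)" by simp
    obtain a where a: "(z, a) \<in> D t" using ne by (auto simp: slice_def)
    have seg: "w - s *\<^sub>R (w - a) \<in> slice z t" if s: "0 < s" "s \<le> 1" for s :: real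
    proof -
      have "(z, w) - s *\<^sub>R ((z, w) - (z, a)) \<in> interior (D t)"
        by (rule mem_interior_closure_convex_shrink[OF domain_props(3)[OF t] _ w s])
           (use a domain_props(2)[OF t] in \<open>simp add: interior_open\<close>)
      then show ?thesis using domain_props(2)[OF t] by (simp add: slice_def interior_open)
    qed
    show "w \<in> closure (slice z t)" unfolding closure_sequential
    proof (intro exI conjI allI)
      fix n show "w - inverse (real (Suc n)) *\<^sub>R (w - a) \<in> slice z t"
        by (rule seg) (auto simp: field_simps)
    next
      have "(\<lambda>n. w - inverse (real (Suc n)) *\<^sub>R (w - a)) \<longlonglongrightarrow> w - 0 *\<^sub>R (w - a)"
        by (intro tendsto_intros LIMSEQ_inverse_real_of_nat)
      then show "(\<lambda>n. w - inverse (real (Suc n)) *\<^sub>R (w - a)) \<longlonglongrightarrow> w" by simp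
    qed
  qed
qed

lemma slice_frontier:
  assumes t: "\<bar>t\<bar> < \<delta>" and ne: "slice z t \<noteq> {}"
  shows "frontier (slice z t) = {w. (z, w) \<in> frontier (D t)}"
  using slice_closure[OF t ne] slice_open[OF t, of z] domain_props(2)[OF t]
  by (auto simp: frontier_def interior_open slice_def)

text \<open>The extension of \<open>f t\<close> in the slice with constant \<open>z\<close>, meaningful if that slice is nonempty.\<close>

definition ext :: "complex \<Rightarrow> complex \<Rightarrow> real \<Rightarrow> complex" where
  "ext z w t = (SOME g. continuous_on {w. (z, w) \<in> closure (D t)} g \<and> g holomorphic_on {w. (z, w) \<in> D t} \<and>
             (\<forall>w. (z, w) \<in> frontier (D t) \<longrightarrow> g w = f t (z, w))) w"

lemma ext_props:
  assumes t: "\<bar>t\<bar> < \<delta>" and ne: "slice z t \<noteq> {}"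
  shows "continuous_on (closure (slice z t)) (\<lambda>w. ext z w t)"
    and "(\<lambda>w. ext z w t) holomorphic_on slice z t"
    and "\<And>w. w \<in> frontier (slice z t) \<Longrightarrow> ext z w t = f t (z, w)"
    and "\<And>w. (z, w) \<in> frontier (D t) \<Longrightarrow> ext z w t = f t (z, w)"
proof -
  let ?P = "\<lambda>g. continuous_on {w. (z, w) \<in> closure (D t)} g \<and> g holomorphic_on {w. (z, w) \<in> D t} \<and>
             (\<forall>w. (z, w) \<in> frontier (D t) \<longrightarrow> g w = f t (z, w))"
  have "\<exists>g. ?P g"
    using CRH[OF t] ne unfolding CRH_function_def slice_def by blast
  from someI_ex[OF this] have P: "?P (\<lambda>w. ext z w t)"
    unfolding ext_def[abs_def] by simp
  show "continuous_on (closure (slice z t)) (\<lambda>w. ext z w t)" using P slice_closure[OF t ne] by simp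
  show "(\<lambda>w. ext z w t) holomorphic_on slice z t" using P by (simp add: slice_def)
  show "\<And>w. (z, w) \<in> frontier (D t) \<Longrightarrow> ext z w t = f t (z, w)" using P by blast
  then show "\<And>w. w \<in> frontier (slice z t) \<Longrightarrow> ext z w t = f t (z, w)"
    using slice_frontier[OF t ne] by simp
qed

end

section \<open>The implicit function theorem\<close>

text \<open>The implicit function is the fixed point of \<open>d \<mapsto> d - \<phi>(x, d) / A\<close>. Its iterates are compositions
  of functions holomorphic along curves, and they converge uniformly.\<close>

lemma holomorphic_implicit_function:
  fixes J :: "'i set"
  assumes \<phi>: "curve_holomorphic \<phi> (insert j J) c r M" and r: "r > 0" and fin: "finite J" and j: "j \<notin> J"
    and c0: "\<phi> c = 0" and nz: "dirderiv \<phi> c (\<lambda>b. if b = j then 1 else 0) \<noteq> 0"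
  shows "\<exists>s>0. \<exists>S. s \<le> r \<and> curve_holomorphic S J c s (norm (c j) + r) \<and>
           (\<forall>x\<in>polydisc J c s. dist (S x) (c j) < r \<and>
              (\<forall>d. dist d (c j) < s \<longrightarrow> \<phi> (x(j := d)) = 0 \<longrightarrow> d = S x))"
proof -
  define E where "E = (\<lambda>b::'i. if b = j then 1 else (0::complex))"
  define A where "A = dirderiv \<phi> c E"
  have A: "norm A > 0" using nz by (simp add: A_def E_def)
  have M: "M \<ge> 0" by (rule curve_holomorphic_nonneg[OF \<phi> r])
  define K where "K = 64 * M / r\<^sup>2 + 1"
  \<comment> \<open>for points within \<open>\<eta>\<close> of \<open>c\<close> the derivative in direction \<open>j\<close> differs from \<open>A\<close> by at most half of \<open>norm A\<close>\<close>
  define \<eta> where "\<eta> = min (r/8) (norm A / 2 / K)"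
  have K0: "K > 0" using M r by (simp add: K_def add_nonneg_pos)
  have \<eta>0: "\<eta> > 0" using r A K0 by (simp add: \<eta>_def)
  have \<eta>r: "\<eta> \<le> r/8" unfolding \<eta>_def by (rule min.cobounded1)
  have \<eta>K: "64 * M / r\<^sup>2 * \<eta> \<le> norm A / 2"
  proof -
    have "64 * M / r\<^sup>2 * \<eta> \<le> K * \<eta>" using \<eta>0 by (intro mult_right_mono) (auto simp: K_def)
    also have "\<dots> \<le> K * (norm A / 2 / K)"
      using K0 by (intro mult_left_mono) (auto simp: \<eta>_def)
    also have "\<dots> = norm A / 2" using K0 by simp
    finally show ?thesis .
  qed
  define L where "L = 8 * M / r + 1"
  \<comment> \<open>for parameters within \<open>s\<close> of \<open>c\<close> the first step of the iteration has length at most \<open>\<eta> / 4\<close>\<close>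
  define s where "s = min \<eta> (\<eta> / 4 * norm A / L)"
  have L0: "L > 0" using M r by (simp add: L_def add_nonneg_pos)
  have s0: "s > 0" using \<eta>0 A L0 by (simp add: s_def)
  have s\<eta>: "s \<le> \<eta>" by (simp add: s_def)
  have sL: "8 * M / r * s \<le> \<eta> / 4 * norm A"
  proof -
    have "8 * M / r * s \<le> L * s" using s0 by (intro mult_right_mono) (auto simp: L_def)
    also have "\<dots> \<le> L * (\<eta> / 4 * norm A / L)"
      using L0 by (intro mult_left_mono) (auto simp: s_def)
    also have "\<dots> = \<eta> / 4 * norm A" using L0 by simp
    finally show ?thesis .
  qed
  define T where "T = (\<lambda>x d. d - \<phi> (x(j := d)) / A)"
  have inP: "x(j := d) \<in> polydisc (insert j J) c (2 * \<eta>)" if "x \<in> polydisc J c s" "dist d (c j) \<le> \<eta>" for x d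
    unfolding polydisc_def
  proof (intro CollectI ballI)
    fix b assume b: "b \<in> insert j J"
    show "dist ((x(j := d)) b) (c b) < 2 * \<eta>"
    proof (cases "b = j")
      case True then show ?thesis using that(2) \<eta>0 by simp
    next
      case False
      then have "dist (x b) (c b) < s" using that(1) b by (simp add: polydisc_def)
      then show ?thesis using False s\<eta> \<eta>0 by simp
    qed
  qed
  have inP4: "x(j := d) \<in> polydisc (insert j J) c (r/4)" if "x \<in> polydisc J c s" "dist d (c j) \<le> \<eta>" for x d
    using inP[OF that] polydisc_mono[of "2 * \<eta>" "r/4" "insert j J" c] \<eta>r by auto
  have Lip: "dist (T x d) (T x d') \<le> 1/2 * dist d d'"
    if x: "x \<in> polydisc J c s" and d: "d \<in> cball (c j) \<eta>" and d': "d' \<in> cball (c j) \<eta>" for x d d'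
  proof -
    have "norm (T x d - T x d') \<le> 1/2 * norm (d - d')"
    proof (rule field_differentiable_bound[where S = "cball (c j) \<eta>" and f' = "\<lambda>d. 1 - dirderiv \<phi> (x(j := d)) E / A"])
      fix d assume "d \<in> cball (c j) \<eta>"
      then have dd: "dist d (c j) \<le> \<eta>" by (simp add: dist_commute)
      have eqf: "(\<lambda>b. (x(j := 0)) b + u * E b) = x(j := u)" for u by (auto simp: E_def fun_eq_iff)
      have "((\<lambda>u. \<phi> (\<lambda>b. (x(j := 0)) b + u * E b)) has_field_derivative dirderiv \<phi> (\<lambda>b. (x(j := 0)) b + d * E b) E) (at d)"
        by (rule dirderiv_has_field_derivative[OF \<phi> _ _, of _ _ _ "r/4"]) (use fin r inP4[OF x dd] eqf in auto)
      then have "((\<lambda>u. \<phi> (x(j := u))) has_field_derivative dirderiv \<phi> (x(j := d)) E) (at d)"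
        unfolding eqf .
      then have "((\<lambda>d. T x d) has_field_derivative 1 - dirderiv \<phi> (x(j := d)) E / A) (at d)"
        unfolding T_def by (intro DERIV_diff DERIV_ident DERIV_cdivide)
      then show "(T x has_field_derivative 1 - dirderiv \<phi> (x(j := d)) E / A) (at d within cball (c j) \<eta>)"
        by (rule has_field_derivative_at_within)
      have "norm (dirderiv \<phi> (x(j := d)) E - dirderiv \<phi> c E) \<le> 64 * M / r\<^sup>2 * \<eta>"
      proof (rule dirderiv_Lipschitz[OF \<phi> r inP4[OF x dd]])
        show "c \<in> polydisc (insert j J) c (r/4)" using r by (intro polydisc_centre) simp
        show "dist ((x(j := d)) b) (c b) \<le> \<eta>" if "b \<in> insert j J" for b
          using that dd x s\<eta> by (auto simp: polydisc_def intro: less_imp_le order.strict_trans2)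
      qed (use \<eta>0 in \<open>auto simp: E_def\<close>)
      then have "norm (A - dirderiv \<phi> (x(j := d)) E) \<le> norm A / 2"
        using \<eta>K by (simp add: A_def norm_minus_commute)
      moreover have "1 - dirderiv \<phi> (x(j := d)) E / A = (A - dirderiv \<phi> (x(j := d)) E) / A"
        using A by (simp add: diff_divide_distrib)
      ultimately show "norm (1 - dirderiv \<phi> (x(j := d)) E / A) \<le> 1/2"
        using A by (simp add: norm_divide divide_le_eq)
    qed (use d d' in auto)
    then show ?thesis by (simp add: dist_norm)
  qed
  have cj: "c j \<in> cball (c j) \<eta>" using \<eta>0 by simp
  have Tc: "dist (T x (c j)) (c j) \<le> \<eta> / 4" if x: "x \<in> polydisc J c s" for x
  proof -
    have "norm (\<phi> (x(j := c j)) - \<phi> c) \<le> 8 * M / r * s"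
    proof (rule curve_holomorphic_Lipschitz[OF \<phi> r])
      show "x(j := c j) \<in> polydisc (insert j J) c (r/2)"
        using inP4[OF x, of "c j"] polydisc_mono[of "r/4" "r/2" "insert j J" c] \<eta>0 r by auto
      show "c \<in> polydisc (insert j J) c (r/2)" using r by (intro polydisc_centre) simp
      show "dist ((x(j := c j)) b) (c b) \<le> s" if "b \<in> insert j J" for b
        using that x s0 by (auto simp: polydisc_def intro: less_imp_le)
    qed (use s0 in simp)
    then have "norm (\<phi> (x(j := c j))) \<le> \<eta> / 4 * norm A" using sL c0 by simp
    then show ?thesis using A by (simp add: T_def dist_norm norm_divide divide_le_eq)
  qed
  have maps: "T x d \<in> cball (c j) (\<eta>/2)" if x: "x \<in> polydisc J c s" and d: "d \<in> cball (c j) (\<eta>/2)" for x d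
  proof -
    have "d \<in> cball (c j) \<eta>" using d \<eta>0 by simp
    then have "dist (T x d) (c j) \<le> 1/2 * dist d (c j) + \<eta> / 4"
      using Lip[OF x _ cj, of d] Tc[OF x] dist_triangle[of "T x d" "c j" "T x (c j)"] by linarith
    then show ?thesis using d by (simp add: dist_commute)
  qed
  have sub: "cball (c j) (\<eta>/2) \<subseteq> cball (c j) \<eta>" using \<eta>0 by auto
  have "\<exists>d. d \<in> cball (c j) (\<eta>/2) \<and> T x d = d" if x: "x \<in> polydisc J c s" for x
  proof -
    have "\<exists>!d. d \<in> cball (c j) (\<eta>/2) \<and> T x d = d"
    proof (rule Banach_fix[where c = "1/2"])
      show "T x ` cball (c j) (\<eta>/2) \<subseteq> cball (c j) (\<eta>/2)" using maps[OF x] by blast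
      show "dist (T x d) (T x d') \<le> 1/2 * dist d d'"
        if "d \<in> cball (c j) (\<eta>/2)" "d' \<in> cball (c j) (\<eta>/2)" for d d'
        using Lip[OF x] that sub by blast
    qed (use \<eta>0 in \<open>auto simp: complete_eq_closed\<close>)
    then show ?thesis by blast
  qed
  then have "\<forall>x\<in>polydisc J c s. \<exists>d. d \<in> cball (c j) (\<eta>/2) \<and> T x d = d" by blast
  from bchoice[OF this] obtain S where S: "\<forall>x\<in>polydisc J c s. S x \<in> cball (c j) (\<eta>/2) \<and> T x (S x) = S x" ..
  define R where "R = (\<lambda>n x. (T x ^^ n) (c j))"
  have R0: "R 0 x = c j" and RS: "R (Suc n) x = T x (R n x)" for n x by (simp_all add: R_def)
  have Rin: "R n x \<in> cball (c j) (\<eta>/2)" if "x \<in> polydisc J c s" for n x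
  proof (induction n)
    case 0 show ?case using \<eta>0 by (simp add: R0)
  next
    case (Suc n) then show ?case unfolding RS by (rule maps[OF that])
  qed
  have Rdist: "dist (R n x) (S x) \<le> (1/2)^n * \<eta>" if x: "x \<in> polydisc J c s" for n x
  proof (induction n)
    case 0
    show ?case using S x \<eta>0 by (auto simp: R0)
  next
    case (Suc n)
    have "dist (R (Suc n) x) (S x) = dist (T x (R n x)) (T x (S x))" using S x by (simp add: RS)
    also have "\<dots> \<le> 1/2 * dist (R n x) (S x)" using Lip[OF x] Rin[OF x, of n] S x sub by blast
    also have "\<dots> \<le> 1/2 * ((1/2)^n * \<eta>)" using Suc.IH by simp
    finally show ?case by simp
  qed
  have "curve_holomorphic S J c s (norm (c j) + r)"
    unfolding curve_holomorphic_def
  proof (intro conjI ballI allI impI)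
    fix x assume x: "x \<in> polydisc J c s"
    then have "dist (S x) (c j) \<le> \<eta>/2" using S by (simp add: dist_commute)
    then show "norm (S x) \<le> norm (c j) + r"
      using norm_triangle_sub[of "S x" "c j"] \<eta>r \<eta>0 by (simp add: dist_norm)
  next
    fix U \<gamma> assume U: "open U" "\<forall>b\<in>J. (\<lambda>u. \<gamma> u b) holomorphic_on U" "\<gamma> ` U \<subseteq> polydisc J c s"
    have Rhol: "(\<lambda>u. R n (\<gamma> u)) holomorphic_on U" for n
    proof (induction n)
      case 0 show ?case by (simp add: R0)
    next
      case (Suc n)
      have "(\<lambda>u. \<phi> ((\<gamma> u)(j := R n (\<gamma> u)))) holomorphic_on U"
      proof (rule curve_holomorphic_along[OF \<phi> U(1)])
        fix b assume b: "b \<in> insert j J"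
        show "(\<lambda>u. ((\<gamma> u)(j := R n (\<gamma> u))) b) holomorphic_on U"
          using b U(2) Suc.IH by (cases "b = j") auto
      next
        fix u assume "u \<in> U"
        then have u: "\<gamma> u \<in> polydisc J c s" using U by blast
        have "dist (R n (\<gamma> u)) (c j) \<le> \<eta>" using Rin[OF u, of n] \<eta>0 by (simp add: dist_commute)
        from inP4[OF u this] show "(\<gamma> u)(j := R n (\<gamma> u)) \<in> polydisc (insert j J) c r"
          using polydisc_mono[of "r/4" r "insert j J" c] r by auto
      qed
      then show ?case unfolding RS T_def using A by (intro holomorphic_intros Suc.IH) auto
    qed
    have ul: "uniform_limit U (\<lambda>n u. R n (\<gamma> u)) (\<lambda>u. S (\<gamma> u)) sequentially"
    proof (rule uniform_limitI)
      fix e :: real assume e: "e > 0"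
      have "(\<lambda>n. (1/2::real)^n * \<eta>) \<longlonglongrightarrow> 0"
        by (rule tendsto_mult_left_zero[OF LIMSEQ_power_zero]) simp
      then have "\<forall>\<^sub>F n in sequentially. (1/2::real)^n * \<eta> < e" using e by (rule order_tendstoD)
      then show "\<forall>\<^sub>F n in sequentially. \<forall>u\<in>U. dist (R n (\<gamma> u)) (S (\<gamma> u)) < e"
      proof (rule eventually_mono)
        fix n assume n: "(1/2::real)^n * \<eta> < e"
        show "\<forall>u\<in>U. dist (R n (\<gamma> u)) (S (\<gamma> u)) < e"
        proof
          fix u assume "u \<in> U"
          then have "\<gamma> u \<in> polydisc J c s" using U by blast
          from Rdist[OF this, of n] n show "dist (R n (\<gamma> u)) (S (\<gamma> u)) < e" by linarith
        qed
      qed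
    qed
    show "(\<lambda>u. S (\<gamma> u)) holomorphic_on U"
    proof (rule holomorphic_uniform_sequence[OF U(1) Rhol])
      fix x assume "x \<in> U"
      then obtain d where "d > 0" "cball x d \<subseteq> U" using U(1) open_contains_cball by blast
      then show "\<exists>d>0. cball x d \<subseteq> U \<and> uniform_limit (cball x d) (\<lambda>n u. R n (\<gamma> u)) (\<lambda>u. S (\<gamma> u)) sequentially"
        using uniform_limit_on_subset[OF ul] by blast
    qed
  qed
  moreover have "dist (S x) (c j) < r \<and> (\<forall>d. dist d (c j) < s \<longrightarrow> \<phi> (x(j := d)) = 0 \<longrightarrow> d = S x)"
    if x: "x \<in> polydisc J c s" for x
  proof (intro conjI allI impI)
    have Sx: "S x \<in> cball (c j) (\<eta>/2)" using S x by blast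
    then show "dist (S x) (c j) < r" using \<eta>r r \<eta>0 by (simp add: dist_commute)
    fix d assume d: "dist d (c j) < s" "\<phi> (x(j := d)) = 0"
    have "T x (S x) = S x" using S x by blast
    moreover have "T x d = d" using d by (simp add: T_def)
    ultimately have "dist d (S x) = dist (T x d) (T x (S x))" by simp
    also have "\<dots> \<le> 1/2 * dist d (S x)"
      by (rule Lip[OF x]) (use d s\<eta> Sx sub in \<open>auto simp: dist_commute\<close>)
    finally show "d = S x" by simp
  qed
  moreover have "s \<le> r" using s\<eta> \<eta>r r by linarith
  ultimately show ?thesis using s0 by blast
qed

lemma curve_holomorphic_lipschitz_on:
  fixes m :: "'x::metric_space \<Rightarrow> 'i \<Rightarrow> complex"
  assumes \<phi>: "curve_holomorphic \<phi> B c r M" and r: "r > 0"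
    and m: "\<And>x. x \<in> X \<Longrightarrow> m x \<in> polydisc B c (r/2)"
    and dm: "\<And>x y b. x \<in> X \<Longrightarrow> y \<in> X \<Longrightarrow> b \<in> B \<Longrightarrow> dist (m x b) (m y b) \<le> dist x y"
  shows "continuous_on X (\<lambda>x. \<phi> (m x))"
proof -
  have "(8 * M / r)-lipschitz_on X (\<lambda>x. \<phi> (m x))"
  proof (rule lipschitz_onI)
    fix x y assume xy: "x \<in> X" "y \<in> X"
    show "dist (\<phi> (m x)) (\<phi> (m y)) \<le> 8 * M / r * dist x y"
      using curve_holomorphic_Lipschitz[OF \<phi> r m[OF xy(1)] m[OF xy(2)] dm[OF xy]] by (simp add: dist_norm)
  qed (use curve_holomorphic_nonneg[OF \<phi> r] r in simp)
  then show ?thesis by (rule lipschitz_on_continuous_on)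
qed

lemma dist_pt5_le:
  "dist (pt5 (fst (fst y)) (snd (fst y)) (snd y) b) (pt5 (fst (fst y')) (snd (fst y')) (snd y') b) \<le> dist y y'"
proof -
  have cd: "dist (cnj a) (cnj b) = dist a b" for a b
    by (simp add: dist_norm flip: complex_cnj_diff)
  have 1: "dist (fst (fst y)) (fst (fst y')) \<le> dist y y'" "dist (snd (fst y)) (snd (fst y')) \<le> dist y y'"
    using dist_fst_le[of "fst y" "fst y'"] dist_snd_le[of "fst y" "fst y'"] dist_fst_le[of y y'] by linarith+
  have 2: "dist (complex_of_real (snd y)) (of_real (snd y')) \<le> dist y y'"
    using dist_snd_le[of y y'] by (simp add: dist_norm flip: of_real_diff)
  show ?thesis using 1 2 by (simp add: pt5_def vec5_def cd)
qed

lemma pt5_continuous_on: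
  assumes \<phi>: "curve_holomorphic \<phi> B (pt5 z0 w0 t0) r M" and r: "r > 0" and B: "B \<subseteq> {..<5}"
  shows "continuous_on ((ball z0 (r/2) \<times> ball w0 (r/2)) \<times> ball t0 (r/2))
           (\<lambda>y. \<phi> (pt5 (fst (fst y)) (snd (fst y)) (snd y)))"
proof (rule curve_holomorphic_lipschitz_on[OF \<phi> r])
  fix y assume "y \<in> (ball z0 (r/2) \<times> ball w0 (r/2)) \<times> ball t0 (r/2)"
  then have "pt5 (fst (fst y)) (snd (fst y)) (snd y) \<in> polydisc {..<5} (pt5 z0 w0 t0) (r/2)"
    by (intro pt5_in_polydisc) (auto simp: dist_commute dist_real_def)
  then show "pt5 (fst (fst y)) (snd (fst y)) (snd y) \<in> polydisc B (pt5 z0 w0 t0) (r/2)"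
    using B by (auto simp: polydisc_def)
qed (rule dist_pt5_le)

section \<open>Extension across the boundary by the Schwarz function\<close>

context hartogs_family
begin

text \<open>Near \<open>p\<close> the function \<open>R\<close> has constant sign on the convex domain, so \<open>\<kappa> L\<close> is nonpositive on the cone of
  inward directions, and negative because the cone is open. Conversely, if \<open>\<kappa> L v < 0\<close>, then a short segment
  joining a point in direction \<open>v\<close> to a point in an inward direction misses the zero set of \<open>R\<close>.\<close>

lemma boundary_derivative:
  assumes t: "\<bar>t\<bar> < \<delta>" and p: "p \<in> frontier (D t)"
    and R: "continuous_on V R" "open V" "convex V" "p \<in> V"
    and zero: "\<And>y. y \<in> V \<Longrightarrow> y \<in> frontier (D t) \<longleftrightarrow> R y = (0::real)"
    and dR: "(R has_derivative L) (at p)" and L: "L v \<noteq> 0"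
  shows "\<exists>\<kappa>. \<bar>\<kappa>\<bar> = 1 \<and> (\<forall>a\<in>D t. \<kappa> * L (a - p) < 0) \<and>
          (\<forall>v. \<kappa> * L v < 0 \<longrightarrow> (\<exists>s>0. p + s *\<^sub>R v \<in> D t))"
proof -
  have dt: "bounded (D t)" "open (D t)" "convex (D t)" "D t \<noteq> {}" using domain_props[OF t] by auto
  have lin: "linear L" using has_derivative_bounded_linear[OF dR] bounded_linear.linear by blast
  have pc: "p \<in> closure (D t)" using p by (simp add: frontier_def)
  have "connected (R ` (D t \<inter> V))"
    by (intro connected_continuous_image convex_connected convex_Int dt R continuous_on_subset[OF R(1)]) auto
  moreover have "0 \<notin> R ` (D t \<inter> V)"
  proof
    assume "0 \<in> R ` (D t \<inter> V)"
    then obtain y where "y \<in> D t" "y \<in> V" "R y = 0" by auto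
    then show False using zero[of y] dt(2) by (simp add: frontier_def interior_open)
  qed
  ultimately have "(\<forall>y\<in>D t \<inter> V. R y < 0) \<or> (\<forall>y\<in>D t \<inter> V. R y > 0)"
  proof -
    assume conn: "connected (R ` (D t \<inter> V))" and n0: "0 \<notin> R ` (D t \<inter> V)"
    have "R x < 0" if x: "x \<in> D t \<inter> V" and y: "y \<in> D t \<inter> V" "\<not> R y > 0" for x y
    proof (rule ccontr)
      assume "\<not> R x < 0"
      then have "0 \<in> R ` (D t \<inter> V)"
        using connectedD_interval[OF conn imageI[OF y(1)] imageI[OF x], of 0] y(2) by simp
      then show False using n0 by blast
    qed
    then show ?thesis by blast
  qed
  then obtain \<kappa> :: real where \<kappa>: "\<bar>\<kappa>\<bar> = 1" "\<And>y. y \<in> D t \<Longrightarrow> y \<in> V \<Longrightarrow> \<kappa> * R y < 0"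
  proof
    assume "\<forall>y\<in>D t \<inter> V. R y < 0" then show ?thesis by (intro that[of 1]) auto
  next
    assume "\<forall>y\<in>D t \<inter> V. R y > 0" then show ?thesis by (intro that[of "-1"]) auto
  qed
  have Rp: "R p = 0" using zero[OF R(4)] p by simp
  have small: "\<exists>e>0. \<forall>u. norm u < e \<longrightarrow> p + u \<in> V \<and> \<bar>R (p + u) - L u\<bar> \<le> \<epsilon> * norm u" if eps: "\<epsilon> > 0" for \<epsilon>
  proof -
    obtain d1 where d1: "d1 > 0" "ball p d1 \<subseteq> V" using R(2,4) openE by blast
    obtain d2 where d2: "d2 > 0" "\<And>y. norm (y - p) < d2 \<Longrightarrow> norm (R y - R p - L (y - p)) \<le> \<epsilon> * norm (y - p)"
      using dR eps unfolding has_derivative_at_alt by blast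
    have "p + u \<in> V \<and> \<bar>R (p + u) - L u\<bar> \<le> \<epsilon> * norm u" if "norm u < min d1 d2" for u
    proof
      have "p + u \<in> ball p d1" using that by (simp add: dist_norm)
      then show "p + u \<in> V" using d1 by blast
      show "\<bar>R (p + u) - L u\<bar> \<le> \<epsilon> * norm u" using d2(2)[of "p + u"] that Rp by simp
    qed
    then show ?thesis using d1 d2 by (intro exI[of _ "min d1 d2"]) auto
  qed
  have seg: "p + s *\<^sub>R (a - p) \<in> D t" if a: "a \<in> D t" and s: "0 < s" "s \<le> 1" for a s
  proof -
    have "p - s *\<^sub>R (p - a) \<in> interior (D t)"
      by (rule mem_interior_closure_convex_shrink[OF dt(3) _ pc s]) (use a dt(2) in \<open>simp add: interior_open\<close>)
    moreover have "p - s *\<^sub>R (p - a) = p + s *\<^sub>R (a - p)" by (simp add: algebra_simps)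
    ultimately show ?thesis using dt(2) by (simp add: interior_open)
  qed
  have le: "\<kappa> * L (a - p) \<le> 0" if a: "a \<in> D t" for a
  proof (rule ccontr)
    assume "\<not> \<kappa> * L (a - p) \<le> 0"
    then have pos: "\<kappa> * L (a - p) > 0" by simp
    then have n0: "norm (a - p) > 0" using linear_0[OF lin] by auto
    define \<epsilon> where "\<epsilon> = \<kappa> * L (a - p) / (2 * norm (a - p))"
    have "\<epsilon> > 0" using pos n0 by (simp add: \<epsilon>_def)
    from small[OF this] obtain e where e: "e > 0"
      "\<And>u. norm u < e \<Longrightarrow> p + u \<in> V \<and> \<bar>R (p + u) - L u\<bar> \<le> \<epsilon> * norm u" by blast
    define s where "s = min 1 (e / (2 * norm (a - p)))"
    have s: "0 < s" "s \<le> 1" using e n0 by (auto simp: s_def)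
    have "s * norm (a - p) \<le> e / (2 * norm (a - p)) * norm (a - p)"
      unfolding s_def by (rule mult_right_mono[OF min.cobounded2]) simp
    also have "\<dots> < e" using n0 e by simp
    finally have sn: "norm (s *\<^sub>R (a - p)) < e" using s by simp
    have "\<bar>R (p + s *\<^sub>R (a - p)) - s * L (a - p)\<bar> \<le> \<epsilon> * (s * norm (a - p))"
      using e(2)[OF sn] s linear_scale[OF lin] by simp
    also have "\<dots> = s * (\<kappa> * L (a - p)) / 2" using n0 by (simp add: \<epsilon>_def)
    finally have "\<bar>\<kappa> * (R (p + s *\<^sub>R (a - p)) - s * L (a - p))\<bar> \<le> s * (\<kappa> * L (a - p)) / 2"
      using \<kappa>(1) by (simp only: abs_mult mult_1)
    moreover have "\<kappa> * (R (p + s *\<^sub>R (a - p)) - s * L (a - p)) = \<kappa> * R (p + s *\<^sub>R (a - p)) - s * (\<kappa> * L (a - p))"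
      by (simp add: algebra_simps)
    moreover have "s * (\<kappa> * L (a - p)) > 0" using s pos by simp
    moreover have "\<kappa> * R (p + s *\<^sub>R (a - p)) < 0"
      using \<kappa>(2)[OF seg[OF a s]] e(2)[OF sn] by blast
    ultimately show False by linarith
  qed
  have lt: "\<kappa> * L (a - p) < 0" if a: "a \<in> D t" for a
  proof (rule ccontr)
    assume "\<not> \<kappa> * L (a - p) < 0"
    then have 0: "\<kappa> * L (a - p) = 0" using le[OF a] by simp
    obtain e where e: "e > 0" "\<And>s. \<bar>s\<bar> < e \<Longrightarrow> a + s *\<^sub>R (L v * \<kappa>) *\<^sub>R v \<in> D t"
      using line_eventually_in_open[OF dt(2) a] by blast
    have "a + (e/2) *\<^sub>R (L v * \<kappa>) *\<^sub>R v \<in> D t" by (rule e(2)) (use e(1) in simp)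
    from le[OF this] have "\<kappa> * L ((a - p) + (e/2 * (L v * \<kappa>)) *\<^sub>R v) \<le> 0" by (simp add: algebra_simps)
    then have "\<kappa> * (e/2 * (L v * \<kappa>) * L v) \<le> 0"
      using 0 by (simp add: linear_add[OF lin] linear_scale[OF lin] distrib_left)
    then have "\<kappa>\<^sup>2 * (L v)\<^sup>2 * e \<le> 0" by (simp add: power2_eq_square mult_ac)
    moreover have "\<kappa>\<^sup>2 = 1" using \<kappa>(1) by (metis power2_abs power_one)
    ultimately show False using e L by (simp add: mult_le_0_iff)
  qed
  have ex: "\<exists>s>0. p + s *\<^sub>R v \<in> D t" if v: "\<kappa> * L v < 0" for v
  proof -
    obtain a where a: "a \<in> D t" using dt(4) by blast
    define K where "K = norm v + norm (a - p)"
    have K: "K > 0" using v linear_0[OF lin] by (auto simp: K_def intro!: add_pos_nonneg)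
    define m where "m = min (- (\<kappa> * L v)) (- (\<kappa> * L (a - p)))"
    have m: "m > 0" using v lt[OF a] by (simp add: m_def)
    define \<epsilon> where "\<epsilon> = m / (2 * K)"
    have "\<epsilon> > 0" using m K by (simp add: \<epsilon>_def)
    from small[OF this] obtain e where e: "e > 0"
      "\<And>u. norm u < e \<Longrightarrow> p + u \<in> V \<and> \<bar>R (p + u) - L u\<bar> \<le> \<epsilon> * norm u" by blast
    define s where "s = min 1 (e / (2 * K))"
    have s: "0 < s" "s \<le> 1" using e K by (auto simp: s_def)
    have sK: "s * K < e"
    proof -
      have "s * K \<le> e / (2 * K) * K" unfolding s_def by (rule mult_right_mono[OF min.cobounded2]) (use K in simp)
      also have "\<dots> < e" using K e by simp
      finally show ?thesis .
    qed
    define T where "T = closed_segment (p + s *\<^sub>R v) (p + s *\<^sub>R (a - p))"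
    have "T \<inter> frontier (D t) = {}"
    proof (rule ccontr)
      assume "T \<inter> frontier (D t) \<noteq> {}"
      then obtain y where y: "y \<in> T" "y \<in> frontier (D t)" by blast
      then obtain u where u: "0 \<le> u" "u \<le> 1" "y = (1 - u) *\<^sub>R (p + s *\<^sub>R v) + u *\<^sub>R (p + s *\<^sub>R (a - p))"
        unfolding T_def in_segment by blast
      define x where "x = (1 - u) *\<^sub>R v + u *\<^sub>R (a - p)"
      have yx: "y = p + s *\<^sub>R x" using u(3) by (simp add: x_def algebra_simps)
      have nx: "norm x \<le> K"
      proof -
        have "norm x \<le> (1 - u) * norm v + u * norm (a - p)"
          unfolding x_def using norm_triangle_ineq[of "(1 - u) *\<^sub>R v" "u *\<^sub>R (a - p)"] u by simp
        also have "\<dots> \<le> 1 * norm v + 1 * norm (a - p)" using u by (intro add_mono mult_right_mono) auto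
        finally show ?thesis by (simp add: K_def)
      qed
      have Lx: "\<kappa> * L x \<le> - m"
      proof -
        have "\<kappa> * L x = (1 - u) * (\<kappa> * L v) + u * (\<kappa> * L (a - p))"
          unfolding x_def linear_add[OF lin] linear_scale[OF lin] by (simp add: distrib_left mult.left_commute)
        also have "\<dots> \<le> (1 - u) * (- m) + u * (- m)"
          using u by (intro add_mono mult_left_mono) (auto simp: m_def)
        finally show ?thesis by (simp add: algebra_simps)
      qed
      have sx: "norm (s *\<^sub>R x) \<le> s * K" using nx s by simp
      then have "norm (s *\<^sub>R x) < e" using sK by linarith
      note ee = e(2)[OF this]
      have "\<bar>\<kappa> * (R y - s * L x)\<bar> \<le> \<epsilon> * (s * K)"
      proof -
        have "\<bar>R y - s * L x\<bar> \<le> \<epsilon> * norm (s *\<^sub>R x)" using ee linear_scale[OF lin] by (simp add: yx)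
        also have "\<dots> \<le> \<epsilon> * (s * K)" using sx \<open>\<epsilon> > 0\<close> by (intro mult_left_mono) auto
        finally show ?thesis using \<kappa>(1) by (simp only: abs_mult mult_1)
      qed
      moreover have "\<epsilon> * (s * K) = s * m / 2" using K by (simp add: \<epsilon>_def)
      moreover have "\<kappa> * (R y - s * L x) = \<kappa> * R y - s * (\<kappa> * L x)" by (simp add: algebra_simps)
      moreover have "s * (\<kappa> * L x) \<le> s * (- m)" using Lx s by (intro mult_left_mono) auto
      moreover have "s * m > 0" using s m by simp
      moreover have "\<kappa> * R y = 0" using zero[of y] y(2) ee by (simp add: yx)
      ultimately show False by linarith
    qed
    moreover have "p + s *\<^sub>R (a - p) \<in> T \<inter> D t" using seg[OF a s] by (simp add: T_def)
    moreover have "connected T" by (simp add: T_def)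
    ultimately have "T \<subseteq> D t" using connected_Int_frontier[of T "D t"] by blast
    then show ?thesis using s by (auto simp: T_def)
  qed
  show ?thesis using \<kappa>(1) lt ex by blast
qed

lemma defining_function_derivative:
  assumes t: "\<bar>t0\<bar> < \<delta>" and p: "(z0, w0) \<in> frontier (D t0)" and r: "r > 0"
    and \<rho>: "curve_holomorphic \<rho> {..<5} (pt5 z0 w0 t0) r M"
    and pts: "\<And>z w t. dist z z0 < r \<Longrightarrow> dist w w0 < r \<Longrightarrow> \<bar>t - t0\<bar> < r \<Longrightarrow>
           Im (\<rho> (pt5 z w t)) = 0 \<and> ((z, w) \<in> frontier (D t) \<longleftrightarrow> \<rho> (pt5 z w t) = 0)"
    and nz: "Re (dirderiv \<rho> (pt5 z0 w0 t0) (vec5 v1 (cnj v1) v2 (cnj v2) 0)) \<noteq> 0"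
    and L_def: "L = (\<lambda>v. Re (dirderiv \<rho> (pt5 z0 w0 t0) (vec5 (fst v) (cnj (fst v)) (snd v) (cnj (snd v)) 0)))"
  shows "\<exists>\<kappa>. \<bar>\<kappa>\<bar> = 1 \<and> (\<forall>a\<in>D t0. \<kappa> * L (a - (z0, w0)) < 0) \<and>
          (\<forall>v. \<kappa> * L v < 0 \<longrightarrow> (\<exists>s>0. (z0, w0) + s *\<^sub>R v \<in> D t0))"
    and "linear L"
    and "Im (dirderiv \<rho> (pt5 z0 w0 t0) (vec5 a (cnj a) b (cnj b) 0)) = 0"
proof -
  define R where "R = (\<lambda>y. Re (\<rho> (pt5 (fst y) (snd y) t0)))"
  define V where "V = ball z0 (r/2) \<times> ball w0 (r/2)"
  have V: "open V" "convex V" "(z0, w0) \<in> V" using r by (auto simp: V_def open_Times convex_Times)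
  have inV: "dist (fst y) z0 < r" "dist (snd y) w0 < r" "\<bar>t0 - t0\<bar> < r" if "y \<in> V" for y
    using that r unfolding V_def by (auto simp: dist_commute)
  have d: "((\<lambda>y. \<rho> (pt5 (fst y) (snd y) t0)) has_derivative
          (\<lambda>v. dirderiv \<rho> (pt5 z0 w0 t0) (vec5 (fst v) (cnj (fst v)) (snd v) (cnj (snd v)) 0))) (at (z0, w0))"
    by (rule pt5_has_derivative[OF \<rho> r])
  have dR: "(R has_derivative L) (at (z0, w0))"
    unfolding R_def L_def by (rule bounded_linear.has_derivative[OF bounded_linear_Re d])
  show "linear L" using has_derivative_bounded_linear[OF dR] bounded_linear.linear by blast
  have "((\<lambda>y. Im (\<rho> (pt5 (fst y) (snd y) t0))) has_derivative
          (\<lambda>v. Im (dirderiv \<rho> (pt5 z0 w0 t0) (vec5 (fst v) (cnj (fst v)) (snd v) (cnj (snd v)) 0)))) (at (z0, w0))"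
    by (rule bounded_linear.has_derivative[OF bounded_linear_Im d])
  then have "((\<lambda>y. 0) has_derivative
          (\<lambda>v. Im (dirderiv \<rho> (pt5 z0 w0 t0) (vec5 (fst v) (cnj (fst v)) (snd v) (cnj (snd v)) 0)))) (at (z0, w0))"
    by (rule has_derivative_transform_within_open[OF _ V(1,3)]) (use pts inV in blast)
  from fun_cong[OF has_derivative_unique[OF this has_derivative_const], of "(a, b)"]
  show "Im (dirderiv \<rho> (pt5 z0 w0 t0) (vec5 a (cnj a) b (cnj b) 0)) = 0" by simp
  have cont: "continuous_on V R"
  proof -
    have "continuous_on V (\<lambda>y. \<rho> (pt5 (fst (fst (y, t0))) (snd (fst (y, t0))) (snd (y, t0))))"
      by (rule continuous_on_compose2[OF pt5_continuous_on[OF \<rho> r order_refl], of V "\<lambda>y. (y, t0)"])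
         (use r in \<open>auto simp: V_def intro!: continuous_intros\<close>)
    then show ?thesis unfolding R_def by (auto intro: continuous_intros)
  qed
  have zero: "y \<in> frontier (D t0) \<longleftrightarrow> R y = 0" if "y \<in> V" for y
    using pts[OF inV[OF that]] by (auto simp: R_def complex_eq_iff)
  have Lv: "L (v1, v2) \<noteq> 0" using nz by (simp add: L_def)
  show "\<exists>\<kappa>. \<bar>\<kappa>\<bar> = 1 \<and> (\<forall>a\<in>D t0. \<kappa> * L (a - (z0, w0)) < 0) \<and>
          (\<forall>v. \<kappa> * L v < 0 \<longrightarrow> (\<exists>s>0. (z0, w0) + s *\<^sub>R v \<in> D t0))"
    by (rule boundary_derivative[OF t p cont V zero dR Lv])
qed

text \<open>The derivative of the defining function is nonzero in a direction with constant \<open>z\<close> or in one with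
  constant \<open>w\<close>. Such a direction or its opposite points into the domain.\<close>

lemma slice_nonempty_cases:
  assumes t: "\<bar>t0\<bar> < \<delta>" and p: "(z0, w0) \<in> frontier (D t0)"
  shows "slice z0 t0 \<noteq> {} \<or> {z. (z, w0) \<in> D t0} \<noteq> {}"
proof -
  obtain r M N \<rho> g v1 v2 where r: "r > 0" and \<rho>: "curve_holomorphic \<rho> {..<5} (pt5 z0 w0 t0) r M"
    and pts: "\<And>z w t. dist z z0 < r \<Longrightarrow> dist w w0 < r \<Longrightarrow> \<bar>t - t0\<bar> < r \<Longrightarrow>
           Im (\<rho> (pt5 z w t)) = 0 \<and> ((z, w) \<in> frontier (D t) \<longleftrightarrow> \<rho> (pt5 z w t) = 0)"
    and nz: "Re (dirderiv \<rho> (pt5 z0 w0 t0) (vec5 v1 (cnj v1) v2 (cnj v2) 0)) \<noteq> 0"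
    using complexified[OF t p] unfolding locally_complexified_def by blast
  define L where "L = (\<lambda>v. Re (dirderiv \<rho> (pt5 z0 w0 t0) (vec5 (fst v) (cnj (fst v)) (snd v) (cnj (snd v)) 0)))"
  note D = defining_function_derivative[OF t p r \<rho> pts nz L_def]
  obtain \<kappa> where \<kappa>: "\<bar>\<kappa>\<bar> = 1" "\<And>v. \<kappa> * L v < 0 \<Longrightarrow> \<exists>s>0. (z0, w0) + s *\<^sub>R v \<in> D t0" using D(1) by blast
  have lin: "linear L" by (rule D(2))
  have k0: "\<kappa> \<noteq> 0" using \<kappa>(1) by auto
  have enter: "\<exists>s. (z0, w0) + s *\<^sub>R v \<in> D t0" if "L v \<noteq> 0" for v
  proof (cases "\<kappa> * L v < 0")
    case True then show ?thesis using \<kappa>(2) by blast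
  next
    case False
    moreover have "\<kappa> * L v \<noteq> 0" using that k0 by simp
    moreover have "\<kappa> * L (- v) = - (\<kappa> * L v)" using linear_neg[OF lin] by simp
    ultimately have "\<kappa> * L (- v) < 0" by linarith
    then obtain s where "(z0, w0) + s *\<^sub>R (- v) \<in> D t0" using \<kappa>(2) by blast
    then have "(z0, w0) + (- s) *\<^sub>R v \<in> D t0" by simp
    then show ?thesis by blast
  qed
  have "L (v1, v2) = L (v1, 0) + L (0, v2)" using linear_add[OF lin, of "(v1, 0)" "(0, v2)"] by simp
  then have "L (0, v2) \<noteq> 0 \<or> L (v1, 0) \<noteq> 0" using nz by (auto simp: L_def)
  then show ?thesis
  proof
    assume "L (0, v2) \<noteq> 0"
    from enter[OF this] show ?thesis by (auto simp: slice_def)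
  next
    assume "L (v1, 0) \<noteq> 0"
    from enter[OF this] show ?thesis by auto
  qed
qed

text \<open>Solving the complexified equation of the boundary for the conjugate of \<open>w\<close> gives the Schwarz
  function \<open>S\<close> of the boundary curve of the slice. Substituting \<open>S\<close> for the conjugate of \<open>w\<close> in
  \<open>f\<close> gives a function that is holomorphic in \<open>w\<close>, agrees with \<open>f\<close> on the boundary, and hence agrees
  with the extension inside.\<close>

lemma ext_across_boundary:
  assumes t0: "\<bar>t0\<bar> < \<delta>" and p: "(z0, w0) \<in> frontier (D t0)" and ne: "slice z0 t0 \<noteq> {}"
  shows "\<exists>r>0. \<exists>M G. curve_holomorphic G {0, 1, 2, 4} (pt5 z0 w0 t0) r M \<and>
           (\<forall>z w t. dist z z0 < r \<longrightarrow> dist w w0 < r \<longrightarrow> \<bar>t - t0\<bar> < r \<longrightarrow>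
              \<bar>t\<bar> < \<delta> \<and> slice z t \<noteq> {} \<and>
              ((z, w) \<in> closure (D t) \<longrightarrow> ext z w t = G (pt5 z w t)))"
proof -
  obtain r M N \<rho> g v1 v2 where r: "r > 0" and \<rho>: "curve_holomorphic \<rho> {..<5} (pt5 z0 w0 t0) r M"
    and g: "curve_holomorphic g {..<5} (pt5 z0 w0 t0) r N"
    and pts': "\<And>z w t. dist z z0 < r \<Longrightarrow> dist w w0 < r \<Longrightarrow> \<bar>t - t0\<bar> < r \<Longrightarrow> \<bar>t\<bar> < \<delta> \<and>
           Im (\<rho> (pt5 z w t)) = 0 \<and> ((z, w) \<in> frontier (D t) \<longleftrightarrow> \<rho> (pt5 z w t) = 0) \<and> g (pt5 z w t) = f t (z, w)"
    and nz: "Re (dirderiv \<rho> (pt5 z0 w0 t0) (vec5 v1 (cnj v1) v2 (cnj v2) 0)) \<noteq> 0"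
    using complexified[OF t0 p] unfolding locally_complexified_def by blast
  have pts: "\<And>z w t. dist z z0 < r \<Longrightarrow> dist w w0 < r \<Longrightarrow> \<bar>t - t0\<bar> < r \<Longrightarrow>
           Im (\<rho> (pt5 z w t)) = 0 \<and> ((z, w) \<in> frontier (D t) \<longleftrightarrow> \<rho> (pt5 z w t) = 0)" using pts' by blast
  define c where "c = pt5 z0 w0 t0"
  define J where "J = {0, 1, 2, 4::nat}"
  have J5: "insert 3 J = {..<5}" by (auto simp: J_def)
  define L where "L = (\<lambda>v. Re (dirderiv \<rho> c (vec5 (fst v) (cnj (fst v)) (snd v) (cnj (snd v)) 0)))"
  note DD = defining_function_derivative[OF t0 p r \<rho> pts nz L_def[unfolded c_def]]
  obtain \<kappa> where \<kappa>: "\<bar>\<kappa>\<bar> = 1" "\<And>a. a \<in> D t0 \<Longrightarrow> \<kappa> * L (a - (z0, w0)) < 0" using DD(1) by blast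
  obtain a where a: "(z0, a) \<in> D t0" using ne by (auto simp: slice_def)
  define e3 where "e3 = (\<lambda>b::nat. if b = 3 then 1 else (0::complex))"
  define e2 where "e2 = (\<lambda>b::nat. if b = 2 then 1 else (0::complex))"
  \<comment> \<open>\<open>\<rho>\<close> is real at real points, so if its derivative in the conjugate of \<open>w\<close> vanished, then so would that in \<open>w\<close>\<close>
  have d3: "dirderiv \<rho> c e3 \<noteq> 0"
  proof
    assume 0: "dirderiv \<rho> c e3 = 0"
    have split: "dirderiv \<rho> c (vec5 0 (cnj 0) b (cnj b) 0) = b * dirderiv \<rho> c e2" for b
    proof -
      have cc: "c \<in> polydisc {..<5} c (r/2)" "r/2 < r" using r by (auto intro: polydisc_centre)
      have "vec5 0 (cnj 0) b (cnj b) 0 = (\<lambda>i. b * e2 i + cnj b * e3 i)"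
        by (auto simp: vec5_def e2_def e3_def fun_eq_iff)
      then have "dirderiv \<rho> c (vec5 0 (cnj 0) b (cnj b) 0)
          = dirderiv \<rho> c (\<lambda>i. b * e2 i) + dirderiv \<rho> c (\<lambda>i. cnj b * e3 i)"
        using dirderiv_add[OF \<rho>[folded c_def] finite_lessThan cc] by simp
      then show ?thesis using dirderiv_scale[OF \<rho>[folded c_def] finite_lessThan cc] 0 by simp
    qed
    have "Im (b * dirderiv \<rho> c e2) = 0" for b
      using DD(3)[of 0 b] split[of b] by (simp add: c_def)
    from this[of 1] this[of \<i>] have "dirderiv \<rho> c e2 = 0" by (simp add: complex_eq_iff)
    then have "L (0, a - w0) = 0" using split[of "a - w0"] by (simp add: L_def)
    then show False using \<kappa>(2)[OF a] by simp
  qed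
  have c0: "\<rho> c = 0" using pts[of z0 w0 t0] p r by (simp add: c_def)
  obtain s S where s: "s > 0" "s \<le> r" and S: "curve_holomorphic S J c s (norm (c 3) + r)"
    "\<And>x. x \<in> polydisc J c s \<Longrightarrow> dist (S x) (c 3) < r"
    "\<And>x d. x \<in> polydisc J c s \<Longrightarrow> dist d (c 3) < s \<Longrightarrow> \<rho> (x(3 := d)) = 0 \<Longrightarrow> d = S x"
    using holomorphic_implicit_function[where j = 3 and J = J and \<phi> = \<rho> and c = c and r = r and M = M]
      \<rho> r c0 d3 unfolding J5 c_def[symmetric] e3_def by (auto simp: J_def)
  define G where "G = (\<lambda>x. g (x(3 := S x)))"
  have G: "curve_holomorphic G J c s N" unfolding G_def
  proof (rule curve_holomorphic_compose[OF g[folded c_def]])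
    fix b assume "b \<in> {..<5::nat}"
    then have "b = 3 \<or> b \<in> J" using J5 by blast
    then show "\<exists>N. curve_holomorphic (\<lambda>x. (x(3 := S x)) b) J c s N"
    proof (cases "b = 3")
      case True then show ?thesis using S(1) by auto
    next
      case False
      then show ?thesis using curve_holomorphic_coordinate[of J b s c] s \<open>b = 3 \<or> b \<in> J\<close> by (auto simp: J_def)
    qed
  next
    fix x assume x: "x \<in> polydisc J c s"
    show "x(3 := S x) \<in> polydisc {..<5} c r"
      using x S(2)[OF x] s(2) unfolding J5[symmetric] polydisc_def by (auto intro: order.strict_trans2)
  qed
  have inJ: "pt5 z w t \<in> polydisc J c s" if "dist z z0 < s" "dist w w0 < s" "\<bar>t - t0\<bar> < s" for z w t
    using pt5_in_polydisc[OF that] J5 unfolding polydisc_def c_def by blast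
  have bdry: "G (pt5 z w t) = f t (z, w)"
    if zwt: "dist z z0 < s" "dist w w0 < s" "\<bar>t - t0\<bar> < s" and fr: "(z, w) \<in> frontier (D t)" for z w t
  proof -
    have r': "dist z z0 < r" "dist w w0 < r" "\<bar>t - t0\<bar> < r" using zwt s by auto
    have eq: "(pt5 z w t)(3 := cnj w) = pt5 z w t" by (auto simp: pt5_def vec5_def fun_eq_iff)
    have "dist (cnj w) (c 3) < s"
      using zwt(2) by (simp add: c_def pt5_def vec5_def dist_norm flip: complex_cnj_diff)
    moreover have "\<rho> ((pt5 z w t)(3 := cnj w)) = 0" using pts[OF r'] fr by (simp add: eq)
    ultimately have "cnj w = S (pt5 z w t)" by (rule S(3)[OF inJ[OF zwt]])
    then have "G (pt5 z w t) = g (pt5 z w t)" unfolding G_def using eq by metis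
    then show ?thesis using pts'[OF r'] by simp
  qed
  \<comment> \<open>one point inside and one point outside on the line, close to \<open>w0\<close>; both persist\<close>
  have pc: "(z0, w0) \<in> closure (D t0)" "(z0, w0) \<notin> D t0"
    using p domain_props(2)[OF t0] by (auto simp: frontier_def interior_open)
  have aw: "a \<noteq> w0" using a pc by blast
  define q where "q = min 1 (s / (2 * norm (a - w0)))"
  have q: "0 < q" "q \<le> 1" using s aw by (auto simp: q_def)
  have qs: "q * norm (a - w0) < s"
  proof -
    have "q * norm (a - w0) \<le> s / (2 * norm (a - w0)) * norm (a - w0)"
      unfolding q_def by (rule mult_right_mono[OF min.cobounded2]) simp
    also have "\<dots> < s" using s aw by simp
    finally show ?thesis .
  qed
  define wi where "wi = w0 + q *\<^sub>R (a - w0)"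
  define wo where "wo = w0 - q *\<^sub>R (a - w0)"
  have intD: "(z0, a) \<in> interior (D t0)" using a domain_props(2)[OF t0] by (simp add: interior_open)
  have wi: "(z0, wi) \<in> D t0"
  proof -
    have "(z0, w0) - q *\<^sub>R ((z0, w0) - (z0, a)) \<in> interior (D t0)"
      by (rule mem_interior_closure_convex_shrink[OF domain_props(3)[OF t0] intD pc(1) q])
    moreover have "(z0, w0) - q *\<^sub>R ((z0, w0) - (z0, a)) = (z0, wi)" by (simp add: wi_def algebra_simps)
    ultimately show ?thesis using domain_props(2)[OF t0] by (simp add: interior_open)
  qed
  have wo: "(z0, wo) \<notin> closure (D t0)"
  proof
    assume woc: "(z0, wo) \<in> closure (D t0)"
    define m where "m = q / (1 + q)"
    have m: "0 < m" "m \<le> 1" "m * (1 + q) = q" using q by (auto simp: m_def)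
    have "(z0, wo) - m *\<^sub>R ((z0, wo) - (z0, a)) \<in> interior (D t0)"
      by (rule mem_interior_closure_convex_shrink[OF domain_props(3)[OF t0] intD woc m(1,2)])
    moreover have "wo - m *\<^sub>R (wo - a) = w0"
    proof -
      have "wo - a = - ((1 + q) *\<^sub>R (a - w0))" by (simp add: wo_def algebra_simps)
      then have "m *\<^sub>R (wo - a) = - (q *\<^sub>R (a - w0))" using m(3) by simp
      then show ?thesis by (simp add: wo_def)
    qed
    ultimately show False using pc(2) domain_props(2)[OF t0] by (simp add: interior_open)
  qed
  obtain \<eta>1 where \<eta>1: "\<eta>1 > 0" "\<And>q' t'. dist q' (z0, wi) < \<eta>1 \<Longrightarrow> \<bar>t' - t0\<bar> < \<eta>1 \<Longrightarrow> \<bar>t'\<bar> < \<delta> \<and> q' \<in> D t'"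
    using inside_open[OF t0 wi] by blast
  obtain \<eta>2 where \<eta>2: "\<eta>2 > 0" "\<And>q' t'. dist q' (z0, wo) < \<eta>2 \<Longrightarrow> \<bar>t' - t0\<bar> < \<eta>2 \<Longrightarrow> q' \<notin> closure (D t')"
    using outside_open[OF t0 wo] by blast
  define e where "e = min s (min \<eta>1 \<eta>2)"
  have e: "e > 0" "e \<le> s" "e \<le> \<eta>1" "e \<le> \<eta>2" using s \<eta>1 \<eta>2 by (auto simp: e_def)
  have main: "\<bar>t\<bar> < \<delta> \<and> slice z t \<noteq> {} \<and> ((z, w) \<in> closure (D t) \<longrightarrow> ext z w t = G (pt5 z w t))"
    if zt: "dist z z0 < e" "\<bar>t - t0\<bar> < e" and w: "dist w w0 < e" for z w t
  proof -
    have 1: "\<bar>t\<bar> < \<delta>" "(z, wi) \<in> D t" using \<eta>1(2)[of "(z, wi)" t] zt e by (auto simp: dist_Pair_Pair)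
    have 2: "(z, wo) \<notin> closure (D t)" using \<eta>2(2)[of "(z, wo)" t] zt e by (auto simp: dist_Pair_Pair)
    have nez: "slice z t \<noteq> {}" using 1 by (auto simp: slice_def)
    have in_ball: "wi \<in> ball w0 s" "wo \<in> ball w0 s" using qs q by (auto simp: wi_def wo_def dist_norm)
    have "wi \<in> slice z t" "wo \<notin> slice z t"
      using 1 2 closure_subset[of "D t"] by (auto simp: slice_def)
    then have "ball w0 s \<inter> frontier (slice z t) \<noteq> {}"
      using in_ball connected_Int_frontier[of "ball w0 s" "slice z t"] by blast
    then have fr: "frontier (slice z t) \<inter> ball w0 s \<noteq> {}" by blast
    have zs: "dist z z0 < s" "\<bar>t - t0\<bar> < s" using zt e by auto
    have Ghol: "(\<lambda>w. G (pt5 z w t)) holomorphic_on ball w0 s"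
    proof (rule curve_holomorphic_along[OF G open_ball])
      fix b assume "b \<in> J"
      then show "(\<lambda>w. pt5 z w t b) holomorphic_on ball w0 s"
        by (auto simp: J_def pt5_def vec5_def intro: holomorphic_intros)
    next
      fix x assume "x \<in> ball w0 s"
      then show "pt5 z x t \<in> polydisc J c s" using inJ[OF zs(1) _ zs(2)] by (simp add: dist_commute)
    qed
    have "ext z w t - G (pt5 z w t) = 0" if wc: "(z, w) \<in> closure (D t)"
    proof (rule boundary_uniqueness_convex[where u = "\<lambda>w. ext z w t - G (pt5 z w t)" and a = w0 and R = s,
          OF slice_open[OF 1(1)] slice_convex[OF 1(1)] _ _ _ fr])
      show "continuous_on (closure (slice z t) \<inter> ball w0 s) (\<lambda>w. ext z w t - G (pt5 z w t))"
        by (intro continuous_on_diff continuous_on_subset[OF ext_props(1)[OF 1(1) nez]]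
            continuous_on_subset[OF holomorphic_on_imp_continuous_on[OF Ghol]]) auto
      show "(\<lambda>w. ext z w t - G (pt5 z w t)) holomorphic_on slice z t \<inter> ball w0 s"
        by (intro holomorphic_on_diff holomorphic_on_subset[OF ext_props(2)[OF 1(1) nez]]
            holomorphic_on_subset[OF Ghol]) auto
      fix x assume x: "x \<in> frontier (slice z t)" "x \<in> ball w0 s"
      have "(z, x) \<in> frontier (D t)" using x(1) slice_frontier[OF 1(1) nez] by blast
      then show "ext z x t - G (pt5 z x t) = 0"
        using bdry[OF zs(1) _ zs(2)] x(2) ext_props(4)[OF 1(1) nez] by (simp add: dist_commute)
    next
      show "w \<in> closure (slice z t)" using wc slice_closure[OF 1(1) nez] by blast
      show "w \<in> ball w0 s" using w e by (simp add: dist_commute)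
    qed
    then show ?thesis using 1 nez by simp
  qed
  have "curve_holomorphic G {0, 1, 2, 4} (pt5 z0 w0 t0) e N"
    using curve_holomorphic_mono[OF G e(2) order_refl] by (simp add: J_def c_def)
  then show ?thesis using main e(1) by blast
qed

end

section \<open>Power series along real lines\<close>

text \<open>The germ of \<open>g\<close> at 0 is real analytic with Taylor coefficients \<open>a\<close>.\<close>

definition has_series :: "(real \<Rightarrow> complex) \<Rightarrow> (nat \<Rightarrow> complex) \<Rightarrow> bool" where
  "has_series g a \<longleftrightarrow> (\<exists>e>0. \<forall>s. \<bar>s\<bar> < e \<longrightarrow> (\<lambda>k. a k * of_real s ^ k) sums g s)"

lemma has_seriesI: "e > 0 \<Longrightarrow> (\<And>s. \<bar>s\<bar> < e \<Longrightarrow> (\<lambda>k. a k * of_real s ^ k) sums g s) \<Longrightarrow> has_series g a"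
  unfolding has_series_def by blast

lemma has_series_unique:
  assumes "has_series g a" "has_series h b" and e: "e > 0" "\<And>s. \<bar>s\<bar> < e \<Longrightarrow> g s = h s"
  shows "a = b"
proof
  fix k
  obtain e1 where e1: "e1 > 0" "\<And>s. \<bar>s\<bar> < e1 \<Longrightarrow> (\<lambda>k. a k * of_real s ^ k) sums g s"
    using assms(1) unfolding has_series_def by blast
  obtain e2 where e2: "e2 > 0" "\<And>s. \<bar>s\<bar> < e2 \<Longrightarrow> (\<lambda>k. b k * of_real s ^ k) sums h s"
    using assms(2) unfolding has_series_def by blast
  show "a k = b k"
  proof (rule powser_real_coeffs_eq[where e = "min e (min e1 e2)" and g = g])
    show "min e (min e1 e2) > 0" using e(1) e1(1) e2(1) by simp
    show "(\<lambda>k. a k * of_real s ^ k) sums g s" if "\<bar>s\<bar> < min e (min e1 e2)" for s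
      using e1(2)[of s] that by simp
    show "(\<lambda>k. b k * of_real s ^ k) sums g s" if "\<bar>s\<bar> < min e (min e1 e2)" for s
      using e2(2)[of s] e(2)[of s] that by simp
  qed
qed

lemma has_series_diff:
  assumes "has_series g a" "has_series h b"
  shows "has_series (\<lambda>s. g s - h s) (\<lambda>k. a k - b k)"
proof -
  obtain e1 where e1: "e1 > 0" "\<And>s. \<bar>s\<bar> < e1 \<Longrightarrow> (\<lambda>k. a k * of_real s ^ k) sums g s"
    using assms(1) unfolding has_series_def by blast
  obtain e2 where e2: "e2 > 0" "\<And>s. \<bar>s\<bar> < e2 \<Longrightarrow> (\<lambda>k. b k * of_real s ^ k) sums h s"
    using assms(2) unfolding has_series_def by blast
  show ?thesis
  proof (rule has_seriesI[where e = "min e1 e2"])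
    fix s assume "\<bar>s\<bar> < min e1 e2"
    then show "(\<lambda>k. (a k - b k) * of_real s ^ k) sums (g s - h s)"
      using sums_diff[OF e1(2)[of s] e2(2)[of s]] by (simp add: left_diff_distrib)
  qed (use e1 e2 in simp)
qed

lemma has_series_zero:
  assumes "has_series g (\<lambda>k. 0)"
  shows "\<exists>e>0. \<forall>s. \<bar>s\<bar> < e \<longrightarrow> g s = 0"
proof -
  obtain e where e: "e > 0" "\<And>s. \<bar>s\<bar> < e \<Longrightarrow> (\<lambda>k. 0 * of_real s ^ k) sums g s"
    using assms unfolding has_series_def by blast
  have "g s = 0" if "\<bar>s\<bar> < e" for s
  proof -
    have "(\<lambda>k::nat. 0) sums g s" using e(2)[OF that] by simp
    then show ?thesis using sums_unique2[OF _ sums_zero] by blast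
  qed
  then show ?thesis using e(1) by blast
qed

lemma holomorphic_has_series:
  assumes "H holomorphic_on ball 0 e" "e > 0" "\<And>s::real. \<bar>s\<bar> < e \<Longrightarrow> H (of_real s) = g s"
  shows "has_series g (\<lambda>k. (deriv ^^ k) H 0 / fact k)"
proof (rule has_seriesI[OF assms(2)])
  fix s :: real assume s: "\<bar>s\<bar> < e"
  then have "of_real s \<in> ball (0::complex) e" by simp
  from holomorphic_power_series[OF assms(1) this]
  show "(\<lambda>k. (deriv ^^ k) H 0 / fact k * of_real s ^ k) sums g s" using assms(3)[OF s] by simp
qed

lemma has_series_identity:
  fixes g :: "real \<Rightarrow> complex"
  assumes loc: "\<And>s0. s0 \<in> S \<Longrightarrow> \<exists>a. has_series (\<lambda>s. g (s0 + s)) a"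
    and S: "open S" "connected S" and z: "z0 \<in> S" "e > 0" "\<And>s. \<bar>s - z0\<bar> < e \<Longrightarrow> g s = 0" and x: "x \<in> S"
  shows "g x = 0"
proof -
  define Z where "Z = {s\<in>S. \<exists>e>0. \<forall>u. \<bar>u - s\<bar> < e \<longrightarrow> g u = 0}"
  have opZ: "open Z" unfolding open_dist
  proof
    fix s assume "s \<in> Z"
    then obtain e where e: "s \<in> S" "e > 0" "\<And>u. \<bar>u - s\<bar> < e \<Longrightarrow> g u = 0" unfolding Z_def by blast
    obtain e' where e': "e' > 0" "\<And>u. dist u s < e' \<Longrightarrow> u \<in> S" using S(1) e(1) unfolding open_dist by blast
    have "u \<in> Z" if us: "dist u s < min e' (e/2)" for u
    proof -
      have "g v = 0" if v: "\<bar>v - u\<bar> < e/2" for v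
      proof (rule e(3))
        have "\<bar>u - s\<bar> < e/2" using us by (simp add: dist_real_def)
        then show "\<bar>v - s\<bar> < e" using v by linarith
      qed
      then show ?thesis using e e'(2)[of u] us unfolding Z_def by (auto intro: exI[of _ "e/2"])
    qed
    then show "\<exists>e>0. \<forall>y. dist y s < e \<longrightarrow> y \<in> Z" using e e' by (intro exI[of _ "min e' (e/2)"]) auto
  qed
  have "S \<inter> closure Z \<subseteq> Z"
  proof
    fix s assume s: "s \<in> S \<inter> closure Z"
    obtain a e where e: "e > 0" "\<And>u. \<bar>u\<bar> < e \<Longrightarrow> (\<lambda>k. a k * of_real u ^ k) sums g (s + u)"
      using loc[of s] s unfolding has_series_def by blast
    obtain y where y: "y \<in> Z" "dist y s < e" using s e(1) closure_approachable[of s Z] by blast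
    obtain d where d: "d > 0" "\<And>u. \<bar>u - y\<bar> < d \<Longrightarrow> g u = 0" using y(1) unfolding Z_def by blast
    \<comment> \<open>the complex power series about \<open>s\<close> vanishes near the real point \<open>y\<close>, hence identically\<close>
    define P where "P = (\<lambda>z. \<Sum>k. a k * z ^ k)"
    have sm: "(\<lambda>k. a k * (z - 0) ^ k) sums P z" if z: "z \<in> ball 0 e" for z
    proof -
      define x where "x = (norm z + e) / 2"
      have x: "norm z < x" "\<bar>x\<bar> < e"
      proof -
        have "norm z < e" using z by simp
        then show "norm z < x" by (simp add: x_def)
        have "0 \<le> norm z" by simp
        then have "0 \<le> x" "x < e" using \<open>norm z < e\<close> e(1) by (simp_all add: x_def)
        then show "\<bar>x\<bar> < e" by simp
      qed
      have "summable (\<lambda>k. a k * of_real x ^ k)" by (rule sums_summable[OF e(2)[OF x(2)]])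
      then have "summable (\<lambda>k. a k * z ^ k)"
        by (rule powser_inside) (use x in simp)
      then show ?thesis by (simp add: P_def summable_sums)
    qed
    have holP: "P holomorphic_on ball 0 e" by (rule power_series_holomorphic[OF sm])
    have gP: "g (s + u) = P (of_real u)" if "\<bar>u\<bar> < e" for u
      using sums_unique2[OF e(2)[OF that]] sm[of "of_real u"] that by simp
    define m where "m = min d (e - dist y s)"
    have m: "m > 0" using d y by (simp add: m_def)
    define U where "U = complex_of_real ` {y - s <..< y - s + m}"
    have "P z = 0" if z: "z \<in> ball 0 e" for z
    proof (rule analytic_continuation[OF holP open_ball _ _ _ _ _ z, where U = U and \<xi> = "of_real (y - s)"])
      show "U \<subseteq> ball 0 e" by (auto simp: U_def m_def dist_real_def)
      show "of_real (y - s) \<in> ball (0::complex) e" using y(2) by (simp add: dist_real_def del: of_real_diff)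
      show "complex_of_real (y - s) islimpt U" unfolding islimpt_approachable
      proof (intro allI impI)
        fix r :: real assume r: "r > 0"
        define u where "u = y - s + min m r / 2"
        have "u \<in> {y - s <..< y - s + m}" "\<bar>u - (y - s)\<bar> < r" "u \<noteq> y - s" using m r by (auto simp: u_def)
        then show "\<exists>x'\<in>U. x' \<noteq> of_real (y - s) \<and> dist x' (of_real (y - s)) < r"
          unfolding U_def by (intro bexI[of _ "of_real u"]) (auto simp: dist_norm simp flip: of_real_diff)
      qed
      fix v assume "v \<in> U"
      then obtain u where u: "v = of_real u" "y - s < u" "u < y - s + m" by (auto simp: U_def)
      have "\<bar>u\<bar> < e" "\<bar>(s + u) - y\<bar> < d" using u by (auto simp: m_def dist_real_def)
      then show "P v = 0" using gP[of u] d(2)[of "s + u"] u by simp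
    qed auto
    then have "g u = 0" if "\<bar>u - s\<bar> < e" for u
      using gP[of "u - s"] that \<open>\<And>z. z \<in> ball 0 e \<Longrightarrow> P z = 0\<close>[of "of_real (u - s)"] by (simp del: of_real_diff)
    then show "s \<in> Z" using s e(1) unfolding Z_def by blast
  qed
  then have clZ: "closedin (top_of_set S) Z"
  proof -
    have "Z = S \<inter> closure Z" using \<open>S \<inter> closure Z \<subseteq> Z\<close> closure_subset[of Z] by (auto simp: Z_def)
    then show ?thesis unfolding closedin_closed using closed_closure by blast
  qed
  have opZ': "openin (top_of_set S) Z" using opZ by (intro open_subset) (auto simp: Z_def)
  have "z0 \<in> Z" using z unfolding Z_def by blast
  then have "Z = S" using S(2) opZ' clZ unfolding connected_clopen by blast
  then have "x \<in> Z" using x by blast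
  then obtain e where "e > 0" "\<forall>u. \<bar>u - x\<bar> < e \<longrightarrow> g u = 0" unfolding Z_def by blast
  then show ?thesis by auto
qed

text \<open>The Taylor coefficients of \<open>E c\<close> at 0 are holomorphic in \<open>c\<close>, so those below order \<open>n\<close> vanish identically. Along the zeros
  \<open>(h t, t)\<close> of \<open>E\<close> the coefficient of order \<open>n\<close> is then of the size of \<open>t\<close>, and its limit is the value at 0.\<close>

lemma leading_coefficient_vanishes:
  fixes E :: "complex \<Rightarrow> complex \<Rightarrow> complex"
  assumes e: "e > 0"
    and h2: "\<And>c. c \<in> ball 0 e \<Longrightarrow> E c holomorphic_on ball 0 e"
    and h1: "\<And>s. \<bar>s\<bar> < e \<Longrightarrow> (\<lambda>c. E c (of_real s)) holomorphic_on ball 0 e"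
    and bd: "\<And>c \<sigma>. c \<in> ball 0 e \<Longrightarrow> \<sigma> \<in> ball 0 e \<Longrightarrow> norm (E c \<sigma>) \<le> M"
    and zero: "\<And>k s. k < n \<Longrightarrow> - e < s \<Longrightarrow> s < 0 \<Longrightarrow> (deriv ^^ k) (E (of_real s)) 0 = 0"
    and h: "(h \<longlongrightarrow> 0) (at 0)" and Eh: "\<forall>\<^sub>F t in at 0. E (of_real (h t)) (of_real t) = 0"
  shows "(deriv ^^ n) (E 0) 0 = 0"
proof -
  define \<Omega> where "\<Omega> = ball (0::complex) (e/2)"
  have cl: "closure \<Omega> = cball 0 (e/2)" "frontier \<Omega> = sphere 0 (e/2)" using e by (simp_all add: \<Omega>_def)
  have sub: "closure \<Omega> \<subseteq> ball 0 e" using e unfolding cl by auto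
  have "\<exists>\<alpha>. (\<forall>k. continuous_on (closure \<Omega>) (\<alpha> k) \<and> \<alpha> k holomorphic_on \<Omega>) \<and>
           (\<forall>k. \<forall>c\<in>closure \<Omega>. norm (\<alpha> k c) \<le> M / (e/2) ^ k) \<and>
           (\<forall>s. \<forall>c\<in>closure \<Omega>. \<bar>s\<bar> \<le> e/4 \<longrightarrow> (\<lambda>k. \<alpha> k c * of_real s ^ k) sums E c (of_real s))"
  proof (rule power_series_from_frontier[OF _ _ e])
    show "open \<Omega>" "bounded \<Omega>" by (simp_all add: \<Omega>_def)
    show "continuous_on (closure \<Omega>) (\<lambda>c. E c (of_real s))" if "\<bar>s\<bar> < e" for s
      using holomorphic_on_imp_continuous_on[OF h1[OF that]] sub continuous_on_subset by blast
    show "(\<lambda>c. E c (of_real s)) holomorphic_on \<Omega>" if "\<bar>s\<bar> < e" for s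
      using h1[OF that] sub closure_subset by (meson holomorphic_on_subset order_trans)
    fix c assume "c \<in> frontier \<Omega>"
    then have c: "c \<in> ball 0 e" using sub by (auto simp: frontier_def)
    show "\<exists>H. H holomorphic_on ball 0 e \<and> (\<forall>z\<in>ball 0 e. norm (H z) \<le> M) \<and>
       (\<forall>s. \<bar>s\<bar> < e \<longrightarrow> H (of_real s) = E c (of_real s))"
      using h2[OF c] bd[OF c] by blast
  qed
  then obtain \<alpha> where \<alpha>: "\<And>k. \<alpha> k holomorphic_on \<Omega>" "\<And>k c. c \<in> closure \<Omega> \<Longrightarrow> norm (\<alpha> k c) \<le> M / (e/2) ^ k"
    "\<And>s c. c \<in> closure \<Omega> \<Longrightarrow> \<bar>s\<bar> \<le> e/4 \<Longrightarrow> (\<lambda>k. \<alpha> k c * of_real s ^ k) sums E c (of_real s)" by blast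
  have \<alpha>E: "\<alpha> k c = (deriv ^^ k) (E c) 0 / fact k" if c: "c \<in> \<Omega>" for k c
  proof -
    have cc: "c \<in> closure \<Omega>" "c \<in> ball 0 e" using c sub closure_subset by blast+
    have "has_series (\<lambda>s. E c (of_real s)) (\<lambda>k. \<alpha> k c)"
      by (rule has_seriesI[where e = "e/4"]) (use e \<alpha>(3)[OF cc(1)] in auto)
    moreover have "has_series (\<lambda>s. E c (of_real s)) (\<lambda>k. (deriv ^^ k) (E c) 0 / fact k)"
      by (rule holomorphic_has_series[OF h2[OF cc(2)] e]) simp
    ultimately have "(\<lambda>k. \<alpha> k c) = (\<lambda>k. (deriv ^^ k) (E c) 0 / fact k)"
      by (rule has_series_unique[OF _ _ zero_less_one]) simp
    then show ?thesis by meson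
  qed
  have \<alpha>0: "\<alpha> k c = 0" if k: "k < n" and c: "c \<in> \<Omega>" for k c
  proof (rule analytic_continuation[OF \<alpha>(1), where U = "of_real ` {- e/2 <..< 0}" and \<xi> = 0])
    show "complex_of_real ` {- e/2 <..< 0} \<subseteq> \<Omega>" by (auto simp: \<Omega>_def)
    show "0 islimpt complex_of_real ` {- e/2 <..< 0}" unfolding islimpt_approachable
    proof (intro allI impI)
      fix r :: real assume r: "r > 0"
      define u where "u = - min (e/2) r / 2"
      have "u \<in> {- e/2 <..< 0}" "\<bar>u\<bar> < r" "u \<noteq> 0" using e r by (auto simp: u_def)
      then show "\<exists>x'\<in>complex_of_real ` {- e/2 <..< 0}. x' \<noteq> 0 \<and> dist x' 0 < r"
        by (intro bexI[of _ "of_real u"]) auto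
    qed
    fix z assume "z \<in> complex_of_real ` {- e/2 <..< 0}"
    then obtain u where u: "z = of_real u" "- e/2 < u" "u < 0" by auto
    have "z \<in> \<Omega>" using u by (simp add: \<Omega>_def)
    moreover have "(deriv ^^ k) (E z) 0 = 0" using zero[OF k, of u] u e by simp
    ultimately show "\<alpha> k z = 0" using \<alpha>E by simp
  qed (use c e in \<open>auto simp: \<Omega>_def\<close>)
  have h0: "((\<lambda>t. complex_of_real (h t)) \<longlongrightarrow> 0) (at 0)" using tendsto_of_real[OF h] by simp
  have "isCont (\<alpha> n) 0"
    using holomorphic_on_imp_continuous_on[OF \<alpha>(1)[of n]] e
    by (simp add: \<Omega>_def continuous_on_eq_continuous_at)
  then have lim: "((\<lambda>t. \<alpha> n (of_real (h t))) \<longlongrightarrow> \<alpha> n 0) (at 0)" by (rule isCont_tendsto_compose[OF _ h0])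
  define C where "C = 2 * M / (e/2) ^ Suc n"
  have "((\<lambda>t. \<alpha> n (of_real (h t))) \<longlongrightarrow> 0) (at 0)"
  proof (rule Lim_null_comparison)
    show "((\<lambda>t::real. C * \<bar>t\<bar>) \<longlongrightarrow> 0) (at 0)"
      by (rule tendsto_mult_right_zero, rule tendsto_rabs_zero, rule tendsto_ident_at)
    have ev1: "\<forall>\<^sub>F t in at 0. \<bar>h t\<bar> < e/2" using order_tendstoD(2)[OF tendsto_rabs_zero[OF h], of "e/2"] e by simp
    have ev2: "\<forall>\<^sub>F t in at (0::real). \<bar>t\<bar> < e/4 \<and> t \<noteq> 0"
      unfolding eventually_at using e by (intro exI[of _ "e/4"]) auto
    show "\<forall>\<^sub>F t in at 0. norm (\<alpha> n (of_real (h t))) \<le> C * \<bar>t\<bar>"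
      using ev1 ev2 Eh
    proof eventually_elim
      case (elim t)
      have hin: "complex_of_real (h t) \<in> \<Omega>" using elim by (simp add: \<Omega>_def)
      then have hcl: "complex_of_real (h t) \<in> closure \<Omega>" using closure_subset by blast
      have "norm (E (of_real (h t)) (of_real t) - (\<Sum>k<Suc n. \<alpha> k (of_real (h t)) * of_real t ^ k))
         \<le> 2 * M * (\<bar>t\<bar> / (e/2)) ^ Suc n"
        by (rule sums_tail_bound[OF \<alpha>(2)[OF hcl] _ _ \<alpha>(3)[OF hcl]]) (use elim e in auto)
      moreover have "(\<Sum>k<n. \<alpha> k (of_real (h t)) * of_real t ^ k) = 0"
        using \<alpha>0 hin by (intro sum.neutral) auto
      ultimately have "norm (\<alpha> n (of_real (h t))) * \<bar>t\<bar> ^ n \<le> 2 * M * (\<bar>t\<bar> / (e/2)) ^ Suc n"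
        using elim by (simp add: norm_mult norm_power)
      also have "\<dots> = C * \<bar>t\<bar> * \<bar>t\<bar> ^ n" by (simp add: C_def power_divide field_simps)
      finally show ?case using elim by simp
    qed
  qed
  then have "\<alpha> n 0 = 0" using lim tendsto_unique[OF trivial_limit_at] by blast
  then show ?thesis using \<alpha>E[of 0 n] e by (simp add: \<Omega>_def)
qed

text \<open>Cauchy estimates for the difference of \<open>G\<close> at two base points make the coefficients Lipschitz.\<close>

lemma parameter_Taylor_coefficient_continuous:
  assumes G: "curve_holomorphic G J (pt5 z0 w0 0) r M" and r: "r > 0" and J: "J \<subseteq> {..<5}"
  defines "A \<equiv> (\<lambda>k y. (deriv ^^ k) (\<lambda>\<sigma>. G (vec5 (fst y) (cnj (fst y)) (snd y) (cnj (snd y)) \<sigma>)) 0 / fact k)"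
  shows "continuous_on (ball z0 (r/2) \<times> ball w0 (r/2)) (A k)"
    and "\<And>y. y \<in> ball z0 (r/2) \<times> ball w0 (r/2) \<Longrightarrow>
           (\<lambda>\<sigma>. G (vec5 (fst y) (cnj (fst y)) (snd y) (cnj (snd y)) \<sigma>)) holomorphic_on ball 0 (r/2)"
    and "\<And>y. y \<in> ball z0 (r/2) \<times> ball w0 (r/2) \<Longrightarrow> has_series (\<lambda>s. G (pt5 (fst y) (snd y) s)) (\<lambda>k. A k y)"
proof -
  define B where "B = ball z0 (r/2) \<times> ball w0 (r/2)"
  define m where "m = (\<lambda>y \<sigma>. vec5 (fst y) (cnj (fst y)) (snd y) (cnj (snd y)) \<sigma>)"
  have cd: "dist (cnj a) (cnj b) = dist a b" for a b
    by (simp add: dist_norm flip: complex_cnj_diff)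
  have inP: "m y \<sigma> \<in> polydisc J (pt5 z0 w0 0) (r/2)" if "y \<in> B" "\<sigma> \<in> ball 0 (r/2)" for y \<sigma>
  proof -
    have "m y \<sigma> \<in> polydisc {..<5} (pt5 z0 w0 0) (r/2)"
      using that r unfolding polydisc_def lessThan_5 B_def
      by (auto simp: m_def pt5_def vec5_def cd dist_commute)
    then show ?thesis using J by (auto simp: polydisc_def)
  qed
  have hol: "(\<lambda>\<sigma>. G (m y \<sigma>)) holomorphic_on ball 0 (r/2)" if "y \<in> B" for y
  proof (rule curve_holomorphic_along[OF G open_ball])
    fix b show "(\<lambda>\<sigma>. m y \<sigma> b) holomorphic_on ball 0 (r/2)"
      by (cases "b = 0"; cases "b = 1"; cases "b = 2"; cases "b = 3"; cases "b = 4") (simp_all add: m_def vec5_def)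
  next
    fix \<sigma> :: complex assume "\<sigma> \<in> ball 0 (r/2)"
    from inP[OF that this] show "m y \<sigma> \<in> polydisc J (pt5 z0 w0 0) r"
      using polydisc_mono[of "r/2" r J "pt5 z0 w0 0"] r by auto
  qed
  then show "\<And>y. y \<in> ball z0 (r/2) \<times> ball w0 (r/2) \<Longrightarrow>
           (\<lambda>\<sigma>. G (vec5 (fst y) (cnj (fst y)) (snd y) (cnj (snd y)) \<sigma>)) holomorphic_on ball 0 (r/2)"
    by (simp add: m_def B_def)
  show "\<And>y. y \<in> ball z0 (r/2) \<times> ball w0 (r/2) \<Longrightarrow> has_series (\<lambda>s. G (pt5 (fst y) (snd y) s)) (\<lambda>k. A k y)"
    unfolding A_def
    by (rule holomorphic_has_series[OF hol[unfolded m_def B_def]]) (use r in \<open>auto simp: pt5_def\<close>)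
  have "((8 * M / r) / (r/4) ^ k)-lipschitz_on B (A k)"
  proof (rule lipschitz_onI)
    fix x y assume x: "x \<in> B" and y: "y \<in> B"
    have "norm ((deriv ^^ k) (\<lambda>\<sigma>. G (m x \<sigma>) - G (m y \<sigma>)) 0 / fact k) \<le> (8 * M / r * dist x y) / (r/4) ^ k"
    proof (rule Taylor_coefficient_bound[where r = "r/2"])
      show "(\<lambda>\<sigma>. G (m x \<sigma>) - G (m y \<sigma>)) holomorphic_on ball 0 (r/2)" by (intro holomorphic_on_diff hol x y)
      fix \<sigma> :: complex assume \<sigma>: "\<sigma> \<in> ball 0 (r/2)"
      show "norm (G (m x \<sigma>) - G (m y \<sigma>)) \<le> 8 * M / r * dist x y"
      proof (rule curve_holomorphic_Lipschitz[OF G r inP[OF x \<sigma>] inP[OF y \<sigma>]])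
        fix b show "dist (m x \<sigma> b) (m y \<sigma> b) \<le> dist x y"
          using dist_fst_le[of x y] dist_snd_le[of x y] by (simp add: m_def vec5_def cd)
      qed simp
    qed (use r in auto)
    moreover have "(deriv ^^ k) (\<lambda>\<sigma>. G (m x \<sigma>) - G (m y \<sigma>)) 0 = (deriv ^^ k) (\<lambda>\<sigma>. G (m x \<sigma>)) 0 - (deriv ^^ k) (\<lambda>\<sigma>. G (m y \<sigma>)) 0"
      by (rule higher_deriv_diff[OF hol[OF x] hol[OF y] open_ball]) (use r in simp)
    ultimately show "dist (A k x) (A k y) \<le> (8 * M / r) / (r/4) ^ k * dist x y"
      by (simp add: A_def m_def dist_norm diff_divide_distrib)
  qed (use curve_holomorphic_nonneg[OF G r] r in simp)
  then show "continuous_on (ball z0 (r/2) \<times> ball w0 (r/2)) (A k)"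
    unfolding B_def by (rule lipschitz_on_continuous_on)
qed

context hartogs_family
begin

text \<open>On the part of the slice at distance more than \<open>\<kappa>\<close> from its boundary, the power series in the
  line parameter is obtained from the series on the boundary of that part, where the extension is
  given by Schwarz functions.\<close>

lemma ext_line_series:
  assumes t0: "\<bar>t0\<bar> < \<delta>" and w1: "(z0, w1) \<in> D t0"
  shows "\<exists>\<Omega> e \<alpha>. open \<Omega> \<and> w1 \<in> \<Omega> \<and> e > 0 \<and> (\<forall>k. \<alpha> k holomorphic_on \<Omega>) \<and>
     (\<forall>c\<in>\<Omega>. \<forall>s::real. \<bar>s\<bar> < e \<longrightarrow>
        (\<lambda>k. \<alpha> k c * of_real s ^ k) sums ext (z0 + of_real s * \<zeta>) (c + of_real s * \<omega>) (t0 + s * \<tau>))"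
proof -
  define O0 where "O0 = slice z0 t0"
  have wO: "w1 \<in> O0" using w1 by (simp add: O0_def slice_def)
  then have ne: "slice z0 t0 \<noteq> {}" by (auto simp: O0_def)
  have O0: "open O0" "bounded O0" unfolding O0_def by (rule slice_open[OF t0], rule slice_bounded[OF t0])
  define Fr where "Fr = frontier O0"
  have Fr: "compact Fr" "closed Fr" "Fr \<noteq> {}"
    using O0(2) wO frontier_eq_empty[of O0] not_bounded_UNIV by (auto simp: Fr_def compact_frontier_bounded)
  define N where "N = 1 + norm \<zeta> + norm \<omega> + \<bar>\<tau>\<bar>"
  have N: "N \<ge> 1" "norm \<zeta> \<le> N" "norm \<omega> \<le> N" "\<bar>\<tau>\<bar> \<le> N" by (auto simp: N_def)
  have small: "norm (\<sigma> * x) < d" if "norm \<sigma> < d / N" "norm x \<le> N" for \<sigma> x :: complex and d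
  proof -
    have "norm \<sigma> * norm x \<le> norm \<sigma> * N" using that by (intro mult_left_mono) auto
    also have "\<dots> < d" using that N by (simp add: pos_less_divide_eq)
    finally show ?thesis by (simp add: norm_mult)
  qed
  define J where "J = {0, 1, 2, 4::nat}"
  have "\<forall>b\<in>Fr. \<exists>r>0. \<exists>M. M \<ge> 0 \<and> (\<exists>G. curve_holomorphic G J (pt5 z0 b t0) r M \<and>
           (\<forall>z w t. dist z z0 < r \<longrightarrow> dist w b < r \<longrightarrow> \<bar>t - t0\<bar> < r \<longrightarrow>
              \<bar>t\<bar> < \<delta> \<and> ((z, w) \<in> closure (D t) \<longrightarrow> ext z w t = G (pt5 z w t))))"
  proof
    fix b assume "b \<in> Fr"
    then have "(z0, b) \<in> frontier (D t0)" using slice_frontier[OF t0 ne] by (auto simp: Fr_def O0_def)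
    from ext_across_boundary[OF t0 this ne] obtain r M G where *: "r > 0" "curve_holomorphic G J (pt5 z0 b t0) r M"
      "\<forall>z w t. dist z z0 < r \<longrightarrow> dist w b < r \<longrightarrow> \<bar>t - t0\<bar> < r \<longrightarrow>
              \<bar>t\<bar> < \<delta> \<and> slice z t \<noteq> {} \<and> ((z, w) \<in> closure (D t) \<longrightarrow> ext z w t = G (pt5 z w t))"
      unfolding J_def by blast
    then show "\<exists>r>0. \<exists>M. M \<ge> 0 \<and> (\<exists>G. curve_holomorphic G J (pt5 z0 b t0) r M \<and>
           (\<forall>z w t. dist z z0 < r \<longrightarrow> dist w b < r \<longrightarrow> \<bar>t - t0\<bar> < r \<longrightarrow>
              \<bar>t\<bar> < \<delta> \<and> ((z, w) \<in> closure (D t) \<longrightarrow> ext z w t = G (pt5 z w t))))"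
      using curve_holomorphic_nonneg[OF *(2,1)] by blast
  qed
  from bchoice[OF this] obtain rr where rr: "\<forall>b\<in>Fr. rr b > 0 \<and> (\<exists>M. M \<ge> 0 \<and> (\<exists>G. curve_holomorphic G J (pt5 z0 b t0) (rr b) M \<and>
           (\<forall>z w t. dist z z0 < rr b \<longrightarrow> dist w b < rr b \<longrightarrow> \<bar>t - t0\<bar> < rr b \<longrightarrow>
              \<bar>t\<bar> < \<delta> \<and> ((z, w) \<in> closure (D t) \<longrightarrow> ext z w t = G (pt5 z w t)))))" ..
  then have "\<forall>b\<in>Fr. \<exists>M. M \<ge> 0 \<and> (\<exists>G. curve_holomorphic G J (pt5 z0 b t0) (rr b) M \<and>
           (\<forall>z w t. dist z z0 < rr b \<longrightarrow> dist w b < rr b \<longrightarrow> \<bar>t - t0\<bar> < rr b \<longrightarrow>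
              \<bar>t\<bar> < \<delta> \<and> ((z, w) \<in> closure (D t) \<longrightarrow> ext z w t = G (pt5 z w t))))" by blast
  from bchoice[OF this] obtain MM where MM: "\<forall>b\<in>Fr. MM b \<ge> 0 \<and> (\<exists>G. curve_holomorphic G J (pt5 z0 b t0) (rr b) (MM b) \<and>
           (\<forall>z w t. dist z z0 < rr b \<longrightarrow> dist w b < rr b \<longrightarrow> \<bar>t - t0\<bar> < rr b \<longrightarrow>
              \<bar>t\<bar> < \<delta> \<and> ((z, w) \<in> closure (D t) \<longrightarrow> ext z w t = G (pt5 z w t))))" ..
  have cover: "Fr \<subseteq> (\<Union>b\<in>Fr. ball b (rr b / 2))" using rr by force
  obtain T where T: "T \<subseteq> Fr" "finite T" "Fr \<subseteq> (\<Union>b\<in>T. ball b (rr b / 2))"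
    using compactE_image[OF Fr(1) _ cover] by blast
  have Tne: "T \<noteq> {}" using T(3) Fr(3) by auto
  define r where "r = Min (rr ` T)"
  have r: "r > 0" "\<And>b. b \<in> T \<Longrightarrow> r \<le> rr b" using T Tne rr by (auto simp: r_def)
  define M where "M = (\<Sum>b\<in>T. MM b)"
  have M: "MM b \<le> M" if "b \<in> T" for b
    unfolding M_def by (rule member_le_sum[OF that]) (use MM T in auto)
  have w1F: "w1 \<notin> Fr" using wO O0(1) by (simp add: Fr_def frontier_def interior_open)
  define \<kappa> where "\<kappa> = min (r/4) (infdist w1 Fr / 2)"
  have dpos: "infdist w1 Fr > 0" using w1F Fr(2,3) infdist_pos_not_in_closed by blast
  have \<kappa>: "\<kappa> > 0" "\<kappa> \<le> r/4" "\<kappa> < infdist w1 Fr" using r dpos by (auto simp: \<kappa>_def)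
  define \<Omega> where "\<Omega> = O0 \<inter> {w. \<kappa> < infdist w Fr}"
  have op: "open \<Omega>" unfolding \<Omega>_def
    by (intro open_Int O0 open_Collect_less continuous_on_const continuous_on_infdist continuous_on_id)
  have bdd: "bounded \<Omega>" using O0(2) bounded_subset by (auto simp: \<Omega>_def)
  have w1\<Omega>: "w1 \<in> \<Omega>" using wO \<kappa> by (simp add: \<Omega>_def)
  have clO: "closure \<Omega> \<subseteq> {w. \<kappa> \<le> infdist w Fr}"
  proof (rule closure_minimal)
    show "closed {w. \<kappa> \<le> infdist w Fr}"
      by (intro closed_Collect_le continuous_on_const continuous_on_infdist continuous_on_id)
  qed (auto simp: \<Omega>_def)
  have clin: "c \<in> O0" if c: "c \<in> closure \<Omega>" for c
  proof (rule ccontr)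
    assume "c \<notin> O0"
    moreover have "c \<in> closure O0" using c closure_mono[of \<Omega> O0] by (auto simp: \<Omega>_def)
    ultimately have "c \<in> Fr" using O0(1) by (simp add: Fr_def frontier_def interior_open)
    then show False using clO c \<kappa>(1) by force
  qed
  have frO: "infdist c Fr = \<kappa>" if c: "c \<in> frontier \<Omega>" for c
  proof -
    have cc: "c \<in> closure \<Omega>" "c \<notin> \<Omega>" using c op by (auto simp: frontier_def interior_open)
    then show ?thesis using clO clin[OF cc(1)] by (force simp: \<Omega>_def)
  qed
  \<comment> \<open>for small \<open>s\<close> the moved closure of \<open>\<Omega>\<close> stays in the domain\<close>
  have cpt: "compact (closure \<Omega>)" using bdd by (simp add: compact_closure)
  have "\<forall>c\<in>closure \<Omega>. \<exists>\<eta>>0. \<forall>q t. dist q (z0, c) < \<eta> \<longrightarrow> \<bar>t - t0\<bar> < \<eta> \<longrightarrow> \<bar>t\<bar> < \<delta> \<and> q \<in> D t"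
    using inside_open[OF t0] clin by (simp add: O0_def slice_def)
  from bchoice[OF this] obtain \<eta> where \<eta>: "\<forall>c\<in>closure \<Omega>. \<eta> c > 0 \<and>
      (\<forall>q t. dist q (z0, c) < \<eta> c \<longrightarrow> \<bar>t - t0\<bar> < \<eta> c \<longrightarrow> \<bar>t\<bar> < \<delta> \<and> q \<in> D t)" ..
  have cover2: "closure \<Omega> \<subseteq> (\<Union>c\<in>closure \<Omega>. ball c (\<eta> c / 2))" using \<eta> by force
  obtain T2 where T2: "T2 \<subseteq> closure \<Omega>" "finite T2" "closure \<Omega> \<subseteq> (\<Union>c\<in>T2. ball c (\<eta> c / 2))"
    using compactE_image[OF cpt _ cover2] by blast
  have "w1 \<in> closure \<Omega>" using w1\<Omega> closure_subset by blast
  then have T2ne: "T2 \<noteq> {}" using T2(3) by auto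
  define m where "m = Min (\<eta> ` T2)"
  have m: "m > 0" "\<And>c. c \<in> T2 \<Longrightarrow> m \<le> \<eta> c" using T2 T2ne \<eta> by (auto simp: m_def)
  define e where "e = min (m / 4 / N) (r / 4 / N)"
  have e: "e > 0" "e \<le> m / 4 / N" "e \<le> r / 4 / N" using m r N by (auto simp: e_def)
  have moved: "\<bar>t0 + s * \<tau>\<bar> < \<delta> \<and> (z0 + of_real s * \<zeta>, c + of_real s * \<omega>) \<in> D (t0 + s * \<tau>)"
    if s: "\<bar>s\<bar> < e" and c: "c \<in> closure \<Omega>" for s c
  proof -
    obtain c' where c': "c' \<in> T2" "dist c' c < \<eta> c' / 2" using T2(3) c by auto
    have sm: "norm (complex_of_real s) < m / 4 / N" using s e by simp
    have 1: "norm (of_real s * \<zeta>) < m/4" "norm (of_real s * \<omega>) < m/4" "norm (complex_of_real s * of_real \<tau>) < m/4"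
      using small[OF sm] N by simp_all
    have "dist (z0 + of_real s * \<zeta>, c + of_real s * \<omega>) (z0, c')
       \<le> dist (z0 + of_real s * \<zeta>) z0 + dist (c + of_real s * \<omega>) c'"
      unfolding dist_Pair_Pair by (rule sqrt_sum_squares_le_sum) simp_all
    also have "dist (c + of_real s * \<omega>) c' \<le> dist c' c + norm (of_real s * \<omega>)"
      using norm_triangle_ineq[of "c - c'" "of_real s * \<omega>"] by (simp add: dist_norm norm_minus_commute algebra_simps)
    also have "dist (z0 + of_real s * \<zeta>) z0 = norm (of_real s * \<zeta>)" by (simp add: dist_norm)
    also have "norm (of_real s * \<zeta>) + (dist c' c + norm (of_real s * \<omega>)) < \<eta> c'"
      using 1 c'(2) m(2)[OF c'(1)] by linarith
    finally have d: "dist (z0 + of_real s * \<zeta>, c + of_real s * \<omega>) (z0, c') < \<eta> c'" by simp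
    have "\<bar>(t0 + s * \<tau>) - t0\<bar> < \<eta> c'"
      using 1(3) m(2)[OF c'(1)] m(1) by (simp add: norm_mult abs_mult)
    then show ?thesis using \<eta> T2(1) c'(1) d by blast
  qed
  define F where "F = (\<lambda>s c. ext (z0 + of_real s * \<zeta>) (c + of_real s * \<omega>) (t0 + s * \<tau>))"
  have Fhol: "\<exists>U. open U \<and> closure \<Omega> \<subseteq> U \<and> F s holomorphic_on U" if s: "\<bar>s\<bar> < e" for s
  proof -
    define U where "U = (\<lambda>c. c + of_real s * \<omega>) -` slice (z0 + of_real s * \<zeta>) (t0 + s * \<tau>)"
    have t': "\<bar>t0 + s * \<tau>\<bar> < \<delta>" using moved[OF s \<open>w1 \<in> closure \<Omega>\<close>] by blast
    have ne': "slice (z0 + of_real s * \<zeta>) (t0 + s * \<tau>) \<noteq> {}"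
      using moved[OF s \<open>w1 \<in> closure \<Omega>\<close>] by (auto simp: slice_def)
    have "open U" unfolding U_def by (intro open_vimage slice_open t' continuous_intros)
    moreover have "closure \<Omega> \<subseteq> U" using moved[OF s] by (auto simp: U_def slice_def)
    moreover have "F s holomorphic_on U"
    proof -
      have "((\<lambda>w. ext (z0 + of_real s * \<zeta>) w (t0 + s * \<tau>)) \<circ> (\<lambda>c. c + of_real s * \<omega>)) holomorphic_on U"
        by (rule holomorphic_on_compose_gen[OF _ ext_props(2)[OF t' ne']])
           (auto intro!: holomorphic_intros simp: U_def)
      then show ?thesis by (simp add: F_def o_def)
    qed
    ultimately show ?thesis by blast
  qed
  have "\<exists>\<alpha>. (\<forall>k. continuous_on (closure \<Omega>) (\<alpha> k) \<and> \<alpha> k holomorphic_on \<Omega>) \<and>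
           (\<forall>k. \<forall>c\<in>closure \<Omega>. norm (\<alpha> k c) \<le> M / (e/2) ^ k) \<and>
           (\<forall>s. \<forall>c\<in>closure \<Omega>. \<bar>s\<bar> \<le> e/4 \<longrightarrow> (\<lambda>k. \<alpha> k c * of_real s ^ k) sums F s c)"
  proof (rule power_series_from_frontier[OF op bdd e(1)])
    show "continuous_on (closure \<Omega>) (F s)" if "\<bar>s\<bar> < e" for s
      using Fhol[OF that] holomorphic_on_imp_continuous_on continuous_on_subset by blast
    show "F s holomorphic_on \<Omega>" if "\<bar>s\<bar> < e" for s
      using Fhol[OF that] closure_subset by (meson holomorphic_on_subset order_trans)
    fix c assume c: "c \<in> frontier \<Omega>"
    obtain b where b: "b \<in> Fr" "dist c b = \<kappa>" using infdist_attains_inf[OF Fr(2,3), of c] frO[OF c] by metis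
    obtain b' where b': "b' \<in> T" "dist b' b < rr b' / 2" using T(3) b(1) by auto
    have b'F: "b' \<in> Fr" using T b' by blast
    obtain G where G: "curve_holomorphic G J (pt5 z0 b' t0) (rr b') (MM b')"
      "\<And>z w t. dist z z0 < rr b' \<Longrightarrow> dist w b' < rr b' \<Longrightarrow> \<bar>t - t0\<bar> < rr b' \<Longrightarrow>
              (z, w) \<in> closure (D t) \<Longrightarrow> ext z w t = G (pt5 z w t)" using MM b'F by blast
    have rb: "r \<le> rr b'" "rr b' > 0" using r b' rr b'F by auto
    have cb: "dist c b' < 3/4 * rr b'"
      using dist_triangle[of c b' b] b(2) b'(2) \<kappa>(2) rb by (simp add: dist_commute)
    define H where "H = (\<lambda>\<sigma>. G (vec5 (z0 + \<sigma> * \<zeta>) (cnj z0 + \<sigma> * cnj \<zeta>) (c + \<sigma> * \<omega>) (cnj c + \<sigma> * cnj \<omega>) (of_real t0 + \<sigma> * of_real \<tau>)))"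
    have inP: "vec5 (z0 + \<sigma> * \<zeta>) (cnj z0 + \<sigma> * cnj \<zeta>) (c + \<sigma> * \<omega>) (cnj c + \<sigma> * cnj \<omega>) (of_real t0 + \<sigma> * of_real \<tau>)
       \<in> polydisc J (pt5 z0 b' t0) (rr b')" if \<sigma>: "\<sigma> \<in> ball 0 e" for \<sigma>
    proof -
      have sm: "norm \<sigma> < r / 4 / N" using \<sigma> e by simp
      have 1: "norm (\<sigma> * \<zeta>) < r/4" "norm (\<sigma> * cnj \<zeta>) < r/4" "norm (\<sigma> * \<omega>) < r/4" "norm (\<sigma> * of_real \<tau>) < r/4"
        using small[OF sm] N by simp_all
      have "dist (c + \<sigma> * \<omega>) b' \<le> dist c b' + norm (\<sigma> * \<omega>)"
        using norm_triangle_ineq[of "c - b'" "\<sigma> * \<omega>"] by (simp add: dist_norm algebra_simps)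
      then have "dist (c + \<sigma> * \<omega>) b' < rr b'" using cb 1(3) rb by linarith
      then show ?thesis using 1 rb r unfolding polydisc_def J_def
        by (auto simp: pt5_def vec5_def dist_norm)
    qed
    show "\<exists>H. H holomorphic_on ball 0 e \<and> (\<forall>z\<in>ball 0 e. norm (H z) \<le> M) \<and> (\<forall>s. \<bar>s\<bar> < e \<longrightarrow> H (of_real s) = F s c)"
    proof (intro exI[of _ H] conjI ballI allI impI)
      show "H holomorphic_on ball 0 e" unfolding H_def
      proof (rule curve_holomorphic_along[OF G(1) open_ball _ inP])
        fix b assume "b \<in> J"
        then show "(\<lambda>\<sigma>. vec5 (z0 + \<sigma> * \<zeta>) (cnj z0 + \<sigma> * cnj \<zeta>) (c + \<sigma> * \<omega>) (cnj c + \<sigma> * cnj \<omega>)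
            (of_real t0 + \<sigma> * of_real \<tau>) b) holomorphic_on ball 0 e"
          unfolding J_def by (auto simp: vec5_def intro!: holomorphic_intros)
      qed
      show "norm (H \<sigma>) \<le> M" if "\<sigma> \<in> ball 0 e" for \<sigma>
        unfolding H_def using curve_holomorphic_bound[OF G(1) inP[OF that]] M[OF b'(1)] by linarith
      fix s :: real assume s: "\<bar>s\<bar> < e"
      have ccl: "c \<in> closure \<Omega>" using c by (simp add: frontier_def)
      have sb: "of_real s \<in> ball (0::complex) e" using s by simp
      have pt: "vec5 (z0 + of_real s * \<zeta>) (cnj z0 + of_real s * cnj \<zeta>) (c + of_real s * \<omega>) (cnj c + of_real s * cnj \<omega>)
          (of_real t0 + of_real s * of_real \<tau>) = pt5 (z0 + of_real s * \<zeta>) (c + of_real s * \<omega>) (t0 + s * \<tau>)"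
        by (simp add: pt5_def)
      note P = inP[OF sb, unfolded pt]
      have "dist (z0 + of_real s * \<zeta>) z0 < rr b'" "dist (c + of_real s * \<omega>) b' < rr b'" "\<bar>t0 + s * \<tau> - t0\<bar> < rr b'"
        using bspec[OF P[unfolded polydisc_def, simplified], of 0] bspec[OF P[unfolded polydisc_def, simplified], of 2]
          bspec[OF P[unfolded polydisc_def, simplified], of 4]
        by (simp_all add: J_def pt5_def vec5_def dist_norm norm_mult abs_mult)
      from G(2)[OF this] have "ext (z0 + of_real s * \<zeta>) (c + of_real s * \<omega>) (t0 + s * \<tau>)
          = G (pt5 (z0 + of_real s * \<zeta>) (c + of_real s * \<omega>) (t0 + s * \<tau>))"
        using moved[OF s ccl] closure_subset by blast
      then show "H (of_real s) = F s c" by (simp add: H_def F_def pt)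
    qed
  qed
  then obtain \<alpha> where \<alpha>: "\<And>k. \<alpha> k holomorphic_on \<Omega>"
    "\<And>s c. c \<in> closure \<Omega> \<Longrightarrow> \<bar>s\<bar> \<le> e/4 \<Longrightarrow> (\<lambda>k. \<alpha> k c * of_real s ^ k) sums F s c" by blast
  have sums: "\<forall>c\<in>\<Omega>. \<forall>s::real. \<bar>s\<bar> < e/4 \<longrightarrow>
        (\<lambda>k. \<alpha> k c * of_real s ^ k) sums ext (z0 + of_real s * \<zeta>) (c + of_real s * \<omega>) (t0 + s * \<tau>)"
    using \<alpha>(2) closure_subset unfolding F_def by (meson less_imp_le subsetD)
  show ?thesis
    by (rule exI[of _ \<Omega>], rule exI[of _ "e/4"], rule exI[of _ \<alpha>]) (use op w1\<Omega> e(1) \<alpha>(1) sums in simp)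
qed

end

section \<open>Exchange of the variables and Taylor coefficients in time\<close>

lemma mem_swap_image: "(a, b) \<in> prod.swap ` S \<longleftrightarrow> (b, a) \<in> S"
proof
  assume "(b, a) \<in> S"
  then have "prod.swap (b, a) \<in> prod.swap ` S" by (rule imageI)
  then show "(a, b) \<in> prod.swap ` S" by simp
qed auto

lemma linear_swap: "linear (prod.swap :: complex \<times> complex \<Rightarrow> complex \<times> complex)"
  by (rule linearI) auto

lemma closure_swap: "closure (prod.swap ` S) = prod.swap ` closure S" for S :: "(complex \<times> complex) set"
  using closure_injective_linear_image[OF linear_swap inj_swap] by metis

lemma frontier_swap: "frontier (prod.swap ` S) = prod.swap ` frontier S" for S :: "(complex \<times> complex) set"
proof -
  have "interior (prod.swap ` S) = prod.swap ` interior S"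
    using interior_injective_linear_image[OF linear_swap inj_swap] by metis
  then show ?thesis unfolding frontier_def closure_swap by (simp add: image_set_diff)
qed

lemma locally_complexified_swap:
  assumes "locally_complexified \<delta> D f z0 w0 t0"
  shows "locally_complexified \<delta> (\<lambda>t. prod.swap ` D t) (\<lambda>t. f t \<circ> prod.swap) w0 z0 t0"
proof -
  obtain r M N \<rho> g v1 v2 where r: "r > 0" and \<rho>: "curve_holomorphic \<rho> {..<5} (pt5 z0 w0 t0) r M"
    and g: "curve_holomorphic g {..<5} (pt5 z0 w0 t0) r N"
    and pts: "\<And>z w t. dist z z0 < r \<Longrightarrow> dist w w0 < r \<Longrightarrow> \<bar>t - t0\<bar> < r \<Longrightarrow> \<bar>t\<bar> < \<delta> \<and>
           Im (\<rho> (pt5 z w t)) = 0 \<and> ((z, w) \<in> frontier (D t) \<longleftrightarrow> \<rho> (pt5 z w t) = 0) \<and> g (pt5 z w t) = f t (z, w)"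
    and nz: "Re (dirderiv \<rho> (pt5 z0 w0 t0) (vec5 v1 (cnj v1) v2 (cnj v2) 0)) \<noteq> 0"
    using assms unfolding locally_complexified_def by blast
  define P where "P = (\<lambda>x::nat \<Rightarrow> complex. vec5 (x 2) (x 3) (x 0) (x 1) (x 4))"
  have Ppt: "P (pt5 w z t) = pt5 z w t" for z w t by (simp add: P_def pt5_def vec5_def)
  have comp: "curve_holomorphic (\<lambda>x. \<phi> (P x)) {..<5} (pt5 w0 z0 t0) r K"
    if "curve_holomorphic \<phi> {..<5} (pt5 z0 w0 t0) r K" for \<phi> K
  proof (rule curve_holomorphic_compose[OF that])
    fix b assume "b \<in> {..<5::nat}"
    then show "\<exists>N. curve_holomorphic (\<lambda>x. P x b) {..<5} (pt5 w0 z0 t0) r N"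
      unfolding lessThan_5[symmetric]
      using curve_holomorphic_coordinate[of "{..<5::nat}" _ r "pt5 w0 z0 t0"] r
      by (auto simp: lessThan_5 P_def vec5_def)
  next
    fix x assume "x \<in> polydisc {..<5} (pt5 w0 z0 t0) r"
    then show "P x \<in> polydisc {..<5} (pt5 z0 w0 t0) r"
      unfolding polydisc_def lessThan_5 by (simp add: P_def pt5_def vec5_def)
  qed
  have dd: "dirderiv (\<lambda>x. \<rho> (P x)) (pt5 w0 z0 t0) (vec5 v2 (cnj v2) v1 (cnj v1) 0)
      = dirderiv \<rho> (pt5 z0 w0 t0) (vec5 v1 (cnj v1) v2 (cnj v2) 0)"
  proof -
    have "P (\<lambda>b. pt5 w0 z0 t0 b + u * vec5 v2 (cnj v2) v1 (cnj v1) 0 b)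
       = (\<lambda>b. pt5 z0 w0 t0 b + u * vec5 v1 (cnj v1) v2 (cnj v2) 0 b)" for u
      by (auto simp: P_def pt5_def vec5_def fun_eq_iff)
    then show ?thesis by (simp add: dirderiv_def)
  qed
  have "\<bar>t\<bar> < \<delta> \<and> Im (\<rho> (P (pt5 w z t))) = 0 \<and> ((w, z) \<in> frontier (prod.swap ` D t) \<longleftrightarrow> \<rho> (P (pt5 w z t)) = 0) \<and>
           g (P (pt5 w z t)) = (f t \<circ> prod.swap) (w, z)"
    if "dist w w0 < r" "dist z z0 < r" "\<bar>t - t0\<bar> < r" for w z t
    using pts[OF that(2,1,3)] by (simp add: Ppt frontier_swap mem_swap_image)
  then show ?thesis unfolding locally_complexified_def
    using r comp[OF \<rho>] comp[OF g] nz[folded dd] by blast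
qed

lemma CRH_function_swap:
  assumes "CRH_function D f"
  shows "CRH_function (prod.swap ` D) (f \<circ> prod.swap)"
proof -
  have 1: "continuous_on (frontier D) f"
    and 2: "\<And>c. {w. (c, w) \<in> D} \<noteq> {} \<Longrightarrow>
        (\<exists>g. continuous_on {w. (c, w) \<in> closure D} g \<and> g holomorphic_on {w. (c, w) \<in> D} \<and>
             (\<forall>w. (c, w) \<in> frontier D \<longrightarrow> g w = f (c, w)))"
    and 3: "\<And>c. {z. (z, c) \<in> D} \<noteq> {} \<Longrightarrow>
        (\<exists>g. continuous_on {z. (z, c) \<in> closure D} g \<and> g holomorphic_on {z. (z, c) \<in> D} \<and>
             (\<forall>z. (z, c) \<in> frontier D \<longrightarrow> g z = f (z, c)))"
    using assms unfolding CRH_function_def by blast+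
  have "continuous_on (frontier (prod.swap ` D)) (f \<circ> prod.swap)"
    unfolding frontier_swap
    by (intro continuous_on_compose continuous_on_subset[OF 1] continuous_on_swap) (auto simp: image_image)
  then show ?thesis unfolding CRH_function_def
    using 2 3 by (simp add: mem_swap_image closure_swap frontier_swap)
qed

lemma dist_swap: "dist (prod.swap a) (prod.swap b) = dist a b" for a b :: "complex \<times> complex"
  by (cases a; cases b) (simp add: dist_Pair_Pair add.commute)

lemma hartogs_family_swap:
  assumes "hartogs_family \<delta> D f"
  shows "hartogs_family \<delta> (\<lambda>t. prod.swap ` D t) (\<lambda>t. f t \<circ> prod.swap)"
proof -
  interpret hartogs_family \<delta> D f by (rule assms)
  show ?thesis
  proof
    fix t :: real assume t: "\<bar>t\<bar> < \<delta>"
    show "bounded (prod.swap ` D t) \<and> open (prod.swap ` D t) \<and> convex (prod.swap ` D t) \<and> prod.swap ` D t \<noteq> {}"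
      using domain[OF t] bounded_linear_image[of "D t" prod.swap] linear_swap convex_linear_image[OF linear_swap]
        open_surjective_linear_image[of "D t" prod.swap] linear_conv_bounded_linear[of prod.swap]
      by (auto simp: surj_swap)
    show "CRH_function (prod.swap ` D t) (f t \<circ> prod.swap)" by (rule CRH_function_swap[OF CRH[OF t]])
  next
    fix t z w assume "\<bar>t\<bar> < \<delta>" "(z, w) \<in> frontier (prod.swap ` D t)"
    then show "locally_complexified \<delta> (\<lambda>t. prod.swap ` D t) (\<lambda>t. f t \<circ> prod.swap) z w t"
      using complexified[of t w z] locally_complexified_swap by (simp add: frontier_swap mem_swap_image)
  next
    fix t e :: real assume te: "\<bar>t\<bar> < \<delta>" "e > 0"
    show "\<exists>\<eta>>0. \<forall>t'. \<bar>t' - t\<bar> < \<eta> \<longrightarrow> \<bar>t'\<bar> < \<delta> \<and>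
           (\<forall>y\<in>frontier (prod.swap ` D t'). \<exists>y'\<in>frontier (prod.swap ` D t). dist y y' < e) \<and>
           (\<forall>y\<in>frontier (prod.swap ` D t). \<exists>y'\<in>frontier (prod.swap ` D t'). dist y y' < e)"
      using frontier_near[OF te] by (simp add: frontier_swap dist_swap)
  qed
qed

lemma holomorphic2_slices:
  assumes F: "holomorphic2_on F D" and D: "open D"
  shows "(\<lambda>w. F (z, w)) holomorphic_on {w. (z, w) \<in> D}" and "(\<lambda>z. F (z, w)) holomorphic_on {z. (z, w) \<in> D}"
proof -
  have d: "\<exists>a b. (F has_derivative (\<lambda>(u, v). a * u + b * v)) (at p)" if "p \<in> D" for p
    using F that at_within_open[OF that D] unfolding holomorphic2_on_def by metis
  show "(\<lambda>w. F (z, w)) holomorphic_on {w. (z, w) \<in> D}" unfolding holomorphic_on_def field_differentiable_def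
  proof
    fix w assume "w \<in> {w. (z, w) \<in> D}"
    then obtain a b where ab: "(F has_derivative (\<lambda>(u, v). a * u + b * v)) (at (z, w))" using d by blast
    have "((\<lambda>w. (z, w)) has_derivative (\<lambda>v. (0, v))) (at w)"
      by (intro has_derivative_Pair has_derivative_const has_derivative_ident)
    from has_derivative_compose[OF this ab] have "((\<lambda>w. F (z, w)) has_field_derivative b) (at w)"
      by (simp add: has_field_derivative_def)
    then show "\<exists>f'. ((\<lambda>w. F (z, w)) has_field_derivative f') (at w within {w. (z, w) \<in> D})"
      using has_field_derivative_at_within by blast
  qed
  show "(\<lambda>z. F (z, w)) holomorphic_on {z. (z, w) \<in> D}" unfolding holomorphic_on_def field_differentiable_def
  proof
    fix z assume "z \<in> {z. (z, w) \<in> D}"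
    then obtain a b where ab: "(F has_derivative (\<lambda>(u, v). a * u + b * v)) (at (z, w))" using d by blast
    have "((\<lambda>z. (z, w)) has_derivative (\<lambda>u. (u, 0))) (at z)"
      by (intro has_derivative_Pair has_derivative_const has_derivative_ident)
    from has_derivative_compose[OF this ab] have "((\<lambda>z. F (z, w)) has_field_derivative a) (at z)"
      by (simp add: has_field_derivative_def)
    then show "\<exists>f'. ((\<lambda>z. F (z, w)) has_field_derivative f') (at z within {z. (z, w) \<in> D})"
      using has_field_derivative_at_within by blast
  qed
qed

definition param_coef :: "((nat \<Rightarrow> complex) \<Rightarrow> complex) \<Rightarrow> nat \<Rightarrow> complex \<times> complex \<Rightarrow> complex" where
  "param_coef G k y = (deriv ^^ k) (\<lambda>\<sigma>. G (vec5 (fst y) (cnj (fst y)) (snd y) (cnj (snd y)) \<sigma>)) 0 / fact k"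

context hartogs_family
begin

definition coef :: "nat \<Rightarrow> complex \<times> complex \<Rightarrow> complex" where
  "coef k y = (SOME a. has_series (\<lambda>s. ext (fst y) (snd y) s) a) k"

text \<open>On the boundary the value is meaningful at points whose slice is nonempty, where the limit exists.\<close>

definition bcoef :: "nat \<Rightarrow> complex \<times> complex \<Rightarrow> complex" where
  "bcoef k y = (if y \<in> D 0 then coef k y else Lim (at y within D 0) (coef k))"

lemma ext_time_series:
  assumes \<delta>: "\<delta> > 0" and y: "(z, w) \<in> D 0"
  shows "\<exists>\<Omega> \<alpha>. open \<Omega> \<and> w \<in> \<Omega> \<and> (\<forall>k. \<alpha> k holomorphic_on \<Omega>) \<and> (\<forall>c\<in>\<Omega>. has_series (\<lambda>s. ext z c s) (\<lambda>k. \<alpha> k c))"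
proof -
  have "\<bar>0\<bar> < \<delta>" using \<delta> by simp
  from ext_line_series[OF this y, of 0 0 1] obtain \<Omega> e \<alpha> where *: "open \<Omega>" "w \<in> \<Omega>" "e > 0" "\<forall>k. \<alpha> k holomorphic_on \<Omega>"
    "\<forall>c\<in>\<Omega>. \<forall>s::real. \<bar>s\<bar> < e \<longrightarrow> (\<lambda>k. \<alpha> k c * of_real s ^ k) sums ext z c s" by auto
  have "has_series (\<lambda>s. ext z c s) (\<lambda>k. \<alpha> k c)" if "c \<in> \<Omega>" for c
    using *(5) that by (intro has_seriesI[OF *(3)]) simp
  then show ?thesis using * by blast
qed

lemma coef_series:
  assumes \<delta>: "\<delta> > 0" and y: "y \<in> D 0"
  shows "has_series (\<lambda>s. ext (fst y) (snd y) s) (\<lambda>k. coef k y)"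
proof -
  have "(fst y, snd y) \<in> D 0" using y by simp
  from ext_time_series[OF \<delta> this] have "\<exists>a. has_series (\<lambda>s. ext (fst y) (snd y) s) a" by blast
  from someI_ex[OF this] show ?thesis unfolding coef_def .
qed

lemma coef_holomorphic:
  assumes \<delta>: "\<delta> > 0"
  shows "(\<lambda>w. coef k (z, w)) holomorphic_on slice z 0"
  unfolding holomorphic_on_def field_differentiable_def
proof
  fix w assume w: "w \<in> slice z 0"
  then have y: "(z, w) \<in> D 0" by (simp add: slice_def)
  obtain \<Omega> \<alpha> where *: "open \<Omega>" "w \<in> \<Omega>" "\<And>k. \<alpha> k holomorphic_on \<Omega>"
    "\<And>c. c \<in> \<Omega> \<Longrightarrow> has_series (\<lambda>s. ext z c s) (\<lambda>k. \<alpha> k c)" using ext_time_series[OF \<delta> y] by blast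
  have op: "open (\<Omega> \<inter> slice z 0)" using *(1) slice_open[of 0 z] \<delta> by auto
  have eq: "\<alpha> k c = coef k (z, c)" if "c \<in> \<Omega> \<inter> slice z 0" for c
  proof -
    have "(\<lambda>k. \<alpha> k c) = (\<lambda>k. coef k (z, c))"
      by (rule has_series_unique[OF *(4) coef_series[OF \<delta>, of "(z, c)"] zero_less_one])
         (use that in \<open>auto simp: slice_def\<close>)
    then show ?thesis by meson
  qed
  have "(\<alpha> k has_field_derivative deriv (\<alpha> k) w) (at w)" by (rule holomorphic_derivI[OF *(3,1,2)])
  then have "((\<lambda>w. coef k (z, w)) has_field_derivative deriv (\<alpha> k) w) (at w)"
    by (rule has_field_derivative_transform_within_open[OF _ op]) (use * w eq in auto)
  then show "\<exists>f'. ((\<lambda>w. coef k (z, w)) has_field_derivative f') (at w within slice z 0)"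
    using has_field_derivative_at_within by blast
qed

text \<open>Inside the domain the coefficient is the Taylor coefficient of the local function \<open>G\<close> of
  \<open>ext_across_boundary\<close>, which is continuous across the boundary.\<close>

lemma bcoef_near_boundary:
  assumes \<delta>: "\<delta> > 0" and p: "(z0, w0) \<in> frontier (D 0)" and ne: "slice z0 0 \<noteq> {}"
  shows "\<exists>r>0. \<exists>M G. curve_holomorphic G {0, 1, 2, 4} (pt5 z0 w0 0) r M \<and>
           (\<forall>z w t. dist z z0 < r \<longrightarrow> dist w w0 < r \<longrightarrow> \<bar>t\<bar> < r \<longrightarrow>
              \<bar>t\<bar> < \<delta> \<and> slice z t \<noteq> {} \<and> ((z, w) \<in> closure (D t) \<longrightarrow> ext z w t = G (pt5 z w t))) \<and>
           (\<forall>k. continuous_on (ball z0 (r/2) \<times> ball w0 (r/2)) (param_coef G k)) \<and>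
           (\<forall>k. \<forall>y\<in>ball z0 (r/2) \<times> ball w0 (r/2). y \<in> closure (D 0) \<longrightarrow> bcoef k y = param_coef G k y)"
proof -
  have t0: "\<bar>0\<bar> < \<delta>" using \<delta> by simp
  obtain r M G where r: "r > 0" and G: "curve_holomorphic G {0, 1, 2, 4} (pt5 z0 w0 0) r M"
    and ext: "\<And>z w t. dist z z0 < r \<Longrightarrow> dist w w0 < r \<Longrightarrow> \<bar>t\<bar> < r \<Longrightarrow>
              \<bar>t\<bar> < \<delta> \<and> slice z t \<noteq> {} \<and> ((z, w) \<in> closure (D t) \<longrightarrow> ext z w t = G (pt5 z w t))"
    using ext_across_boundary[OF t0 p ne] by auto
  define B where "B = ball z0 (r/2) \<times> ball w0 (r/2)"
  have J: "{0, 1, 2, 4::nat} \<subseteq> {..<5}" by auto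
  have opB: "open B" by (simp add: B_def open_Times)
  note A = parameter_Taylor_coefficient_continuous[OF G r J, folded param_coef_def, folded B_def]
  have inside: "coef k y = param_coef G k y" if yB: "y \<in> B" and yD: "y \<in> D 0" for k y
  proof -
    obtain \<eta> where \<eta>: "\<eta> > 0" "\<And>q t. dist q y < \<eta> \<Longrightarrow> \<bar>t\<bar> < \<eta> \<Longrightarrow> q \<in> D t"
      using inside_open[OF t0 yD] by auto
    have "(\<lambda>k. coef k y) = (\<lambda>k. param_coef G k y)"
    proof (rule has_series_unique[OF coef_series[OF \<delta> yD] A(3)[OF yB], of "min \<eta> r"])
      fix s :: real assume s: "\<bar>s\<bar> < min \<eta> r"
      have "y \<in> D s" using \<eta>(2)[of y s] \<eta>(1) s by simp
      then have "(fst y, snd y) \<in> closure (D s)" using closure_subset by auto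
      moreover have "dist (fst y) z0 < r" "dist (snd y) w0 < r"
        using yB r unfolding B_def by (auto simp: dist_commute)
      ultimately show "ext (fst y) (snd y) s = G (pt5 (fst y) (snd y) s)"
        using ext[of "fst y" "snd y" s] s by simp
    qed (use \<eta> r in simp)
    then show ?thesis by meson
  qed
  have "bcoef k y = param_coef G k y" if yB: "y \<in> B" and yc: "y \<in> closure (D 0)" for k y
  proof (cases "y \<in> D 0")
    case True then show ?thesis using inside[OF yB] by (simp add: bcoef_def)
  next
    case False
    have nt: "at y within D 0 \<noteq> bot"
      using yc False by (auto simp: trivial_limit_within closure_def)
    have "isCont (param_coef G k) y"
      using A(1)[of k] opB yB continuous_on_eq_continuous_at by blast
    then have "(param_coef G k \<longlongrightarrow> param_coef G k y) (at y within D 0)"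
      unfolding isCont_def using tendsto_within_subset by blast
    then have "(coef k \<longlongrightarrow> param_coef G k y) (at y within D 0)"
    proof (rule Lim_transform_eventually)
      have "\<forall>\<^sub>F x in at y within D 0. x \<in> D 0 \<and> x \<in> B"
        unfolding eventually_at_topological using opB yB by blast
      then show "\<forall>\<^sub>F x in at y within D 0. param_coef G k x = coef k x"
        by (rule eventually_mono) (use inside in auto)
    qed
    then show ?thesis using tendsto_Lim[OF nt] False by (simp add: bcoef_def)
  qed
  then show ?thesis using r G ext A(1) unfolding B_def by blast
qed

lemma bcoef_slice:
  assumes \<delta>: "\<delta> > 0" and ne: "slice z 0 \<noteq> {}"
  shows "continuous_on (closure (slice z 0)) (\<lambda>w. bcoef k (z, w))" and "(\<lambda>w. bcoef k (z, w)) holomorphic_on slice z 0"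
proof -
  have t0: "\<bar>0\<bar> < \<delta>" using \<delta> by simp
  show hol: "(\<lambda>w. bcoef k (z, w)) holomorphic_on slice z 0"
    using coef_holomorphic[OF \<delta>, of k z] by (rule holomorphic_transform) (simp add: bcoef_def slice_def)
  show "continuous_on (closure (slice z 0)) (\<lambda>w. bcoef k (z, w))"
    unfolding continuous_on_eq_continuous_within
  proof
    fix w assume w: "w \<in> closure (slice z 0)"
    show "continuous (at w within closure (slice z 0)) (\<lambda>w. bcoef k (z, w))"
    proof (cases "w \<in> slice z 0")
      case True
      then show ?thesis using holomorphic_on_imp_continuous_on[OF hol] slice_open[OF t0, of z]
          continuous_on_eq_continuous_at continuous_at_imp_continuous_within by blast
    next
      case False
      then have "w \<in> frontier (slice z 0)" using w slice_open[OF t0, of z] by (simp add: frontier_def interior_open)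
      then have p: "(z, w) \<in> frontier (D 0)" using slice_frontier[OF t0 ne] by blast
      obtain r G where r: "r > 0" and c: "continuous_on (ball z (r/2) \<times> ball w (r/2)) (param_coef G k)"
        and eq: "\<And>y. y \<in> ball z (r/2) \<times> ball w (r/2) \<Longrightarrow> y \<in> closure (D 0) \<Longrightarrow> bcoef k y = param_coef G k y"
        using bcoef_near_boundary[OF \<delta> p ne] by blast
      have "continuous_on (ball w (r/2)) (\<lambda>x. param_coef G k (z, x))"
        by (rule continuous_on_compose2[OF c]) (use r in \<open>auto intro!: continuous_intros\<close>)
      then have "isCont (\<lambda>x. param_coef G k (z, x)) w"
        using r by (simp add: continuous_on_eq_continuous_at)
      then have "continuous (at w within closure (slice z 0)) (\<lambda>x. param_coef G k (z, x))"
        by (rule continuous_at_imp_continuous_within)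
      then show ?thesis
      proof (rule continuous_transform_within[OF _ half_gt_zero[OF r] w])
        fix x assume x: "x \<in> closure (slice z 0)" "dist x w < r/2"
        have "(z, x) \<in> closure (D 0)" using x(1) slice_closure[OF t0 ne] by blast
        then show "param_coef G k (z, x) = bcoef k (z, x)"
          using eq[of "(z, x)"] x r by (simp add: dist_commute)
      qed
    qed
  qed
qed

lemma ext_bounded:
  assumes t: "\<bar>t\<bar> < \<delta>"
  shows "\<exists>M. \<forall>z w. (z, w) \<in> D t \<longrightarrow> norm (ext z w t) \<le> M"
proof -
  have "compact (frontier (D t))" using domain_props(1)[OF t] by (rule compact_frontier_bounded)
  moreover have "continuous_on (frontier (D t)) (f t)" using CRH[OF t] by (simp add: CRH_function_def)
  ultimately have "compact (f t ` frontier (D t))" by (rule compact_continuous_image[rotated])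
  then obtain M where M: "\<And>y. y \<in> frontier (D t) \<Longrightarrow> norm (f t y) \<le> M"
    using compact_imp_bounded bounded_iff by (metis imageI)
  have "norm (ext z w t) \<le> M" if y: "(z, w) \<in> D t" for z w
  proof -
    have w: "w \<in> slice z t" using y by (simp add: slice_def)
    then have ne: "slice z t \<noteq> {}" by auto
    show ?thesis
    proof (rule maximum_modulus_frontier[where S = "slice z t" and f = "\<lambda>w. ext z w t"])
      show "(\<lambda>w. ext z w t) holomorphic_on interior (slice z t)"
        using ext_props(2)[OF t ne] slice_open[OF t] by (simp add: interior_open)
      show "continuous_on (closure (slice z t)) (\<lambda>w. ext z w t)" by (rule ext_props(1)[OF t ne])
      show "bounded (slice z t)" by (rule slice_bounded[OF t])
      fix x assume x: "x \<in> frontier (slice z t)"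
      then have "(z, x) \<in> frontier (D t)" using slice_frontier[OF t ne] by blast
      then show "norm (ext z x t) \<le> M" using M ext_props(3)[OF t ne x] by simp
    qed (rule w)
  qed
  then show ?thesis by blast
qed

text \<open>Near the boundary point both \<open>ext\<close> inside and \<open>f t\<close> on the boundary are values of one continuous function.\<close>

lemma ext_continuous_boundary:
  assumes t: "\<bar>t\<bar> < \<delta>" and p: "(z0, w0) \<in> frontier (D t)" and ne: "slice z0 t \<noteq> {}"
    and F: "\<And>z w. (z, w) \<in> D t \<Longrightarrow> F (z, w) = ext z w t" "\<And>y. y \<in> frontier (D t) \<Longrightarrow> F y = f t y"
  shows "continuous (at (z0, w0) within closure (D t)) F"
proof -
  obtain r M G where r: "r > 0" and G: "curve_holomorphic G {0, 1, 2, 4} (pt5 z0 w0 t) r M"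
    and ext: "\<And>z w. dist z z0 < r \<Longrightarrow> dist w w0 < r \<Longrightarrow>
              slice z t \<noteq> {} \<and> ((z, w) \<in> closure (D t) \<longrightarrow> ext z w t = G (pt5 z w t))"
    using ext_across_boundary[OF t p ne] by force
  have J: "{0, 1, 2, 4::nat} \<subseteq> {..<5}" by auto
  have "continuous_on (ball z0 (r/2) \<times> ball w0 (r/2)) (\<lambda>y. G (pt5 (fst (fst (y, t))) (snd (fst (y, t))) (snd (y, t))))"
    by (rule continuous_on_compose2[OF pt5_continuous_on[OF G r J], where f = "\<lambda>y. (y, t)"])
       (use r in \<open>auto intro!: continuous_intros\<close>)
  then have "isCont (\<lambda>y. G (pt5 (fst y) (snd y) t)) (z0, w0)"
    using r by (simp add: continuous_on_eq_continuous_at open_Times)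
  then have "continuous (at (z0, w0) within closure (D t)) (\<lambda>y. G (pt5 (fst y) (snd y) t))"
    by (rule continuous_at_imp_continuous_within)
  then show ?thesis
  proof (rule continuous_transform_within[OF _ r])
    show "(z0, w0) \<in> closure (D t)" using p by (simp add: frontier_def)
    fix y assume y: "y \<in> closure (D t)" "dist y (z0, w0) < r"
    have near: "dist (fst y) z0 < r" "dist (snd y) w0 < r"
      using y(2) dist_fst_le[of y "(z0, w0)"] dist_snd_le[of y "(z0, w0)"] by auto
    have e: "slice (fst y) t \<noteq> {}" "ext (fst y) (snd y) t = G (pt5 (fst y) (snd y) t)" using ext[OF near] y(1) by auto
    show "G (pt5 (fst y) (snd y) t) = F y"
    proof (cases "y \<in> D t")
      case True then show ?thesis using F(1)[of "fst y" "snd y"] e by simp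
    next
      case False
      then have fr: "y \<in> frontier (D t)" using y(1) domain_props(2)[OF t] by (simp add: frontier_def interior_open)
      then have "ext (fst y) (snd y) t = f t y" using ext_props(4)[OF t e(1), of "snd y"] by simp
      then show ?thesis using F(2)[OF fr] e by simp
    qed
  qed
qed

end

section \<open>Agreement of the extensions in the two families of slices\<close>

locale hartogs_family_CR = hartogs_family +
  assumes delta_pos: "\<delta> > 0" and CR0: "CRH_eq_CR (D 0)"
    and normal_line: "\<And>p. p \<in> frontier (D 0) \<Longrightarrow> \<exists>n h. (\<forall>\<^sub>F s in at_right 0. p - s *\<^sub>R n \<in> D 0) \<and>
           (h \<longlongrightarrow> 0) (at 0) \<and> (\<forall>\<^sub>F t in at 0. p + h t *\<^sub>R n \<in> frontier (D t))"
begin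

interpretation sw: hartogs_family \<delta> "\<lambda>t. prod.swap ` D t" "\<lambda>t. f t \<circ> prod.swap"
  by (rule hartogs_family_swap) (rule hartogs_family_axioms)

lemma zero_in_range: "\<bar>0\<bar> < \<delta>"
  using delta_pos by simp

lemma sw_slice: "sw.slice w t = {z. (z, w) \<in> D t}"
  by (simp add: sw.slice_def mem_swap_image)

lemma transversal_cases:
  assumes "\<bar>t\<bar> < \<delta>" "(z, w) \<in> frontier (D t)"
  shows "slice z t \<noteq> {} \<or> sw.slice w t \<noteq> {}"
  using slice_nonempty_cases[OF assms] unfolding sw_slice .

text \<open>Both local functions \<open>G\<close> equal \<open>f t\<close> on the moving boundary, which the normal line through the given point
  meets at the parameter \<open>h t\<close>. Their difference on this line, as a function of the position on the line
  and of \<open>t\<close>, satisfies the assumptions of \<open>leading_coefficient_vanishes\<close>.\<close>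

lemma bcoef_agree_at_boundary:
  assumes p: "(z0, w0) \<in> frontier (D 0)" and ne: "slice z0 0 \<noteq> {}" and ne': "sw.slice w0 0 \<noteq> {}"
    and IH: "\<And>k z w. k < n \<Longrightarrow> (z, w) \<in> D 0 \<Longrightarrow> coef k (z, w) = sw.coef k (w, z)"
  shows "bcoef n (z0, w0) = sw.bcoef n (w0, z0)"
proof -
  define J where "J = {0, 1, 2, 4::nat}"
  obtain r M G where r: "r > 0" and G: "curve_holomorphic G J (pt5 z0 w0 0) r M"
    and ext: "\<And>z w t. dist z z0 < r \<Longrightarrow> dist w w0 < r \<Longrightarrow> \<bar>t\<bar> < r \<Longrightarrow>
              \<bar>t\<bar> < \<delta> \<and> slice z t \<noteq> {} \<and> ((z, w) \<in> closure (D t) \<longrightarrow> ext z w t = G (pt5 z w t))"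
    and eq: "\<And>k y. y \<in> ball z0 (r/2) \<times> ball w0 (r/2) \<Longrightarrow> y \<in> closure (D 0) \<Longrightarrow> bcoef k y = param_coef G k y"
    using bcoef_near_boundary[OF delta_pos p ne] unfolding J_def by blast
  have p': "(w0, z0) \<in> frontier (prod.swap ` D 0)" using p by (simp add: frontier_swap mem_swap_image)
  obtain r' M' G' where r': "r' > 0" and G': "curve_holomorphic G' J (pt5 w0 z0 0) r' M'"
    and ext': "\<And>w z t. dist w w0 < r' \<Longrightarrow> dist z z0 < r' \<Longrightarrow> \<bar>t\<bar> < r' \<Longrightarrow>
              \<bar>t\<bar> < \<delta> \<and> sw.slice w t \<noteq> {} \<and> ((w, z) \<in> closure (prod.swap ` D t) \<longrightarrow> sw.ext w z t = G' (pt5 w z t))"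
    and eq': "\<And>k y. y \<in> ball w0 (r'/2) \<times> ball z0 (r'/2) \<Longrightarrow> y \<in> closure (prod.swap ` D 0) \<Longrightarrow> sw.bcoef k y = param_coef G' k y"
    using sw.bcoef_near_boundary[OF delta_pos p' ne'] unfolding J_def by blast
  obtain m h where inw: "\<forall>\<^sub>F s in at_right 0. (z0, w0) - s *\<^sub>R m \<in> D 0" and h: "(h \<longlongrightarrow> 0) (at 0)"
    and hf: "\<forall>\<^sub>F t in at 0. (z0, w0) + h t *\<^sub>R m \<in> frontier (D t)"
    using normal_line[OF p] by blast
  obtain n1 n2 where m: "m = (n1, n2)" by (cases m)
  obtain b where b: "b > 0" "\<And>s. 0 < s \<Longrightarrow> s < b \<Longrightarrow> (z0, w0) - s *\<^sub>R m \<in> D 0"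
    using inw unfolding eventually_at_right_field by auto
  define N where "N = 1 + norm n1 + norm n2"
  have N: "N \<ge> 1" "norm n1 \<le> N" "norm n2 \<le> N" by (auto simp: N_def)
  define e where "e = min b (min r r' / 2 / N)"
  have e: "e > 0" "e \<le> b" "e \<le> min r r' / 2 / N" using b r r' N by (auto simp: e_def)
  have small: "norm (c * x) < min r r' / 2" if "norm c < e" "norm x \<le> N" for c x :: complex
  proof -
    have "norm c * norm x \<le> norm c * N" using that by (intro mult_left_mono) auto
    also have "\<dots> < e * N" using that N by (intro mult_strict_right_mono) auto
    also have "\<dots> \<le> min r r' / 2" using e(3) N by (simp add: pos_le_divide_eq)
    finally show ?thesis by (simp add: norm_mult)
  qed
  have en: "e \<le> min r r' / 2"
  proof -
    have "min r r' / 2 / N \<le> min r r' / 2 / 1" using N r r' by (intro divide_left_mono) auto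
    then show ?thesis using e(3) by linarith
  qed
  define P where "P = (\<lambda>c \<sigma>. vec5 (z0 + c * n1) (cnj z0 + c * cnj n1) (w0 + c * n2) (cnj w0 + c * cnj n2) \<sigma>)"
  define P' where "P' = (\<lambda>c \<sigma>. vec5 (w0 + c * n2) (cnj w0 + c * cnj n2) (z0 + c * n1) (cnj z0 + c * cnj n1) \<sigma>)"
  have inP: "P c \<sigma> \<in> polydisc J (pt5 z0 w0 0) r" "P' c \<sigma> \<in> polydisc J (pt5 w0 z0 0) r'"
    if c: "c \<in> ball 0 e" and \<sigma>: "\<sigma> \<in> ball 0 e" for c \<sigma>
  proof -
    have "norm c < e" using c by simp
    note sm = small[OF this]
    have "norm (c * n1) < min r r' / 2" "norm (c * cnj n1) < min r r' / 2" "norm (c * n2) < min r r' / 2"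
      "norm (c * cnj n2) < min r r' / 2" "norm \<sigma> < min r r' / 2"
      using sm[of n1] sm[of "cnj n1"] sm[of n2] sm[of "cnj n2"] N \<sigma> en by simp_all
    then have "norm (c * n1) < r" "norm (c * cnj n1) < r" "norm (c * n2) < r" "norm (c * cnj n2) < r" "norm \<sigma> < r"
      "norm (c * n1) < r'" "norm (c * cnj n1) < r'" "norm (c * n2) < r'" "norm (c * cnj n2) < r'" "norm \<sigma> < r'"
      using r r' by linarith+
    then show "P c \<sigma> \<in> polydisc J (pt5 z0 w0 0) r" "P' c \<sigma> \<in> polydisc J (pt5 w0 z0 0) r'"
      unfolding polydisc_def J_def P_def P'_def by (simp_all add: pt5_def vec5_def dist_norm)
  qed
  define E where "E = (\<lambda>c \<sigma>. G (P c \<sigma>) - G' (P' c \<sigma>))"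
  have hol\<sigma>: "(\<lambda>\<sigma>. G (P c \<sigma>)) holomorphic_on ball 0 e" "(\<lambda>\<sigma>. G' (P' c \<sigma>)) holomorphic_on ball 0 e"
    if c: "c \<in> ball 0 e" for c
    by (rule curve_holomorphic_along[OF G open_ball _ inP(1)[OF c]],
        auto simp: J_def P_def vec5_def)
       (rule curve_holomorphic_along[OF G' open_ball _ inP(2)[OF c]],
        auto simp: J_def P'_def vec5_def)
  have holc: "(\<lambda>c. G (P c \<sigma>)) holomorphic_on ball 0 e" "(\<lambda>c. G' (P' c \<sigma>)) holomorphic_on ball 0 e"
    if \<sigma>: "\<sigma> \<in> ball 0 e" for \<sigma>
    by (rule curve_holomorphic_along[OF G open_ball _ inP(1)[OF _ \<sigma>]],
        auto simp: J_def P_def vec5_def intro!: holomorphic_intros)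
       (rule curve_holomorphic_along[OF G' open_ball _ inP(2)[OF _ \<sigma>]],
        auto simp: J_def P'_def vec5_def intro!: holomorphic_intros)
  have on_line: "P (of_real s) \<sigma> = vec5 z (cnj z) w (cnj w) \<sigma>" "P' (of_real s) \<sigma> = vec5 w (cnj w) z (cnj z) \<sigma>"
    "z \<in> ball z0 (r/2)" "w \<in> ball w0 (r/2)" "z \<in> ball z0 (r'/2)" "w \<in> ball w0 (r'/2)"
    if s: "\<bar>s\<bar> < e" and zw: "(z, w) = (z0, w0) + s *\<^sub>R m" for s z w \<sigma>
  proof -
    have zw': "z = z0 + of_real s * n1" "w = w0 + of_real s * n2" using zw by (simp_all add: m scaleR_conv_of_real)
    show "P (of_real s) \<sigma> = vec5 z (cnj z) w (cnj w) \<sigma>" "P' (of_real s) \<sigma> = vec5 w (cnj w) z (cnj z) \<sigma>"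
      by (simp_all add: P_def P'_def zw')
    have "norm (complex_of_real s) < e" using s by simp
    note sm = small[OF this]
    have "norm (of_real s * n1) < min r r' / 2" "norm (of_real s * n2) < min r r' / 2"
      using sm[of n1] sm[of n2] N by simp_all
    then show "z \<in> ball z0 (r/2)" "w \<in> ball w0 (r/2)" "z \<in> ball z0 (r'/2)" "w \<in> ball w0 (r'/2)"
      by (simp_all add: zw' dist_norm)
  qed
  have deriv_E: "(deriv ^^ k) (E (of_real s)) 0 / fact k = param_coef G k (z, w) - param_coef G' k (w, z)"
    if s: "\<bar>s\<bar> < e" and zw: "(z, w) = (z0, w0) + s *\<^sub>R m" for k s z w
  proof -
    have c: "of_real s \<in> ball (0::complex) e" using s by simp
    have "(deriv ^^ k) (E (of_real s)) 0
        = (deriv ^^ k) (\<lambda>\<sigma>. G (P (of_real s) \<sigma>)) 0 - (deriv ^^ k) (\<lambda>\<sigma>. G' (P' (of_real s) \<sigma>)) 0"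
      unfolding E_def by (rule higher_deriv_diff[OF hol\<sigma>[OF c] open_ball]) (use e in simp)
    then show ?thesis
      unfolding on_line(1,2)[OF s zw] by (simp add: param_coef_def diff_divide_distrib)
  qed
  have "(deriv ^^ n) (E 0) 0 = 0"
  proof (rule leading_coefficient_vanishes[OF e(1)])
    show "E c holomorphic_on ball 0 e" if "c \<in> ball 0 e" for c
      unfolding E_def by (intro holomorphic_on_diff hol\<sigma> that)
    show "(\<lambda>c. E c (of_real s)) holomorphic_on ball 0 e" if "\<bar>s\<bar> < e" for s
      unfolding E_def using that by (intro holomorphic_on_diff holc) simp_all
    show "norm (E c \<sigma>) \<le> M + M'" if "c \<in> ball 0 e" "\<sigma> \<in> ball 0 e" for c \<sigma>
      unfolding E_def
      using norm_triangle_ineq4[of "G (P c \<sigma>)" "G' (P' c \<sigma>)"]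
        curve_holomorphic_bound[OF G inP(1)[OF that]] curve_holomorphic_bound[OF G' inP(2)[OF that]] by linarith
    show "(deriv ^^ k) (E (of_real s)) 0 = 0" if k: "k < n" and s: "- e < s" "s < 0" for k s
    proof -
      obtain z w where zw: "(z, w) = (z0, w0) + s *\<^sub>R m" by (metis surj_pair)
      have se: "\<bar>s\<bar> < e" using s by simp
      have zwD: "(z, w) \<in> D 0" using b(2)[of "- s"] s e zw by simp
      note L = on_line(3-6)[OF se zw]
      have "bcoef k (z, w) = param_coef G k (z, w)" using eq[of "(z, w)"] L zwD closure_subset by auto
      moreover have "sw.bcoef k (w, z) = param_coef G' k (w, z)"
        using eq'[of "(w, z)"] L zwD closure_subset[of "D 0"] by (auto simp: closure_swap mem_swap_image)
      moreover have "bcoef k (z, w) = sw.bcoef k (w, z)"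
        using IH[OF k zwD] zwD by (simp add: bcoef_def sw.bcoef_def mem_swap_image)
      ultimately have "(deriv ^^ k) (E (of_real s)) 0 / fact k = 0" using deriv_E[OF se zw] by simp
      then show ?thesis by simp
    qed
    show "(h \<longlongrightarrow> 0) (at 0)" by (rule h)
    have ev1: "\<forall>\<^sub>F t in at 0. \<bar>h t\<bar> < e" using order_tendstoD(2)[OF tendsto_rabs_zero[OF h] e(1)] .
    have ev2: "\<forall>\<^sub>F t in at (0::real). \<bar>t\<bar> < e" unfolding eventually_at using e(1) by (intro exI[of _ e]) auto
    show "\<forall>\<^sub>F t in at 0. E (of_real (h t)) (of_real t) = 0"
      using ev1 ev2 hf
    proof eventually_elim
      case (elim t)
      obtain z w where zw: "(z, w) = (z0, w0) + h t *\<^sub>R m" by (metis surj_pair)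
      have fr: "(z, w) \<in> frontier (D t)" using elim(3) by (simp add: zw)
      then have cl: "(z, w) \<in> closure (D t)" by (simp add: frontier_def)
      note L = on_line[OF elim(1) zw]
      have nr: "dist z z0 < r" "dist w w0 < r" "\<bar>t\<bar> < r" "dist z z0 < r'" "dist w w0 < r'" "\<bar>t\<bar> < r'"
        using L(3-6) r r' elim(2) en by (auto simp: dist_commute)
      note X = ext[OF nr(1-3)] and X' = ext'[OF nr(5,4,6)]
      have "G (pt5 z w t) = f t (z, w)"
        using X cl ext_props(4)[of t z w] fr by auto
      moreover have "G' (pt5 w z t) = f t (z, w)"
        using X' cl sw.ext_props(4)[of t w z] fr by (auto simp: closure_swap frontier_swap mem_swap_image)
      ultimately show ?case unfolding E_def L(1,2) by (simp add: pt5_def)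
    qed
  qed
  then have "param_coef G n (z0, w0) = param_coef G' n (w0, z0)"
    using deriv_E[of 0 z0 w0 n] e(1) by simp
  moreover have "bcoef n (z0, w0) = param_coef G n (z0, w0)"
    using eq[of "(z0, w0)"] r p by (auto simp: frontier_def)
  moreover have "sw.bcoef n (w0, z0) = param_coef G' n (w0, z0)"
    using eq'[of "(w0, z0)"] r' p' by (auto simp: frontier_def)
  ultimately show ?thesis by simp
qed

text \<open>By induction on the order \<open>n\<close>. The boundary values \<open>q\<close> of the two \<open>n\<close>-th coefficients form a CR
  Hartogs function on \<open>D 0\<close>, hence extend holomorphically, and both coefficients equal the extension.\<close>

lemma coefs_agree: "(z, w) \<in> D 0 \<Longrightarrow> coef n (z, w) = sw.coef n (w, z)"
proof (induction n arbitrary: z w rule: less_induct)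
  case (less n)
  note agree = bcoef_agree_at_boundary[OF _ _ _ less.IH]
  define q where "q = (\<lambda>p. if slice (fst p) 0 \<noteq> {} then bcoef n p else sw.bcoef n (prod.swap p))"
  have q1: "q (z, w) = bcoef n (z, w)" if "slice z 0 \<noteq> {}" for z w
    using that by (simp add: q_def)
  have q2: "q (z, w) = sw.bcoef n (w, z)" if "(z, w) \<in> frontier (D 0)" "sw.slice w 0 \<noteq> {}" for z w
    using agree[of z w n] that by (simp add: q_def)
  have "continuous_on (frontier (D 0)) q"
    unfolding continuous_on_eq_continuous_within
  proof
    fix p assume p: "p \<in> frontier (D 0)"
    obtain z0 w0 where pz: "p = (z0, w0)" by (cases p)
    have p0: "(z0, w0) \<in> frontier (D 0)" using p pz by simp
    from transversal_cases[OF zero_in_range p0] show "continuous (at p within frontier (D 0)) q"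
    proof
      assume ne: "slice z0 0 \<noteq> {}"
      obtain r G where r: "r > 0"
        and ne: "\<And>z w t. dist z z0 < r \<Longrightarrow> dist w w0 < r \<Longrightarrow> \<bar>t\<bar> < r \<Longrightarrow> slice z t \<noteq> {}"
        and c: "continuous_on (ball z0 (r/2) \<times> ball w0 (r/2)) (param_coef G n)"
        and eq: "\<And>y. y \<in> ball z0 (r/2) \<times> ball w0 (r/2) \<Longrightarrow> y \<in> closure (D 0) \<Longrightarrow> bcoef n y = param_coef G n y"
        using bcoef_near_boundary[OF delta_pos p0 ne] by blast
      have "isCont (param_coef G n) p"
        using c r pz by (simp add: continuous_on_eq_continuous_at open_Times)
      then have "continuous (at p within frontier (D 0)) (param_coef G n)" by (rule continuous_at_imp_continuous_within)
      then show ?thesis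
      proof (rule continuous_transform_within[OF _ half_gt_zero[OF r] p])
        fix y assume y: "y \<in> frontier (D 0)" "dist y p < r/2"
        have d: "dist (fst y) z0 < r/2" "dist (snd y) w0 < r/2"
          using y(2) dist_fst_le[of y p] dist_snd_le[of y p] by (auto simp: pz)
        have "slice (fst y) 0 \<noteq> {}" using ne[of "fst y" "snd y" 0] d r by simp
        then have "q y = bcoef n y" by (simp add: q_def)
        moreover have "bcoef n y = param_coef G n y"
          using eq[of y] d y(1) by (auto simp: frontier_def dist_commute mem_Times_iff)
        ultimately show "param_coef G n y = q y" by simp
      qed
    next
      assume ne: "sw.slice w0 0 \<noteq> {}"
      have p': "(w0, z0) \<in> frontier (prod.swap ` D 0)" using p0 by (simp add: frontier_swap mem_swap_image)
      obtain r G where r: "r > 0"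
        and ne: "\<And>w z t. dist w w0 < r \<Longrightarrow> dist z z0 < r \<Longrightarrow> \<bar>t\<bar> < r \<Longrightarrow> sw.slice w t \<noteq> {}"
        and c: "continuous_on (ball w0 (r/2) \<times> ball z0 (r/2)) (param_coef G n)"
        and eq: "\<And>y. y \<in> ball w0 (r/2) \<times> ball z0 (r/2) \<Longrightarrow> y \<in> closure (prod.swap ` D 0) \<Longrightarrow> sw.bcoef n y = param_coef G n y"
        using sw.bcoef_near_boundary[OF delta_pos p' ne] by blast
      have c': "continuous_on (ball z0 (r/2) \<times> ball w0 (r/2)) (\<lambda>y. param_coef G n (prod.swap y))"
        by (rule continuous_on_compose2[OF c continuous_on_swap]) auto
      have "isCont (\<lambda>y. param_coef G n (prod.swap y)) p"
        using c' r pz by (simp add: continuous_on_eq_continuous_at open_Times)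
      then have "continuous (at p within frontier (D 0)) (\<lambda>y. param_coef G n (prod.swap y))" by (rule continuous_at_imp_continuous_within)
      then show ?thesis
      proof (rule continuous_transform_within[OF _ half_gt_zero[OF r] p])
        fix y assume y: "y \<in> frontier (D 0)" "dist y p < r/2"
        obtain z w where yz: "y = (z, w)" by (cases y)
        have d: "dist z z0 < r/2" "dist w w0 < r/2"
          using y(2) dist_fst_le[of y p] dist_snd_le[of y p] by (auto simp: pz yz)
        have "sw.slice w 0 \<noteq> {}" using ne[of w z 0] d r by simp
        then have "q y = sw.bcoef n (w, z)" using q2 y(1) by (simp add: yz)
        moreover have "sw.bcoef n (w, z) = param_coef G n (w, z)"
          using eq[of "(w, z)"] d y(1) by (auto simp: frontier_def dist_commute closure_swap mem_swap_image yz)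
        ultimately show "param_coef G n (prod.swap y) = q y" by (simp add: yz)
      qed
    qed
  qed
  moreover have "\<exists>g. continuous_on {w. (c, w) \<in> closure (D 0)} g \<and> g holomorphic_on {w. (c, w) \<in> D 0} \<and>
             (\<forall>w. (c, w) \<in> frontier (D 0) \<longrightarrow> g w = q (c, w))" if "{w. (c, w) \<in> D 0} \<noteq> {}" for c
  proof -
    have ne: "slice c 0 \<noteq> {}" using that by (simp add: slice_def)
    show ?thesis
      using bcoef_slice[OF delta_pos ne, of n] q1[OF ne] unfolding slice_closure[OF zero_in_range ne]
      unfolding slice_def by (intro exI[of _ "\<lambda>w. bcoef n (c, w)"]) simp
  qed
  moreover have "\<exists>g. continuous_on {z. (z, c) \<in> closure (D 0)} g \<and> g holomorphic_on {z. (z, c) \<in> D 0} \<and>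
             (\<forall>z. (z, c) \<in> frontier (D 0) \<longrightarrow> g z = q (z, c))" if "{z. (z, c) \<in> D 0} \<noteq> {}" for c
  proof -
    have ne: "sw.slice c 0 \<noteq> {}" using that by (simp add: sw_slice)
    show ?thesis
      using sw.bcoef_slice[OF delta_pos ne, of n] q2[OF _ ne] unfolding sw.slice_closure[OF zero_in_range ne]
      unfolding sw_slice by (intro exI[of _ "\<lambda>z. sw.bcoef n (c, z)"]) (simp add: closure_swap mem_swap_image)
  qed
  ultimately have "CRH_function (D 0) q" unfolding CRH_function_def by blast
  then have "CR_function (D 0) q" using CR0 unfolding CRH_eq_CR_def by blast
  then obtain Q where Q: "continuous_on (closure (D 0)) Q" "holomorphic2_on Q (D 0)" "\<And>p. p \<in> frontier (D 0) \<Longrightarrow> Q p = q p"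
    unfolding CR_function_def by blast
  note Qhol = holomorphic2_slices[OF Q(2) domain_props(2)[OF zero_in_range]]
  have zw: "(z, w) \<in> D 0" by (rule less.prems)
  have ne: "slice z 0 \<noteq> {}" using zw by (auto simp: slice_def)
  have ne': "sw.slice w 0 \<noteq> {}" using zw by (auto simp: sw_slice)
  have "Q (z, w) = bcoef n (z, w)"
  proof (rule holomorphic_eq_if_eq_on_frontier[where f = "\<lambda>w. Q (z, w)" and g = "\<lambda>w. bcoef n (z, w)",
        OF slice_open[OF zero_in_range] slice_bounded[OF zero_in_range] _ _ bcoef_slice[OF delta_pos ne]])
    show "continuous_on (closure (slice z 0)) (\<lambda>w. Q (z, w))"
      unfolding slice_closure[OF zero_in_range ne]
      by (rule continuous_on_compose2[OF Q(1)]) (auto intro!: continuous_intros)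
    show "(\<lambda>w. Q (z, w)) holomorphic_on slice z 0" using Qhol(1) by (simp add: slice_def)
    show "Q (z, w) = bcoef n (z, w)" if "w \<in> frontier (slice z 0)" for w
      using that Q(3) q1[OF ne] slice_frontier[OF zero_in_range ne] by simp
    show "w \<in> closure (slice z 0)" using zw closure_subset[of "slice z 0"] by (auto simp: slice_def)
  qed
  moreover have "Q (z, w) = sw.bcoef n (w, z)"
  proof (rule holomorphic_eq_if_eq_on_frontier[where f = "\<lambda>z. Q (z, w)" and g = "\<lambda>z. sw.bcoef n (w, z)",
        OF sw.slice_open[OF zero_in_range] sw.slice_bounded[OF zero_in_range] _ _ sw.bcoef_slice[OF delta_pos ne']])
    show "continuous_on (closure (sw.slice w 0)) (\<lambda>z. Q (z, w))"
      unfolding sw.slice_closure[OF zero_in_range ne']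
      by (rule continuous_on_compose2[OF Q(1)]) (auto intro!: continuous_intros simp: closure_swap mem_swap_image)
    show "(\<lambda>z. Q (z, w)) holomorphic_on sw.slice w 0" using Qhol(2) by (simp add: sw_slice)
    show "Q (z, w) = sw.bcoef n (w, z)" if "z \<in> frontier (sw.slice w 0)" for z
      using that Q(3) q2[OF _ ne'] sw.slice_frontier[OF zero_in_range ne'] by (simp add: frontier_swap mem_swap_image)
    show "z \<in> closure (sw.slice w 0)" using zw closure_subset[of "sw.slice w 0"] by (auto simp: sw_slice)
  qed
  moreover have "bcoef n (z, w) = coef n (z, w)" using zw by (simp add: bcoef_def)
  moreover have "sw.bcoef n (w, z) = sw.coef n (w, z)"
    unfolding sw.bcoef_def using zw by (simp only: mem_swap_image if_True)
  ultimately show ?case by (simp only:)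
qed

definition gap :: "(complex \<times> complex) \<times> real \<Rightarrow> complex" where
  "gap x = ext (fst (fst x)) (snd (fst x)) (snd x) - sw.ext (snd (fst x)) (fst (fst x)) (snd x)"

definition total :: "((complex \<times> complex) \<times> real) set" where
  "total = {x. \<bar>snd x\<bar> < \<delta> \<and> fst x \<in> D (snd x)}"

lemma open_total: "open total"
  unfolding open_dist
proof
  fix x assume x: "x \<in> total"
  obtain \<eta> where \<eta>: "\<eta> > 0" "\<And>q t. dist q (fst x) < \<eta> \<Longrightarrow> \<bar>t - snd x\<bar> < \<eta> \<Longrightarrow> \<bar>t\<bar> < \<delta> \<and> q \<in> D t"
    using inside_open[of "snd x" "fst x"] x unfolding total_def by auto
  have "y \<in> total" if "dist y x < \<eta>" for y
    using \<eta>(2)[of "fst y" "snd y"] dist_fst_le[of y x] dist_snd_le[of y x] that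
    by (simp add: total_def dist_real_def)
  then show "\<exists>e>0. \<forall>y. dist y x < e \<longrightarrow> y \<in> total" using \<eta>(1) by blast
qed

lemma gap_line_series:
  assumes x: "x \<in> total"
  shows "\<exists>a. has_series (\<lambda>s. gap (x + s *\<^sub>R v)) a"
proof -
  obtain z w t where xt: "x = ((z, w), t)" by (metis surj_pair)
  obtain \<zeta> \<omega> \<tau> where vt: "v = ((\<zeta>, \<omega>), \<tau>)" by (metis surj_pair)
  have t: "\<bar>t\<bar> < \<delta>" and zw: "(z, w) \<in> D t" using x by (auto simp: total_def xt)
  have wz: "(w, z) \<in> prod.swap ` D t" using zw by (simp add: mem_swap_image)
  obtain \<Omega> e \<alpha> where 1: "w \<in> \<Omega>" "e > 0" "\<forall>c\<in>\<Omega>. \<forall>s::real. \<bar>s\<bar> < e \<longrightarrow>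
        (\<lambda>k. \<alpha> k c * of_real s ^ k) sums ext (z + of_real s * \<zeta>) (c + of_real s * \<omega>) (t + s * \<tau>)"
    using ext_line_series[OF t zw, of \<zeta> \<omega> \<tau>] by blast
  obtain \<Omega>' e' \<beta> where 2: "z \<in> \<Omega>'" "e' > 0" "\<forall>c\<in>\<Omega>'. \<forall>s::real. \<bar>s\<bar> < e' \<longrightarrow>
        (\<lambda>k. \<beta> k c * of_real s ^ k) sums sw.ext (w + of_real s * \<omega>) (c + of_real s * \<zeta>) (t + s * \<tau>)"
    using sw.ext_line_series[OF t wz, of \<omega> \<zeta> \<tau>] by blast
  have s1: "has_series (\<lambda>s. ext (z + of_real s * \<zeta>) (w + of_real s * \<omega>) (t + s * \<tau>)) (\<lambda>k. \<alpha> k w)"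
    by (rule has_seriesI[OF 1(2)]) (use 1 in blast)
  have s2: "has_series (\<lambda>s. sw.ext (w + of_real s * \<omega>) (z + of_real s * \<zeta>) (t + s * \<tau>)) (\<lambda>k. \<beta> k z)"
    by (rule has_seriesI[OF 2(2)]) (use 2 in blast)
  have "gap (x + s *\<^sub>R v) = ext (z + of_real s * \<zeta>) (w + of_real s * \<omega>) (t + s * \<tau>)
      - sw.ext (w + of_real s * \<omega>) (z + of_real s * \<zeta>) (t + s * \<tau>)" for s
    by (simp add: gap_def xt vt scaleR_conv_of_real)
  then show ?thesis using has_series_diff[OF s1 s2] by auto
qed

text \<open>All Taylor coefficients in \<open>t\<close> vanish on \<open>D 0\<close>, so the gap vanishes at every point as long as the point stays in the
  domain. A ball of points stays in the domain for a common time.\<close>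

lemma gap_zero_initially: "\<exists>x\<in>total. snd x = 0 \<and> (\<exists>e>0. \<forall>y\<in>ball x e. gap y = 0)"
proof -
  obtain p where p: "p \<in> D 0" using domain_props(4)[OF zero_in_range] by blast
  obtain \<eta> where \<eta>: "\<eta> > 0" "\<And>q t. dist q p < \<eta> \<Longrightarrow> \<bar>t\<bar> < \<eta> \<Longrightarrow> \<bar>t\<bar> < \<delta> \<and> q \<in> D t"
    using inside_open[OF zero_in_range p] by auto
  have "gap y = 0" if y: "y \<in> ball (p, 0) \<eta>" for y
  proof -
    obtain q t where yq: "y = (q, t)" by (cases y)
    have q: "dist q p < \<eta>" and t: "\<bar>t\<bar> < \<eta>"
      using y dist_fst_le[of y "(p, 0)"] dist_snd_le[of y "(p, 0)"] by (auto simp: yq dist_commute dist_real_def)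
    have qD: "q \<in> D 0" using \<eta>(2)[OF q, of 0] \<eta>(1) by simp
    have qD': "prod.swap q \<in> prod.swap ` D 0" using qD by (rule imageI)
    have s1: "has_series (\<lambda>s. ext (fst q) (snd q) s) (\<lambda>k. coef k q)" by (rule coef_series[OF delta_pos qD])
    have s2: "has_series (\<lambda>s. sw.ext (snd q) (fst q) s) (\<lambda>k. sw.coef k (prod.swap q))"
      using sw.coef_series[OF delta_pos qD'] by simp
    have "coef k q = sw.coef k (prod.swap q)" for k using coefs_agree[of "fst q" "snd q" k] qD by (simp add: prod.swap_def)
    then have "has_series (\<lambda>s. gap (q, s)) (\<lambda>k. 0)"
      using has_series_diff[OF s1 s2] by (simp add: gap_def)
    from has_series_zero[OF this] obtain e where e: "e > 0" "\<And>s. \<bar>s\<bar> < e \<Longrightarrow> gap (q, s) = 0" by blast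
    have "gap (q, t) = 0"
    proof (rule has_series_identity[where S = "{-\<eta><..<\<eta>}" and g = "\<lambda>s. gap (q, s)" and ?z0.0 = 0 and e = e])
      fix s0 assume "s0 \<in> {-\<eta><..<\<eta>}"
      then have "(q, s0) \<in> total" using \<eta>(2)[OF q, of s0] by (auto simp: total_def)
      from gap_line_series[OF this, of "(0, 1)"] show "\<exists>a. has_series (\<lambda>s. gap (q, s0 + s)) a" by simp
    qed (use \<eta> e t in auto)
    then show ?thesis by (simp add: yq)
  qed
  moreover have "(p, 0) \<in> total" using p delta_pos by (simp add: total_def)
  ultimately show ?thesis using \<eta>(1) by (intro bexI[of _ "(p, 0)"]) auto
qed

text \<open>The set where the gap vanishes locally is open and closed in the total space, which is swept out
  by the connected domains over a connected parameter interval.\<close>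

lemma gap_zero:
  assumes "x \<in> total"
  shows "gap x = 0"
proof -
  define Z where "Z = {x\<in>total. \<exists>e>0. \<forall>y\<in>ball x e. gap y = 0}"
  have opZ: "open Z" unfolding open_dist
  proof
    fix x assume "x \<in> Z"
    then obtain e where e: "x \<in> total" "e > 0" "\<And>y. y \<in> ball x e \<Longrightarrow> gap y = 0" unfolding Z_def by blast
    obtain e' where e': "e' > 0" "\<And>y. dist y x < e' \<Longrightarrow> y \<in> total" using open_total e(1) unfolding open_dist by blast
    have "u \<in> Z" if u: "dist u x < min e' (e/2)" for u
    proof -
      have "gap y = 0" if "y \<in> ball u (e/2)" for y
        by (rule e(3)) (use u that dist_triangle[of x y u] in \<open>simp add: dist_commute\<close>)
      then show ?thesis using e(2) e'(2)[of u] u unfolding Z_def by (auto intro: exI[of _ "e/2"])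
    qed
    then show "\<exists>e>0. \<forall>y. dist y x < e \<longrightarrow> y \<in> Z" using e e' by (intro exI[of _ "min e' (e/2)"]) auto
  qed
  have clZ: "total \<inter> closure Z \<subseteq> Z"
  proof
    fix x assume x: "x \<in> total \<inter> closure Z"
    obtain r where r: "r > 0" "ball x r \<subseteq> total" using open_total x openE by blast
    obtain z where z: "z \<in> Z" "dist z x < r" using x r(1) closure_approachable by blast
    obtain e where e: "e > 0" "\<And>y. y \<in> ball z e \<Longrightarrow> gap y = 0" using z(1) unfolding Z_def by blast
    have "gap y = 0" if y: "y \<in> ball x r" for y
    proof -
      define S where "S = (\<lambda>s::real. z + s *\<^sub>R (y - z)) -` ball x r"
      define N where "N = norm (y - z) + 1"
      have N: "N > 0" by (simp add: N_def add_nonneg_pos)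
      have "gap (z + 1 *\<^sub>R (y - z)) = 0"
      proof (rule has_series_identity[where S = S and g = "\<lambda>s. gap (z + s *\<^sub>R (y - z))" and ?z0.0 = 0 and e = "e / N"])
        fix s0 assume "s0 \<in> S"
        then have "z + s0 *\<^sub>R (y - z) \<in> total" using r by (auto simp: S_def)
        from gap_line_series[OF this, of "y - z"]
        show "\<exists>a. has_series (\<lambda>s. gap (z + (s0 + s) *\<^sub>R (y - z))) a" by (simp add: scaleR_add_left add.assoc)
      next
        show "open S" unfolding S_def by (intro open_vimage open_ball continuous_intros)
        have "convex S"
        proof (rule convexI)
          fix a b u v :: real assume ab: "a \<in> S" "b \<in> S" and uv: "0 \<le> u" "0 \<le> v" "u + v = 1"
          have "u *\<^sub>R (z + a *\<^sub>R (y - z)) + v *\<^sub>R (z + b *\<^sub>R (y - z)) \<in> ball x r"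
            by (rule convexD[OF convex_ball]) (use ab uv in \<open>auto simp: S_def\<close>)
          moreover have "u *\<^sub>R (z + a *\<^sub>R (y - z)) + v *\<^sub>R (z + b *\<^sub>R (y - z)) = (u + v) *\<^sub>R z + (u * a + v * b) *\<^sub>R (y - z)"
            by (simp only: scaleR_add_right scaleR_add_left scaleR_scaleR) (simp add: add_ac)
          ultimately show "u *\<^sub>R a + v *\<^sub>R b \<in> S" using uv by (simp add: S_def)
        qed
        then show "connected S" by (rule convex_connected)
        show "0 \<in> S" "1 \<in> S" using z(2) y by (auto simp: S_def dist_commute)
        show "e / N > 0" using e N by simp
        fix s assume "\<bar>s - 0\<bar> < e / N"
        then have "\<bar>s\<bar> * N < e" using N by (simp add: pos_less_divide_eq)
        moreover have "\<bar>s\<bar> * norm (y - z) \<le> \<bar>s\<bar> * N" by (intro mult_left_mono) (auto simp: N_def)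
        ultimately have "norm (s *\<^sub>R (y - z)) < e" by simp
        then show "gap (z + s *\<^sub>R (y - z)) = 0" by (intro e(2)) (simp add: dist_norm)
      qed
      then show ?thesis by simp
    qed
    then show "x \<in> Z" using x r(1) unfolding Z_def by blast
  qed
  define T where "T = {t. \<exists>y. (y, t) \<in> Z}"
  have fibre: "(y, t) \<in> Z" if tT: "t \<in> T" and y: "(y, t) \<in> total" for y t
  proof -
    define C where "C = D t \<times> {t}"
    have t: "\<bar>t\<bar> < \<delta>" using y by (simp add: total_def)
    have sub: "C \<subseteq> total" using t by (auto simp: C_def total_def)
    have "connected C" unfolding C_def
      by (intro connected_Times convex_connected domain_props t) auto
    moreover have "openin (top_of_set C) (C \<inter> Z)" using opZ by (simp add: openin_open_Int)
    moreover have "closedin (top_of_set C) (C \<inter> Z)"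
    proof -
      have "C \<inter> Z = C \<inter> closure Z" using clZ sub closure_subset[of Z] by blast
      then show ?thesis by (simp add: closedin_closed_Int)
    qed
    ultimately have "C \<inter> Z = {} \<or> C \<inter> Z = C" unfolding connected_clopen by blast
    moreover have "C \<inter> Z \<noteq> {}" using tT by (auto simp: T_def C_def Z_def total_def)
    ultimately have "C \<subseteq> Z" by blast
    then show ?thesis using y by (auto simp: C_def total_def)
  qed
  define I where "I = {-\<delta><..<\<delta>}"
  have TI: "T \<subseteq> I" by (auto simp: T_def Z_def total_def I_def)
  have "open T" unfolding open_dist
  proof
    fix t assume "t \<in> T"
    then obtain y where "(y, t) \<in> Z" unfolding T_def by blast
    then obtain e where e: "e > 0" "\<And>x. dist x (y, t) < e \<Longrightarrow> x \<in> Z" using opZ unfolding open_dist by blast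
    have "t' \<in> T" if "dist t' t < e" for t'
    proof -
      have "(y, t') \<in> Z" using e(2)[of "(y, t')"] that by (simp add: dist_Pair_Pair)
      then show ?thesis unfolding T_def by blast
    qed
    then show "\<exists>e>0. \<forall>t'. dist t' t < e \<longrightarrow> t' \<in> T" using e(1) by blast
  qed
  then have opT: "openin (top_of_set I) T" using TI open_subset by blast
  have "I \<inter> closure T \<subseteq> T"
  proof
    fix t assume t: "t \<in> I \<inter> closure T"
    then have td: "\<bar>t\<bar> < \<delta>" by (auto simp: I_def)
    obtain y where y: "y \<in> D t" using domain_props(4)[OF td] by blast
    obtain \<eta> where \<eta>: "\<eta> > 0" "\<And>q t'. dist q y < \<eta> \<Longrightarrow> \<bar>t' - t\<bar> < \<eta> \<Longrightarrow> \<bar>t'\<bar> < \<delta> \<and> q \<in> D t'"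
      using inside_open[OF td y] by blast
    have "(y, t) \<in> closure Z" unfolding closure_approachable
    proof (intro allI impI)
      fix e :: real assume e: "e > 0"
      obtain t' where t': "t' \<in> T" "dist t' t < min e \<eta>"
        using t e \<eta>(1) closure_approachable[of t T] by (metis IntD2 min_less_iff_conj)
      have "(y, t') \<in> total" using \<eta>(2)[of y t'] \<eta>(1) t' by (simp add: total_def dist_real_def)
      from fibre[OF t'(1) this] show "\<exists>x\<in>Z. dist x (y, t) < e"
        using t' by (intro bexI[of _ "(y, t')"]) (auto simp: dist_Pair_Pair)
    qed
    moreover have "(y, t) \<in> total" using y td by (simp add: total_def)
    ultimately have "(y, t) \<in> Z" using clZ by blast
    then show "t \<in> T" unfolding T_def by blast
  qed
  then have "T = I \<inter> closure T" using TI closure_subset[of T] by blast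
  then have "closedin (top_of_set I) T" using closedin_closed_Int[of "closure T" I] by simp
  moreover have "connected I" by (simp add: I_def)
  ultimately have "T = {} \<or> T = I" using opT unfolding connected_clopen by blast
  moreover have "0 \<in> T"
  proof -
    obtain x where x: "x \<in> total" "snd x = 0" "\<exists>e>0. \<forall>y\<in>ball x e. gap y = 0" using gap_zero_initially by blast
    then have "x \<in> Z" unfolding Z_def by blast
    then have "(fst x, 0) \<in> Z" using x(2) by (metis prod.collapse)
    then show ?thesis unfolding T_def by blast
  qed
  ultimately have "snd x \<in> T" using assms by (auto simp: total_def I_def)
  then have "x \<in> Z" using fibre[of "snd x" "fst x"] assms by simp
  then show ?thesis unfolding Z_def by auto
qed

text \<open>The common extension is separately holomorphic and bounded. Its continuity at a boundary point is seen
  in a slice direction that meets the domain.\<close>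

lemma CR_family:
  assumes t: "\<bar>t\<bar> < \<delta>"
  shows "CR_function (D t) (f t)"
proof -
  have eq: "ext z w t = sw.ext w z t" if "(z, w) \<in> D t" for z w
    using gap_zero[of "((z, w), t)"] that t by (simp add: gap_def total_def)
  obtain M where M: "\<And>z w. (z, w) \<in> D t \<Longrightarrow> norm (ext z w t) \<le> M" using ext_bounded[OF t] by blast
  define F where "F = (\<lambda>y. if y \<in> D t then ext (fst y) (snd y) t else f t y)"
  have op: "open (D t)" by (rule domain_props(2)[OF t])
  have Fd: "\<exists>a b. (F has_derivative (\<lambda>(u, v). a * u + b * v)) (at p)" if p: "p \<in> D t" for p
  proof -
    obtain a b where pab: "p = (a, b)" by (cases p)
    obtain e where e: "e > 0" "ball p e \<subseteq> D t" using op p openE by blast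
    define r where "r = e / 2"
    have r: "r > 0" using e by (simp add: r_def)
    have box: "(u, v) \<in> D t" if "u \<in> ball a r" "v \<in> ball b r" for u v
    proof -
      have "dist (a, b) (u, v) \<le> dist a u + dist b v"
        unfolding dist_Pair_Pair by (rule sqrt_sum_squares_le_sum) simp_all
      also have "\<dots> < e" using that by (simp add: r_def)
      finally show ?thesis using e(2) by (auto simp: pab)
    qed
    have cen: "a \<in> ball a r" "b \<in> ball b r" using r by auto
    define h where "h = (\<lambda>y. ext (fst y) (snd y) t)"
    have "(h has_derivative (\<lambda>(u, v). deriv (\<lambda>u. h (u, b)) a * u + deriv (\<lambda>v. h (a, v)) b * v)) (at (a, b))"
    proof (rule separately_holomorphic_has_derivative[OF r])
      show "norm (h (u, v)) \<le> M" if "u \<in> ball a r" "v \<in> ball b r" for u v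
        using M[OF box[OF that]] by (simp add: h_def)
    next
      fix v assume v: "v \<in> ball b r"
      have ne: "sw.slice v t \<noteq> {}" using box[OF cen(1) v] by (auto simp: sw_slice)
      have "(\<lambda>u. sw.ext v u t) holomorphic_on ball a r"
        by (rule holomorphic_on_subset[OF sw.ext_props(2)[OF t ne]]) (use box v in \<open>auto simp: sw_slice\<close>)
      then show "(\<lambda>u. h (u, v)) holomorphic_on ball a r"
        by (rule holomorphic_transform) (use eq box v in \<open>auto simp: h_def\<close>)
    next
      fix u assume u: "u \<in> ball a r"
      have ne: "slice u t \<noteq> {}" using box[OF u cen(2)] by (auto simp: slice_def)
      show "(\<lambda>v. h (u, v)) holomorphic_on ball b r" unfolding h_def fst_conv snd_conv
        by (rule holomorphic_on_subset[OF ext_props(2)[OF t ne]]) (use box u in \<open>auto simp: slice_def\<close>)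
    qed
    then have "(F has_derivative (\<lambda>(u, v). deriv (\<lambda>u. h (u, b)) a * u + deriv (\<lambda>v. h (a, v)) b * v)) (at p)"
      unfolding pab by (rule has_derivative_transform_within_open[OF _ op]) (use p in \<open>auto simp: F_def h_def pab\<close>)
    then show ?thesis by blast
  qed
  have "holomorphic2_on F (D t)" unfolding holomorphic2_on_def
  proof
    fix p assume "p \<in> D t"
    from Fd[OF this] show "\<exists>a b. (F has_derivative (\<lambda>(u, v). a * u + b * v)) (at p within D t)"
      using has_derivative_at_withinI by blast
  qed
  moreover have Ff: "F p = f t p" if "p \<in> frontier (D t)" for p
    using that op by (simp add: F_def frontier_def interior_open)
  moreover have "continuous_on (closure (D t)) F" unfolding continuous_on_eq_continuous_within
  proof
    fix p assume p: "p \<in> closure (D t)"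
    show "continuous (at p within closure (D t)) F"
    proof (cases "p \<in> D t")
      case True
      then show ?thesis using Fd[OF True] has_derivative_continuous continuous_at_imp_continuous_within by blast
    next
      case False
      obtain z w where pz: "p = (z, w)" by (cases p)
      have fr: "(z, w) \<in> frontier (D t)" using p False op by (simp add: frontier_def interior_open pz)
      from transversal_cases[OF t fr] show ?thesis
      proof
        assume ne: "slice z t \<noteq> {}"
        show ?thesis unfolding pz
          by (rule ext_continuous_boundary[OF t fr ne]) (use Ff in \<open>auto simp: F_def\<close>)
      next
        assume ne: "sw.slice w t \<noteq> {}"
        have fr': "(w, z) \<in> frontier (prod.swap ` D t)" using fr by (simp add: frontier_swap mem_swap_image)
        have "continuous (at (w, z) within closure (prod.swap ` D t)) (\<lambda>y. F (prod.swap y))"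
        proof (rule sw.ext_continuous_boundary[OF t fr' ne])
          fix w z assume "(w, z) \<in> prod.swap ` D t"
          then have "(z, w) \<in> D t" by (simp add: mem_swap_image)
          then show "F (prod.swap (w, z)) = sw.ext w z t" using eq by (simp add: F_def)
        next
          fix y assume "y \<in> frontier (prod.swap ` D t)"
          then have "prod.swap y \<in> frontier (D t)" unfolding frontier_swap by auto
          then show "F (prod.swap y) = (f t \<circ> prod.swap) y" using Ff by simp
        qed
        then have c: "continuous (at (prod.swap (z, w)) within prod.swap ` closure (D t)) (\<lambda>y. F (prod.swap y))"
          by (simp add: closure_swap)
        have "continuous (at (z, w) within closure (D t)) prod.swap"
          using continuous_on_swap continuous_on_eq_continuous_within[of UNIV prod.swap]
            continuous_within_subset by (metis UNIV_I subset_UNIV)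
        from continuous_within_compose[OF this c] show ?thesis by (simp add: pz o_def)
      qed
    qed
  qed
  moreover have "continuous_on (frontier (D t)) (f t)" using CRH[OF t] by (simp add: CRH_function_def)
  ultimately show ?thesis unfolding CR_function_def by blast
qed

end

section \<open>Variations of CR Hartogs functions\<close>

lemma strictly_convex_domain_imp_convex: "strictly_convex_domain D \<Longrightarrow> convex D"
  unfolding strictly_convex_domain_def convex_contains_open_segment
  by (metis closure_subset empty_subsetI open_segment_idem subsetD)

lemma unit_normal_field_norm: "unit_normal_field D \<nu> \<Longrightarrow> x \<in> frontier D \<Longrightarrow> norm (\<nu> x) = 1"
  unfolding unit_normal_field_def analytic_defining_function_def by (metis norm_sgn)

lemma unit_normal_field_inward:
  assumes \<nu>: "unit_normal_field D \<nu>" and p: "p \<in> frontier D"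
  shows "\<forall>\<^sub>F s in at_right 0. p - s *\<^sub>R \<nu> p \<in> D"
proof -
  obtain V \<rho> g where df: "analytic_defining_function D p V \<rho> g" and n: "\<nu> p = sgn g"
    using \<nu> p unfolding unit_normal_field_def by blast
  have "g \<noteq> 0" using df by (simp add: analytic_defining_function_def)
  then have "g \<bullet> (- sgn g) < 0" by (simp add: sgn_div_norm dot_square_norm power2_eq_square)
  then obtain e where e: "e > 0" "\<And>s. 0 < s \<Longrightarrow> s < e \<Longrightarrow> p + s *\<^sub>R (- sgn g) \<in> D"
    using inward_direction_enters[OF df p] by blast
  then show ?thesis unfolding eventually_at_right_field by (intro exI[of _ e]) (simp add: n)
qed

theorem theorem5:
  fixes D :: "real \<Rightarrow> (complex \<times> complex) set"
    and f :: "real \<Rightarrow> complex \<times> complex \<Rightarrow> complex"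
    and \<delta> :: real
  assumes "\<delta> > 0"
    and "\<And>t. \<bar>t\<bar> < \<delta> \<Longrightarrow> bounded (D t) \<and> strictly_convex_domain (D t)"
    and "has_real_analytic_boundary (D 0)"
    and "real_analytic_variation \<delta> D"
    and "real_analytic_CRH_variation \<delta> D f"
    and "CRH_eq_CR (D 0)"
  shows "\<forall>t. \<bar>t\<bar> < \<delta> \<longrightarrow> CR_function (D t) (f t)"
proof -
  define I where "I = {-\<delta><..<\<delta>}"
  have I: "t \<in> I \<longleftrightarrow> \<bar>t\<bar> < \<delta>" for t by (auto simp: I_def)
  obtain \<nu> W \<pi> \<sigma> h where \<nu>: "unit_normal_field (D 0) \<nu>" and "normal_coordinates (D 0) \<nu> W \<pi> \<sigma>"
    and han: "real_analytic_on (\<lambda>(x, t). h x t) (frontier (D 0) \<times> I)"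
    and h0: "\<forall>x\<in>frontier (D 0). h x 0 = 0"
    and "\<forall>t\<in>I. \<forall>x\<in>frontier (D 0). x + h x t *\<^sub>R \<nu> x \<in> W \<and>
           \<pi> (x + h x t *\<^sub>R \<nu> x) = x \<and> \<sigma> (x + h x t *\<^sub>R \<nu> x) = h x t"
    and fr': "\<forall>t\<in>I. frontier (D t) = (\<lambda>x. x + h x t *\<^sub>R \<nu> x) ` frontier (D 0)"
    using assms(4) unfolding real_analytic_variation_def I_def by (elim exE conjE)
  note fr = bspec[OF fr']
  have zI: "0 \<in> I" using assms(1) by (simp add: I)
  have hc: "continuous_on (frontier (D 0) \<times> I) (\<lambda>(x, t). h x t)"
    by (rule real_analytic_on_imp_continuous_on[OF han])
  have cpt: "compact (frontier (D 0))"
    using assms(2)[of 0] assms(1) by (simp add: compact_frontier_bounded)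
  have uniform: "\<exists>\<eta>>0. \<forall>t'. \<bar>t' - t\<bar> < \<eta> \<longrightarrow> t' \<in> I \<and> (\<forall>x\<in>frontier (D 0). \<bar>h x t' - h x t\<bar> < e)"
    if t: "t \<in> I" and e: "e > 0" for t e
  proof -
    have "open I" by (simp add: I_def)
    then obtain r where r: "r > 0" "cball t r \<subseteq> I" using t open_contains_cball by blast
    have "uniformly_continuous_on (frontier (D 0) \<times> cball t r) (\<lambda>(x, t). h x t)"
      by (intro compact_uniformly_continuous continuous_on_subset[OF hc] compact_Times cpt) (use r in auto)
    then obtain d where d: "d > 0" "\<And>y y'. y \<in> frontier (D 0) \<times> cball t r \<Longrightarrow> y' \<in> frontier (D 0) \<times> cball t r \<Longrightarrow>
        dist y' y < d \<Longrightarrow> dist ((\<lambda>(x, t). h x t) y') ((\<lambda>(x, t). h x t) y) < e"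
      unfolding uniformly_continuous_on_def using e by metis
    have "t' \<in> I \<and> (\<forall>x\<in>frontier (D 0). \<bar>h x t' - h x t\<bar> < e)" if t': "\<bar>t' - t\<bar> < min r d" for t'
    proof
      have "t' \<in> cball t r" using t' by (simp add: dist_real_def abs_minus_commute)
      then show "t' \<in> I" using r by blast
      show "\<forall>x\<in>frontier (D 0). \<bar>h x t' - h x t\<bar> < e"
      proof
        fix x assume x: "x \<in> frontier (D 0)"
        have "dist (x, t') (x, t) < d" using t' by (simp add: dist_Pair_Pair dist_real_def)
        then show "\<bar>h x t' - h x t\<bar> < e"
          using d(2)[of "(x, t)" "(x, t')"] x r(1) \<open>t' \<in> cball t r\<close> by (simp add: dist_real_def)
      qed
    qed
    then show ?thesis using r d by (intro exI[of _ "min r d"]) auto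
  qed
  have move: "dist (x + h x t *\<^sub>R \<nu> x) (x + h x t' *\<^sub>R \<nu> x) = \<bar>h x t - h x t'\<bar>" if "x \<in> frontier (D 0)" for x t t'
    using unit_normal_field_norm[OF \<nu> that] by (simp add: dist_norm flip: scaleR_left_diff_distrib)
  interpret hartogs_family_CR \<delta> D f
  proof
    fix t :: real assume t: "\<bar>t\<bar> < \<delta>"
    show "bounded (D t) \<and> open (D t) \<and> convex (D t) \<and> D t \<noteq> {}"
      using assms(2)[OF t] strictly_convex_domain_imp_convex by (auto simp: strictly_convex_domain_def)
    show "CRH_function (D t) (f t)" using assms(5) t I unfolding real_analytic_CRH_variation_def I_def by blast
  next
    fix t z w assume "\<bar>t\<bar> < \<delta>" "(z, w) \<in> frontier (D t)"
    then show "locally_complexified \<delta> D f z w t" by (rule variation_locally_complexified[OF assms(4,5)])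
  next
    fix t e :: real assume t: "\<bar>t\<bar> < \<delta>" and e: "e > 0"
    obtain \<eta> where \<eta>: "\<eta> > 0" "\<And>t'. \<bar>t' - t\<bar> < \<eta> \<Longrightarrow> t' \<in> I"
      "\<And>t' x. \<bar>t' - t\<bar> < \<eta> \<Longrightarrow> x \<in> frontier (D 0) \<Longrightarrow> \<bar>h x t' - h x t\<bar> < e"
      using uniform[OF _ e, of t] t I by blast
    have tI: "t \<in> I" using t I by simp
    have "\<bar>t'\<bar> < \<delta> \<and> (\<forall>y\<in>frontier (D t'). \<exists>y'\<in>frontier (D t). dist y y' < e) \<and>
           (\<forall>y\<in>frontier (D t). \<exists>y'\<in>frontier (D t'). dist y y' < e)" if t': "\<bar>t' - t\<bar> < \<eta>" for t'
    proof (intro conjI ballI)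
      show "\<bar>t'\<bar> < \<delta>" using \<eta>(2)[OF t'] I by simp
      fix y
      {
        assume "y \<in> frontier (D t')"
        then obtain x where x: "x \<in> frontier (D 0)" "y = x + h x t' *\<^sub>R \<nu> x" using fr[OF \<eta>(2)[OF t']] by blast
        have "dist y (x + h x t *\<^sub>R \<nu> x) < e" unfolding x(2) move[OF x(1)] by (rule \<eta>(3)[OF t' x(1)])
        then show "\<exists>y'\<in>frontier (D t). dist y y' < e" using fr[OF tI] x(1) by blast
      }
      {
        assume "y \<in> frontier (D t)"
        then obtain x where x: "x \<in> frontier (D 0)" "y = x + h x t *\<^sub>R \<nu> x" using fr[OF tI] by blast
        have "dist y (x + h x t' *\<^sub>R \<nu> x) < e"
          unfolding x(2) move[OF x(1)] using \<eta>(3)[OF t' x(1)] by (simp add: abs_minus_commute)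
        then show "\<exists>y'\<in>frontier (D t'). dist y y' < e" using fr[OF \<eta>(2)[OF t']] x(1) by blast
      }
    qed
    then show "\<exists>\<eta>>0. \<forall>t'. \<bar>t' - t\<bar> < \<eta> \<longrightarrow> \<bar>t'\<bar> < \<delta> \<and>
           (\<forall>y\<in>frontier (D t'). \<exists>y'\<in>frontier (D t). dist y y' < e) \<and>
           (\<forall>y\<in>frontier (D t). \<exists>y'\<in>frontier (D t'). dist y y' < e)" using \<eta>(1) by blast
  next
    show "\<delta> > 0" "CRH_eq_CR (D 0)" by (rule assms)+
  next
    fix p assume p: "p \<in> frontier (D 0)"
    have "(h p \<longlongrightarrow> 0) (at 0)" unfolding tendsto_iff
    proof (intro allI impI)
      fix e :: real assume e: "e > 0"
      obtain \<eta> where \<eta>: "\<eta> > 0"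
        "\<forall>t'. \<bar>t' - 0\<bar> < \<eta> \<longrightarrow> t' \<in> I \<and> (\<forall>x\<in>frontier (D 0). \<bar>h x t' - h x 0\<bar> < e)"
        using uniform[OF zI e] by (elim exE conjE)
      have "\<bar>h p t'\<bar> < e" if "\<bar>t'\<bar> < \<eta>" for t'
      proof -
        have "\<forall>x\<in>frontier (D 0). \<bar>h x t' - h x 0\<bar> < e" using \<eta>(2)[rule_format, of t'] that by simp
        from bspec[OF this p] bspec[OF h0 p] show ?thesis by simp
      qed
      then show "\<forall>\<^sub>F t in at 0. dist (h p t) 0 < e"
        unfolding eventually_at using \<eta>(1) by (intro exI[of _ \<eta>]) (simp add: dist_real_def)
    qed
    moreover have "p + h p t *\<^sub>R \<nu> p \<in> frontier (D t)" if "\<bar>t\<bar> < \<delta>" for t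
      unfolding fr[OF I[THEN iffD2, OF that]] using p by (rule imageI)
    then have "\<forall>\<^sub>F t in at 0. p + h p t *\<^sub>R \<nu> p \<in> frontier (D t)"
      unfolding eventually_at using assms(1) by (intro exI[of _ \<delta>]) (simp add: dist_real_def)
    ultimately show "\<exists>n h. (\<forall>\<^sub>F s in at_right 0. p - s *\<^sub>R n \<in> D 0) \<and> (h \<longlongrightarrow> 0) (at 0) \<and>
        (\<forall>\<^sub>F t in at 0. p + h t *\<^sub>R n \<in> frontier (D t))"
      using unit_normal_field_inward[OF \<nu> p] by blast
  qed
  show ?thesis using CR_family by blast
qed

end
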